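(* Let $G$ be a finite group and $(\pi,V)$ an irreducible complex representation of $G$ of dimension $n$. Let $m$ be an even natural number with $g^m=1$ for all $g\in G$, let $K_0=\mathbb{Q}(\mu_{nm})\subseteq\mathbb{C}$, and let $K$ be a field extension of $K_0$ containing at least $n$ elements which are algebraically independent over $K_0$, with algebraic closure $\overline{K}\subseteq\mathbb{C}$. Assume there exists $g^*\in G$ such that $\pi(g^* )$ is a regular element of $\mathrm{GL}_n(\overline{K})$. Then there exists a basis $\{x_1,\dots,x_n\}$ of $V$, in which $\pi(G)\subseteq\mathrm{GL}_n(K)$, such that the set $K^{\times}\,\mathrm{Im}(\Pi)$ is Zariski dense in $\mathrm{GL}_n(\overline{K})$.
   Context: $\mu_k$ denotes the group of $k$-th roots of unity in $\mathbb{C}$. A semisimple element of $\mathrm{GL}_n$ is regular if the dimension of its centralizer equals $n$, i.e. its eigenvalues are pairwise distinct. Given a basis $\{x_1,\dots,x_n\}$ of $V$, let $\pi_n$ be the permutation representation of $S_n$ on $V$, $\pi_n(p)(\sum c_ix_i)=\sum c_ix_{p(i)}$; $\Pi=\pi\ast\pi_n: G\ast S_n\to\mathrm{GL}_n(\mathbb{C})$ is the homomorphism from the free product $G\ast S_n$ induced by $\pi$ (written as matrices in the basis $\{x_i\}$) and $\pi_n$. *)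

theory Defs
  imports
    "HOL-Algebra.Sym_Groups"
    "HOL-Algebra.Generated_Fields"
    "HOL-Algebra.Algebraic_Closure_Type"
    "HOL-Analysis.Abstract_Topology"
    "HOL-Library.Poly_Mapping"
    "Jordan_Normal_Form.Char_Poly"
begin

section \<open>Multivariate polynomials and fields of complex numbers\<close>

type_synonym 'i mpoly = "('i \<Rightarrow>\<^sub>0 nat) \<Rightarrow>\<^sub>0 complex"

text \<open>The polynomial ring \<open>L[X\<^sub>i | i \<in> I]\<close>, inside the polynomials with complex coefficients.\<close>

definition mpolys :: "complex set \<Rightarrow> 'i set \<Rightarrow> 'i mpoly set" where
  "mpolys L I = {p. (\<forall>m. Poly_Mapping.lookup p m \<in> L) \<and>
                    (\<forall>m\<in>Poly_Mapping.keys p. Poly_Mapping.keys m \<subseteq> I)}"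

definition mpoly_eval :: "('i \<Rightarrow> complex) \<Rightarrow> 'i mpoly \<Rightarrow> complex" where
  "mpoly_eval x p = (\<Sum>m\<in>Poly_Mapping.keys p.
     Poly_Mapping.lookup p m * (\<Prod>i\<in>Poly_Mapping.keys m. x i ^ Poly_Mapping.lookup m i))"

abbreviation complex_field :: "complex ring" where
  "complex_field \<equiv> ring_of_type_algebra"

definition roots_of_unity :: "nat \<Rightarrow> complex set" where
  "roots_of_unity k = {z. z ^ k = 1}"

definition cyclotomic_field :: "nat \<Rightarrow> complex set" where
  "cyclotomic_field k = generate_field complex_field (roots_of_unity k)"

text \<open>The algebraic closure of \<open>K\<close> inside the complex numbers.\<close>

definition algebraic_closure_in_complex :: "complex set \<Rightarrow> complex set" where
  "algebraic_closure_in_complex K =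
     {z. \<exists>p :: complex poly. p \<noteq> 0 \<and> (\<forall>i. coeff p i \<in> K) \<and> poly p z = 0}"

definition algebraically_independent ::
    "complex set \<Rightarrow> 'i set \<Rightarrow> ('i \<Rightarrow> complex) \<Rightarrow> bool" where
  "algebraically_independent F I t \<longleftrightarrow>
     (\<forall>p\<in>mpolys F I. mpoly_eval t p = 0 \<longrightarrow> p = 0)"

lemma mpoly_monomials:
  fixes p :: "'a \<Rightarrow>\<^sub>0 'b :: comm_monoid_add"
  shows "p = (\<Sum>m\<in>Poly_Mapping.keys p. Poly_Mapping.single m (Poly_Mapping.lookup p m))"
proof (rule poly_mapping_eqI)
  fix k
  have "Poly_Mapping.lookup p k =
      (\<Sum>m\<in>Poly_Mapping.keys p. if m = k then Poly_Mapping.lookup p m else 0)"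
    by (subst sum.delta) (auto simp: in_keys_iff)
  then show "Poly_Mapping.lookup p k = Poly_Mapping.lookup
      (\<Sum>m\<in>Poly_Mapping.keys p. Poly_Mapping.single m (Poly_Mapping.lookup p m)) k"
    by (simp only: lookup_sum lookup_single when_def)
qed

lemma mpoly_eval_add: "mpoly_eval x (p + q) = mpoly_eval x p + mpoly_eval x q"
  unfolding mpoly_eval_def
  by (rule setsum_keys_plus_distrib[where
        f = "\<lambda>m c. c * (\<Prod>i\<in>Poly_Mapping.keys m. x i ^ Poly_Mapping.lookup m i)"])
     (auto simp: algebra_simps)

lemma mpoly_eval_sum: "finite S \<Longrightarrow> mpoly_eval x (sum f S) = (\<Sum>s\<in>S. mpoly_eval x (f s))"
  by (induction S rule: finite_induct) (auto simp: mpoly_eval_add, simp add: mpoly_eval_def)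

lemma monomial_eval_add:
  fixes x :: "'i \<Rightarrow> complex" and a b :: "'i \<Rightarrow>\<^sub>0 nat"
  shows "(\<Prod>i\<in>Poly_Mapping.keys (a + b). x i ^ Poly_Mapping.lookup (a + b) i) =
    (\<Prod>i\<in>Poly_Mapping.keys a. x i ^ Poly_Mapping.lookup a i) *
    (\<Prod>i\<in>Poly_Mapping.keys b. x i ^ Poly_Mapping.lookup b i)"
proof -
  have *: "(\<Prod>i\<in>Poly_Mapping.keys c. x i ^ Poly_Mapping.lookup c i) =
      (\<Prod>i\<in>Poly_Mapping.keys a \<union> Poly_Mapping.keys b. x i ^ Poly_Mapping.lookup c i)"
    if "Poly_Mapping.keys c \<subseteq> Poly_Mapping.keys a \<union> Poly_Mapping.keys b" for c
    by (rule prod.mono_neutral_left) (use that in \<open>auto simp: in_keys_iff\<close>)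
  show ?thesis
    by (subst (1 2 3) *) (auto simp: Poly_Mapping.keys_add lookup_add power_add prod.distrib
        dest: subsetD[OF Poly_Mapping.keys_add])
qed

lemma mpoly_mult_expand:
  fixes p q :: "'i mpoly"
  shows "p * q = (\<Sum>a\<in>Poly_Mapping.keys p. \<Sum>b\<in>Poly_Mapping.keys q.
    Poly_Mapping.single (a + b) (Poly_Mapping.lookup p a * Poly_Mapping.lookup q b))"
  by (subst mpoly_monomials[of p], subst mpoly_monomials[of q])
     (simp add: sum_product Poly_Mapping.mult_single)

lemma mpoly_eval_mult: "mpoly_eval x (p * q) = mpoly_eval x p * mpoly_eval x q"
proof -
  have 1: "mpoly_eval x (Poly_Mapping.single m c) =
      c * (\<Prod>i\<in>Poly_Mapping.keys m. x i ^ Poly_Mapping.lookup m i)" for m c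
    by (auto simp: mpoly_eval_def)
  have "mpoly_eval x (p * q) = (\<Sum>a\<in>Poly_Mapping.keys p. \<Sum>b\<in>Poly_Mapping.keys q.
      Poly_Mapping.lookup p a * Poly_Mapping.lookup q b *
      (\<Prod>i\<in>Poly_Mapping.keys (a + b). x i ^ Poly_Mapping.lookup (a + b) i))"
    by (subst mpoly_mult_expand) (simp add: mpoly_eval_sum 1)
  also have "\<dots> = mpoly_eval x p * mpoly_eval x q"
    unfolding mpoly_eval_def sum_product by (simp add: monomial_eval_add mult_ac)
  finally show ?thesis .
qed

lemma mpolys_mult:
  assumes "subring L complex_field" and p: "p \<in> mpolys L I" and q: "q \<in> mpolys L I"
  shows "p * q \<in> mpolys L I"
proof -
  have L: "0 \<in> L" "\<And>a b. a \<in> L \<Longrightarrow> b \<in> L \<Longrightarrow> a + b \<in> L" "\<And>a b. a \<in> L \<Longrightarrow> b \<in> L \<Longrightarrow> a * b \<in> L"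
    using subringE[OF assms(1)] by (auto simp: ring_of_type_algebra_def)
  have sumL: "sum f S \<in> L" if "\<And>s. s \<in> S \<Longrightarrow> f s \<in> L" for f :: "('i \<Rightarrow>\<^sub>0 nat) \<Rightarrow> complex" and S
    using that by (induction S rule: infinite_finite_induct) (auto intro: L)
  have "Poly_Mapping.lookup (p * q) m \<in> L" for m
    using p q by (subst mpoly_mult_expand)
      (auto simp: lookup_sum lookup_single when_def mpolys_def intro!: sumL L)
  moreover have "Poly_Mapping.keys m \<subseteq> I" if m: "m \<in> Poly_Mapping.keys (p * q)" for m
  proof -
    obtain a b where "m = a + b" "a \<in> Poly_Mapping.keys p" "b \<in> Poly_Mapping.keys q"
      using m Poly_Mapping.keys_mult[of p q] by blast
    then show ?thesis
      using p q Poly_Mapping.keys_add[of a b] by (force simp: mpolys_def)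
  qed
  ultimately show ?thesis
    by (auto simp: mpolys_def)
qed

section \<open>The general linear group and its Zariski topology\<close>

definition mat_space :: "nat \<Rightarrow> complex set \<Rightarrow> complex mat set" where
  "mat_space n L = {A \<in> carrier_mat n n. \<forall>i<n. \<forall>j<n. A $$ (i, j) \<in> L}"

definition GL :: "nat \<Rightarrow> complex set \<Rightarrow> complex mat monoid" where
  "GL n L = \<lparr>carrier = {A \<in> mat_space n L. det A \<noteq> 0}, monoid.mult = (*), one = 1\<^sub>m n\<rparr>"

text \<open>A semisimple element of \<open>GL\<^sub>n\<close> is regular if its centralizer has dimension \<open>n\<close>, i.e. its
  eigenvalues, counted with algebraic multiplicity, are pairwise distinct. The latter forces
  diagonalizability, so semisimplicity is not demanded separately.\<close>

definition regular_semisimple :: "complex mat \<Rightarrow> bool" where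
  "regular_semisimple A \<longleftrightarrow>
     (\<exists>es. distinct es \<and> char_poly A = (\<Prod>e\<leftarrow>es. [:- e, 1:]))"

definition zero_locus :: "nat \<Rightarrow> complex set \<Rightarrow> (nat \<times> nat) mpoly set \<Rightarrow> complex mat set" where
  "zero_locus n L P = {A \<in> mat_space n L. \<forall>p\<in>P. mpoly_eval (\<lambda>ij. A $$ ij) p = 0}"

text \<open>The Zariski topology on the affine space of \<open>n \<times> n\<close> matrices over a field \<open>L\<close>
  of complex numbers.\<close>

definition zariski_topology :: "nat \<Rightarrow> complex set \<Rightarrow> complex mat topology" where
  "zariski_topology n L = topology (\<lambda>U. \<exists>P \<subseteq> mpolys L ({..<n} \<times> {..<n}).
     U = mat_space n L - zero_locus n L P)"

lemma group_GL_complex: "group (GL n UNIV)"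
proof (rule groupI)
  fix A assume "A \<in> carrier (GL n UNIV)"
  then have A: "A \<in> carrier_mat n n" "det A \<noteq> 0"
    by (auto simp: GL_def mat_space_def)
  then obtain B where B: "B \<in> carrier_mat n n" "B * A = 1\<^sub>m n"
    using det_non_zero_imp_unit[OF A(1) A(2), of "()"] by (auto simp: Units_def ring_mat_def)
  then have "det B * det A = 1"
    using det_mult[OF B(1) A(1)] by simp
  then show "\<exists>B\<in>carrier (GL n UNIV). B \<otimes>\<^bsub>GL n UNIV\<^esub> A = \<one>\<^bsub>GL n UNIV\<^esub>"
    using B by (intro bexI[of _ B]) (auto simp: GL_def mat_space_def)
qed (auto simp: GL_def mat_space_def det_mult)

lemma istopology_zariski:
  assumes L: "subring L complex_field"
  shows "istopology (\<lambda>U. \<exists>P \<subseteq> mpolys L ({..<n} \<times> {..<n}). U = mat_space n L - zero_locus n L P)"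
    (is "istopology ?open")
proof -
  have "?open (S \<inter> T)" if "?open S" "?open T" for S T
  proof -
    obtain P Q where P: "P \<subseteq> mpolys L ({..<n} \<times> {..<n})" "S = mat_space n L - zero_locus n L P"
      and Q: "Q \<subseteq> mpolys L ({..<n} \<times> {..<n})" "T = mat_space n L - zero_locus n L Q"
      using \<open>?open S\<close> \<open>?open T\<close> by auto
    let ?R = "{p * q | p q. p \<in> P \<and> q \<in> Q}"
    have "?R \<subseteq> mpolys L ({..<n} \<times> {..<n})"
      using P(1) Q(1) by (auto intro: mpolys_mult[OF L])
    moreover have "S \<inter> T = mat_space n L - zero_locus n L ?R"
    proof -
      have "A \<in> zero_locus n L ?R \<longleftrightarrow> A \<in> zero_locus n L P \<or> A \<in> zero_locus n L Q" for A
      proof (cases "A \<in> zero_locus n L P \<or> A \<in> zero_locus n L Q \<or> A \<notin> mat_space n L")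
        case True
        then show ?thesis by (auto simp: zero_locus_def mpoly_eval_mult)
      next
        case False
        then obtain p q where pq: "p \<in> P" "q \<in> Q" "mpoly_eval (\<lambda>ij. A $$ ij) p \<noteq> 0"
          "mpoly_eval (\<lambda>ij. A $$ ij) q \<noteq> 0"
          by (auto simp: zero_locus_def)
        then have "mpoly_eval (\<lambda>ij. A $$ ij) (p * q) \<noteq> 0" by (simp add: mpoly_eval_mult)
        moreover have "p * q \<in> ?R" using pq by blast
        ultimately have "A \<notin> zero_locus n L ?R" unfolding zero_locus_def by blast
        with False show ?thesis by simp
      qed
      then show ?thesis unfolding P(2) Q(2) by (simp add: set_eq_iff) blast
    qed
    ultimately show ?thesis by (intro exI[of _ ?R]) simp
  qed
  moreover have "?open (\<Union>\<K>)" if K: "\<forall>U\<in>\<K>. ?open U" for \<K>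
  proof -
    obtain P where P: "\<And>U. U \<in> \<K> \<Longrightarrow> P U \<subseteq> mpolys L ({..<n} \<times> {..<n}) \<and>
        U = mat_space n L - zero_locus n L (P U)"
      using bchoice[OF K] by auto
    have "\<Union>\<K> = (\<Union>U\<in>\<K>. mat_space n L - zero_locus n L (P U))"
      using P by blast
    also have "\<dots> = mat_space n L - zero_locus n L (\<Union>U\<in>\<K>. P U)"
      by (auto simp: zero_locus_def)
    finally show ?thesis
      using P by (intro exI[of _ "\<Union>U\<in>\<K>. P U"]) (simp add: UN_least)
  qed
  ultimately show ?thesis
    unfolding istopology_def by simp
qed

lemma openin_zariski_topology_iff:
  assumes "subring L complex_field"
  shows "openin (zariski_topology n L) U \<longleftrightarrow>
    (\<exists>P \<subseteq> mpolys L ({..<n} \<times> {..<n}). U = mat_space n L - zero_locus n L P)"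
  unfolding zariski_topology_def topology_inverse'[OF istopology_zariski[OF assms]] ..

lemma topspace_zariski_topology:
  assumes "subring L complex_field"
  shows "topspace (zariski_topology n L) = mat_space n L"
proof -
  have "1 \<in> mpolys L ({..<n} \<times> {..<n})"
    using subringE[OF assms]
    by (auto simp: mpolys_def ring_of_type_algebra_def lookup_one when_def)
  moreover have "mat_space n L = mat_space n L - zero_locus n L {1}"
    by (auto simp: zero_locus_def mpoly_eval_def)
  ultimately have "openin (zariski_topology n L) (mat_space n L)"
    unfolding openin_zariski_topology_iff[OF assms] by (intro exI[of _ "{1}"]) simp
  moreover have "U \<subseteq> mat_space n L" if "openin (zariski_topology n L) U" for U
    using that unfolding openin_zariski_topology_iff[OF assms] by auto
  ultimately show ?thesis
    unfolding topspace_def by (intro subset_antisym Union_least Union_upper) auto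
qed

lemma closedin_zariski_topology_iff:
  assumes "subring L complex_field"
  shows "closedin (zariski_topology n L) C \<longleftrightarrow>
    (\<exists>P \<subseteq> mpolys L ({..<n} \<times> {..<n}). C = zero_locus n L P)"
proof -
  have Z: "zero_locus n L P \<subseteq> mat_space n L" for P
    by (auto simp: zero_locus_def)
  then have "C \<subseteq> mat_space n L \<and> mat_space n L - C = mat_space n L - zero_locus n L P \<longleftrightarrow>
      C = zero_locus n L P" for P
    using Z[of P] by auto
  then show ?thesis
    unfolding closedin_def topspace_zariski_topology[OF assms] openin_zariski_topology_iff[OF assms]
    by blast
qed

text \<open>The closed subsets of \<open>GL n L\<close> as an affine variety are cut out by polynomials in the
  entries and \<open>1 / det\<close>; clearing denominators, this is the topology induced from the
  affine space of matrices.\<close>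

definition zariski_GL :: "nat \<Rightarrow> complex set \<Rightarrow> complex mat topology" where
  "zariski_GL n L = subtopology (zariski_topology n L) (carrier (GL n L))"

definition zariski_dense_in_GL :: "nat \<Rightarrow> complex set \<Rightarrow> complex mat set \<Rightarrow> bool" where
  "zariski_dense_in_GL n L S \<longleftrightarrow>
     S \<subseteq> carrier (GL n L) \<and> Abstract_Topology.closure_of (zariski_GL n L) S = carrier (GL n L)"

section \<open>Free products of groups\<close>

abbreviation letters :: "('a, 'c) monoid_scheme \<Rightarrow> ('b, 'd) monoid_scheme \<Rightarrow> ('a + 'b) set" where
  "letters G H \<equiv> Sum_Type.Plus (carrier G) (carrier H)"

abbreviation words :: "('a, 'c) monoid_scheme \<Rightarrow> ('b, 'd) monoid_scheme \<Rightarrow> ('a + 'b) list set" where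
  "words G H \<equiv> lists (letters G H)"

inductive free_product_step ::
    "('a, 'c) monoid_scheme \<Rightarrow> ('b, 'd) monoid_scheme \<Rightarrow> ('a + 'b) list \<Rightarrow> ('a + 'b) list \<Rightarrow> bool"
  for G H where
  one_left: "free_product_step G H (us @ [Inl \<one>\<^bsub>G\<^esub>] @ vs) (us @ vs)"
| one_right: "free_product_step G H (us @ [Inr \<one>\<^bsub>H\<^esub>] @ vs) (us @ vs)"
| mult_left: "\<lbrakk>a \<in> carrier G; b \<in> carrier G\<rbrakk> \<Longrightarrow>
    free_product_step G H (us @ [Inl a, Inl b] @ vs) (us @ [Inl (a \<otimes>\<^bsub>G\<^esub> b)] @ vs)"
| mult_right: "\<lbrakk>a \<in> carrier H; b \<in> carrier H\<rbrakk> \<Longrightarrow>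
    free_product_step G H (us @ [Inr a, Inr b] @ vs) (us @ [Inr (a \<otimes>\<^bsub>H\<^esub> b)] @ vs)"

definition free_product_rel ::
    "('a, 'c) monoid_scheme \<Rightarrow> ('b, 'd) monoid_scheme \<Rightarrow> (('a + 'b) list \<times> ('a + 'b) list) set" where
  "free_product_rel G H = {(u, v). u \<in> words G H \<and>
     v \<in> words G H \<and> equivclp (free_product_step G H) u v}"

definition free_product ::
    "('a, 'c) monoid_scheme \<Rightarrow> ('b, 'd) monoid_scheme \<Rightarrow> ('a + 'b) list set monoid" where
  "free_product G H =
     \<lparr>carrier = words G H // free_product_rel G H,
      monoid.mult = (\<lambda>U V. \<Union>u\<in>U. \<Union>v\<in>V. free_product_rel G H `` {u @ v}),
      one = free_product_rel G H `` {[]}\<rparr>"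

definition word_eval ::
    "('l, 'e) monoid_scheme \<Rightarrow> ('a \<Rightarrow> 'l) \<Rightarrow> ('b \<Rightarrow> 'l) \<Rightarrow> ('a + 'b) list \<Rightarrow> 'l" where
  "word_eval L f h ws = foldr (\<lambda>s y. case_sum f h s \<otimes>\<^bsub>L\<^esub> y) ws \<one>\<^bsub>L\<^esub>"

text \<open>The map \<open>f * h\<close> from the free product to \<open>L\<close>; all words representing an element of the
  free product have the same value.\<close>

definition free_product_lift ::
    "('l, 'e) monoid_scheme \<Rightarrow> ('a \<Rightarrow> 'l) \<Rightarrow> ('b \<Rightarrow> 'l) \<Rightarrow> ('a + 'b) list set \<Rightarrow> 'l" where
  "free_product_lift L f h U = the_elem (word_eval L f h ` U)"

lemma equiv_free_product_rel:
  "equiv (words G H) (free_product_rel G H)"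
proof (rule equivI)
  show "sym (free_product_rel G H)"
    by (auto simp: sym_def free_product_rel_def intro: equivclp_sym)
  show "trans (free_product_rel G H)"
    by (auto simp: trans_def free_product_rel_def intro: equivclp_trans)
qed (auto simp: refl_on_def free_product_rel_def)

lemma free_product_step_append:
  "free_product_step G H u v \<Longrightarrow> free_product_step G H (xs @ u @ ys) (xs @ v @ ys)"
proof (induction rule: free_product_step.induct)
  case (one_left us vs)
  then show ?case
    using free_product_step.one_left[of G H "xs @ us" "vs @ ys"] by simp
next
  case (one_right us vs)
  then show ?case
    using free_product_step.one_right[of G H "xs @ us" "vs @ ys"] by simp
next
  case (mult_left a b us vs)
  then show ?case
    using free_product_step.mult_left[of a G b H "xs @ us" "vs @ ys"] by simp
next
  case (mult_right a b us vs)
  then show ?case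
    using free_product_step.mult_right[of a H b G "xs @ us" "vs @ ys"] by simp
qed

lemma equivclp_free_product_append:
  "equivclp (free_product_step G H) u v \<Longrightarrow>
   equivclp (free_product_step G H) (xs @ u @ ys) (xs @ v @ ys)"
proof (induction rule: equivclp_induct)
  case (step y z)
  then have "equivclp (free_product_step G H) (xs @ y @ ys) (xs @ z @ ys)"
    by (auto intro: free_product_step_append r_into_equivclp converse_r_into_equivclp)
  with step.IH show ?case
    by (rule equivclp_trans)
qed simp

lemma free_product_rel_append:
  assumes "(u, u') \<in> free_product_rel G H" "(v, v') \<in> free_product_rel G H"
  shows "(u @ v, u' @ v') \<in> free_product_rel G H"
  using assms equivclp_free_product_append[of G H u u' "[]" v]
    equivclp_free_product_append[of G H v v' u' "[]"]
  by (auto simp: free_product_rel_def intro: equivclp_trans)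

lemma free_product_mult_class:
  assumes u: "u \<in> words G H" and v: "v \<in> words G H"
  shows "free_product_rel G H `` {u} \<otimes>\<^bsub>free_product G H\<^esub> free_product_rel G H `` {v} =
    free_product_rel G H `` {u @ v}"
proof -
  have "(\<lambda>u v. free_product_rel G H `` {u @ v}) respects2 free_product_rel G H"
    by (auto simp: congruent2_def intro!: equiv_class_eq[OF equiv_free_product_rel]
        free_product_rel_append)
  from UN_equiv_class2[OF equiv_free_product_rel equiv_free_product_rel this u v]
  show ?thesis by (simp add: free_product_def)
qed

theorem group_free_product:
  assumes "group G" and "group H"
  shows "group (free_product G H)"
proof -
  interpret G: group G by fact
  interpret H: group H by fact
  let ?W = "words G H" and ?r = "free_product_rel G H"
  have carr: "?r `` {u} \<in> carrier (free_product G H)" if "u \<in> ?W" for u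
    using that by (auto simp: free_product_def intro: quotientI)
  have E: "\<exists>u\<in>?W. U = ?r `` {u}" if "U \<in> carrier (free_product G H)" for U
    using that by (auto simp: free_product_def elim: quotientE)
  have one: "\<one>\<^bsub>free_product G H\<^esub> = ?r `` {[]}"
    by (simp add: free_product_def)
  have app: "u @ v \<in> ?W" if "u \<in> ?W" "v \<in> ?W" for u v
    using that by auto
  have inverse: "\<exists>v\<in>?W. (v @ u, []) \<in> ?r" if "u \<in> ?W" for u
    using that
  proof (induction u)
    case Nil
    have "([] @ [], []) \<in> ?r" by (simp add: free_product_rel_def)
    then show ?case by blast
  next
    case (Cons s u)
    then obtain v where v: "v \<in> ?W" "(v @ u, []) \<in> ?r" by auto
    have "\<exists>t\<in>letters G H. equivclp (free_product_step G H) [t, s] []"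
    proof (cases s)
      case (Inl a)
      with Cons have a: "a \<in> carrier G" by auto
      have "free_product_step G H [Inl (inv\<^bsub>G\<^esub> a), Inl a] [Inl \<one>\<^bsub>G\<^esub>]"
        using free_product_step.mult_left[of "inv\<^bsub>G\<^esub> a" G a H "[]" "[]"] a by simp
      moreover have "free_product_step G H [Inl \<one>\<^bsub>G\<^esub>] []"
        using free_product_step.one_left[of G H "[]" "[]"] by simp
      ultimately have "equivclp (free_product_step G H) [Inl (inv\<^bsub>G\<^esub> a), Inl a] []"
        by (meson equivclp_trans r_into_equivclp)
      moreover have "Inl (inv\<^bsub>G\<^esub> a) \<in> letters G H"
        using a by auto
      ultimately show ?thesis unfolding Inl by blast
    next
      case (Inr a)
      with Cons have a: "a \<in> carrier H" by auto
      have "free_product_step G H [Inr (inv\<^bsub>H\<^esub> a), Inr a] [Inr \<one>\<^bsub>H\<^esub>]"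
        using free_product_step.mult_right[of "inv\<^bsub>H\<^esub> a" H a G "[]" "[]"] a by simp
      moreover have "free_product_step G H [Inr \<one>\<^bsub>H\<^esub>] []"
        using free_product_step.one_right[of G H "[]" "[]"] by simp
      ultimately have "equivclp (free_product_step G H) [Inr (inv\<^bsub>H\<^esub> a), Inr a] []"
        by (meson equivclp_trans r_into_equivclp)
      moreover have "Inr (inv\<^bsub>H\<^esub> a) \<in> letters G H"
        using a by auto
      ultimately show ?thesis unfolding Inr by blast
    qed
    then obtain t where t: "t \<in> letters G H"
      and ts: "equivclp (free_product_step G H) [t, s] []" by blast
    have "equivclp (free_product_step G H) (v @ [t, s] @ u) (v @ [] @ u)"
      by (rule equivclp_free_product_append[OF ts])
    then have "equivclp (free_product_step G H) ((v @ [t]) @ s # u) []"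
      using v(2) by (auto simp: free_product_rel_def intro: equivclp_trans)
    then have "((v @ [t]) @ s # u, []) \<in> ?r"
      using v(1) t Cons.hyps by (auto simp: free_product_rel_def)
    moreover have "v @ [t] \<in> ?W" using v(1) t by auto
    ultimately show ?case by blast
  qed
  show ?thesis
  proof (rule groupI)
    fix U V assume "U \<in> carrier (free_product G H)" "V \<in> carrier (free_product G H)"
    then obtain u v where "u \<in> ?W" "v \<in> ?W" "U = ?r `` {u}" "V = ?r `` {v}"
      using E by meson
    then show "U \<otimes>\<^bsub>free_product G H\<^esub> V \<in> carrier (free_product G H)"
      using carr app free_product_mult_class by metis
  next
    show "\<one>\<^bsub>free_product G H\<^esub> \<in> carrier (free_product G H)"
      unfolding one by (rule carr) simp
  next
    fix U V Z
    assume "U \<in> carrier (free_product G H)" "V \<in> carrier (free_product G H)"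
      "Z \<in> carrier (free_product G H)"
    then obtain u v w where uvw: "u \<in> ?W" "v \<in> ?W" "w \<in> ?W"
      and [simp]: "U = ?r `` {u}" "V = ?r `` {v}" "Z = ?r `` {w}"
      using E by meson
    show "U \<otimes>\<^bsub>free_product G H\<^esub> V \<otimes>\<^bsub>free_product G H\<^esub> Z =
        U \<otimes>\<^bsub>free_product G H\<^esub> (V \<otimes>\<^bsub>free_product G H\<^esub> Z)"
      using uvw app by (simp add: free_product_mult_class del: append_in_lists_conv)
  next
    fix U assume "U \<in> carrier (free_product G H)"
    then obtain u where u: "u \<in> ?W" "U = ?r `` {u}" using E by meson
    then show "\<one>\<^bsub>free_product G H\<^esub> \<otimes>\<^bsub>free_product G H\<^esub> U = U"
      unfolding one using free_product_mult_class[of "[]" G H u] by simp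
    obtain v where v: "v \<in> ?W" "(v @ u, []) \<in> ?r" using inverse u(1) by blast
    have "?r `` {v} \<otimes>\<^bsub>free_product G H\<^esub> U = \<one>\<^bsub>free_product G H\<^esub>"
      unfolding one u(2) free_product_mult_class[OF v(1) u(1)]
      by (rule equiv_class_eq[OF equiv_free_product_rel v(2)])
    then show "\<exists>V\<in>carrier (free_product G H). V \<otimes>\<^bsub>free_product G H\<^esub> U = \<one>\<^bsub>free_product G H\<^esub>"
      using carr v(1) by blast
  qed
qed

text \<open>The universal property: \<open>free_product_lift L f h\<close> is a homomorphism that restricts to \<open>f\<close>
  and \<open>h\<close> on the two factors, and it is the only one.\<close>

context
  fixes G :: "('a, 'c) monoid_scheme" and H :: "('b, 'd) monoid_scheme"
    and L :: "('l, 'e) monoid_scheme" and f h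
  assumes G: "group G" and H: "group H" and L: "group L"
    and f: "f \<in> hom G L" and h: "h \<in> hom H L"
begin

interpretation G: group G by (fact G)
interpretation H: group H by (fact H)
interpretation L: group L by (fact L)

lemma case_sum_closed: "s \<in> letters G H \<Longrightarrow> case_sum f h s \<in> carrier L"
  using f h by (auto simp: hom_def)

lemma word_eval_closed: "u \<in> words G H \<Longrightarrow> word_eval L f h u \<in> carrier L"
  by (induction u) (auto simp: word_eval_def simp del: sum.case intro!: L.m_closed case_sum_closed)

lemma word_eval_append:
  "\<lbrakk>u \<in> words G H; v \<in> words G H\<rbrakk> \<Longrightarrow>
   word_eval L f h (u @ v) = word_eval L f h u \<otimes>\<^bsub>L\<^esub> word_eval L f h v"
proof (induction u)
  case Nil
  then show ?case using word_eval_closed[of v] by (simp add: word_eval_def)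
next
  case (Cons s u)
  have "word_eval L f h (s # w) = case_sum f h s \<otimes>\<^bsub>L\<^esub> word_eval L f h w" for w
    by (simp add: word_eval_def)
  with Cons show ?case
    using word_eval_closed[of u] word_eval_closed[of v] case_sum_closed[of s]
    by (simp add: L.m_assoc)
qed

lemma free_product_step_lists:
  "free_product_step G H u v \<Longrightarrow>
   u \<in> words G H \<longleftrightarrow> v \<in> words G H"
  by (induction rule: free_product_step.induct) auto

lemma word_eval_step:
  assumes "free_product_step G H u v" "u \<in> words G H"
  shows "word_eval L f h u = word_eval L f h v"
  using assms
proof (induction rule: free_product_step.induct)
  case (one_left us vs)
  then have "us \<in> words G H" "vs \<in> words G H"
    "[Inl \<one>\<^bsub>G\<^esub>] \<in> words G H" by auto
  moreover have "word_eval L f h [Inl \<one>\<^bsub>G\<^esub>] = \<one>\<^bsub>L\<^esub>"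
    using f by (simp add: word_eval_def hom_one[OF _ G L])
  ultimately show ?case
    using word_eval_closed[of vs]
    by (simp add: word_eval_append del: Cons_in_lists_iff append.simps)
next
  case (one_right us vs)
  then have "us \<in> words G H" "vs \<in> words G H"
    "[Inr \<one>\<^bsub>H\<^esub>] \<in> words G H" by auto
  moreover have "word_eval L f h [Inr \<one>\<^bsub>H\<^esub>] = \<one>\<^bsub>L\<^esub>"
    using h by (simp add: word_eval_def hom_one[OF _ H L])
  ultimately show ?case
    using word_eval_closed[of vs]
    by (simp add: word_eval_append del: Cons_in_lists_iff append.simps)
next
  case (mult_left a b us vs)
  then have "us \<in> words G H" "vs \<in> words G H"
    "[Inl a, Inl b] \<in> words G H"
    "[Inl (a \<otimes>\<^bsub>G\<^esub> b)] \<in> words G H" by auto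
  moreover have "word_eval L f h [Inl a, Inl b] = word_eval L f h [Inl (a \<otimes>\<^bsub>G\<^esub> b)]"
    using f mult_left by (simp add: word_eval_def hom_mult hom_in_carrier)
  ultimately show ?case
    by (simp add: word_eval_append del: Cons_in_lists_iff append.simps)
next
  case (mult_right a b us vs)
  then have "us \<in> words G H" "vs \<in> words G H"
    "[Inr a, Inr b] \<in> words G H"
    "[Inr (a \<otimes>\<^bsub>H\<^esub> b)] \<in> words G H" by auto
  moreover have "word_eval L f h [Inr a, Inr b] = word_eval L f h [Inr (a \<otimes>\<^bsub>H\<^esub> b)]"
    using h mult_right by (simp add: word_eval_def hom_mult hom_in_carrier)
  ultimately show ?case
    by (simp add: word_eval_append del: Cons_in_lists_iff append.simps)
qed

lemma word_eval_equivclp: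
  assumes "equivclp (free_product_step G H) u v" "u \<in> words G H"
  shows "v \<in> words G H \<and> word_eval L f h u = word_eval L f h v"
  using assms
proof (induction rule: equivclp_induct)
  case (step y z)
  then show ?case
    using word_eval_step free_product_step_lists by metis
qed simp

lemma free_product_lift_class:
  assumes "u \<in> words G H"
  shows "free_product_lift L f h (free_product_rel G H `` {u}) = word_eval L f h u"
proof -
  have "word_eval L f h ` (free_product_rel G H `` {u}) = {word_eval L f h u}"
    using assms word_eval_equivclp by (force simp: free_product_rel_def)
  then show ?thesis by (simp add: free_product_lift_def)
qed

theorem free_product_lift_hom: "free_product_lift L f h \<in> hom (free_product G H) L"
proof (rule homI)
  fix U assume "U \<in> carrier (free_product G H)"
  then obtain u where "u \<in> words G H" "U = free_product_rel G H `` {u}"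
    by (auto simp: free_product_def elim!: quotientE)
  then show "free_product_lift L f h U \<in> carrier L"
    using free_product_lift_class[of u] word_eval_closed[of u] by simp
next
  fix U V assume "U \<in> carrier (free_product G H)" "V \<in> carrier (free_product G H)"
  then obtain u v where uv: "u \<in> words G H" "v \<in> words G H"
    and [simp]: "U = free_product_rel G H `` {u}" "V = free_product_rel G H `` {v}"
    by (auto simp: free_product_def elim!: quotientE)
  then have "u @ v \<in> words G H" by auto
  with uv show "free_product_lift L f h (U \<otimes>\<^bsub>free_product G H\<^esub> V) =
      free_product_lift L f h U \<otimes>\<^bsub>L\<^esub> free_product_lift L f h V"
    by (simp add: free_product_mult_class free_product_lift_class word_eval_append
        del: append_in_lists_conv)
qed

theorem free_product_lift_left:
  "a \<in> carrier G \<Longrightarrow> free_product_lift L f h (free_product_rel G H `` {[Inl a]}) = f a"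
  using f by (subst free_product_lift_class) (auto simp: word_eval_def hom_in_carrier)

theorem free_product_lift_right:
  "b \<in> carrier H \<Longrightarrow> free_product_lift L f h (free_product_rel G H `` {[Inr b]}) = h b"
  using h by (subst free_product_lift_class) (auto simp: word_eval_def hom_in_carrier)

theorem free_product_lift_unique:
  assumes F: "F \<in> hom (free_product G H) L"
    and "\<And>a. a \<in> carrier G \<Longrightarrow> F (free_product_rel G H `` {[Inl a]}) = f a"
    and "\<And>b. b \<in> carrier H \<Longrightarrow> F (free_product_rel G H `` {[Inr b]}) = h b"
    and "U \<in> carrier (free_product G H)"
  shows "F U = free_product_lift L f h U"
proof -
  have carr: "free_product_rel G H `` {u} \<in> carrier (free_product G H)"
    if "u \<in> words G H" for u
    using that by (auto simp: free_product_def intro: quotientI)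
  have "F (free_product_rel G H `` {u}) = word_eval L f h u"
    if "u \<in> words G H" for u
    using that
  proof (induction u)
    case Nil
    have "F \<one>\<^bsub>free_product G H\<^esub> = \<one>\<^bsub>L\<^esub>"
      by (rule hom_one[OF F group_free_product[OF G H] L])
    then show ?case by (simp add: free_product_def word_eval_def)
  next
    case (Cons s u)
    then have su: "[s] \<in> words G H" "u \<in> words G H"
      by auto
    have "F (free_product_rel G H `` {s # u}) =
        F (free_product_rel G H `` {[s]} \<otimes>\<^bsub>free_product G H\<^esub> free_product_rel G H `` {u})"
      using free_product_mult_class[OF su] by simp
    also have "\<dots> = F (free_product_rel G H `` {[s]}) \<otimes>\<^bsub>L\<^esub> F (free_product_rel G H `` {u})"
      by (rule hom_mult[OF F carr carr]) (fact su)+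
    also have "F (free_product_rel G H `` {[s]}) = case_sum f h s"
      using Cons.hyps assms(2,3) by (cases s) auto
    finally show ?case
      using Cons.IH by (simp add: word_eval_def)
  qed
  moreover obtain u where "u \<in> words G H" "U = free_product_rel G H `` {u}"
    using assms(4) by (auto simp: free_product_def elim!: quotientE)
  ultimately show ?thesis
    using free_product_lift_class[of u] by simp
qed

end

section \<open>Representations\<close>

text \<open>The vector space \<open>V\<close> is the whole type \<open>'v\<close>, with scalar multiplication \<open>scale\<close>.\<close>

definition GL_space :: "(complex \<Rightarrow> 'v \<Rightarrow> 'v) \<Rightarrow> ('v :: ab_group_add \<Rightarrow> 'v) monoid" where
  "GL_space scale =
     \<lparr>carrier = {T. Vector_Spaces.linear scale scale T \<and> bij T}, monoid.mult = (\<circ>), one = id\<rparr>"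

definition irreducible_representation ::
    "('g, 'b) monoid_scheme \<Rightarrow> (complex \<Rightarrow> 'v \<Rightarrow> 'v) \<Rightarrow> ('g \<Rightarrow> 'v :: ab_group_add \<Rightarrow> 'v) \<Rightarrow> bool" where
  "irreducible_representation G scale \<pi> \<longleftrightarrow>
     \<pi> \<in> hom G (GL_space scale) \<and>
     (UNIV :: 'v set) \<noteq> {0} \<and>
     (\<forall>W. module.subspace scale W \<and> (\<forall>g\<in>carrier G. \<pi> g ` W \<subseteq> W) \<longrightarrow> W = {0} \<or> W = UNIV)"

definition is_basis :: "(complex \<Rightarrow> 'v \<Rightarrow> 'v) \<Rightarrow> nat \<Rightarrow> (nat \<Rightarrow> 'v :: ab_group_add) \<Rightarrow> bool" where
  "is_basis scale n x \<longleftrightarrow> inj_on x {1..n} \<and>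
     \<not> module.dependent scale (x ` {1..n}) \<and> module.span scale (x ` {1..n}) = UNIV"

abbreviation coord ::
    "(complex \<Rightarrow> 'v \<Rightarrow> 'v) \<Rightarrow> nat \<Rightarrow> (nat \<Rightarrow> 'v :: ab_group_add) \<Rightarrow> 'v \<Rightarrow> nat \<Rightarrow> complex" where
  "coord scale n x v i \<equiv> module.representation scale (x ` {1..n}) v (x i)"

text \<open>Bases are indexed by \<open>1, \<dots>, n\<close>, matrix entries by \<open>0, \<dots>, n - 1\<close>.\<close>

definition matrix_in_basis ::
    "(complex \<Rightarrow> 'v \<Rightarrow> 'v) \<Rightarrow> nat \<Rightarrow> (nat \<Rightarrow> 'v :: ab_group_add) \<Rightarrow> ('v \<Rightarrow> 'v) \<Rightarrow> complex mat" where
  "matrix_in_basis scale n x T = mat n n (\<lambda>(i, j). coord scale n x (T (x (Suc j))) (Suc i))"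

definition permutation_representation ::
    "(complex \<Rightarrow> 'v \<Rightarrow> 'v) \<Rightarrow> nat \<Rightarrow> (nat \<Rightarrow> 'v :: ab_group_add) \<Rightarrow> (nat \<Rightarrow> nat) \<Rightarrow> 'v \<Rightarrow> 'v" where
  "permutation_representation scale n x p v = (\<Sum>i\<in>{1..n}. scale (coord scale n x v i) (x (p i)))"

definition Pi_hom ::
    "(complex \<Rightarrow> 'v \<Rightarrow> 'v) \<Rightarrow> nat \<Rightarrow> (nat \<Rightarrow> 'v :: ab_group_add) \<Rightarrow> ('g \<Rightarrow> 'v \<Rightarrow> 'v) \<Rightarrow>
     ('g + (nat \<Rightarrow> nat)) list set \<Rightarrow> complex mat" where
  "Pi_hom scale n x \<pi> = free_product_lift (GL n UNIV)
     (\<lambda>g. matrix_in_basis scale n x (\<pi> g))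
     (\<lambda>p. matrix_in_basis scale n x (permutation_representation scale n x p))"

end

theory Submission
  imports "Jordan_Normal_Form.Schur_Decomposition" Defs
begin

text \<open>In a suitably scaled eigenbasis of the regular element, all matrices of the representation have
  entries in \<open>K\<^sub>0\<close>, and the regular element is \<open>D = diag(z)\<close>. There is a reflection \<open>s\<close> such that \<open>D s\<close>
  has prescribed eigenvalues, subject only to the determinant condition; choose them algebraically as
  independent as possible. In a basis where \<open>s\<close> is a transposition, \<open>D s\<close> lies in the group in
  question, and the powers of a scalar multiple of it are Zariski dense in a maximal torus. In the
  eigenbasis of \<open>D s\<close> all off-diagonal entries of \<open>s\<close> are nonzero, so that contracting conjugates of
  subtori by the torus produces all matrices that differ from the identity in one column only.
  These generate all invertible matrices. The only exception is \<open>n = 2\<close>, \<open>z\<^sub>0 + z\<^sub>1 = 0\<close>, where \<open>s\<close> is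
  replaced by a non-diagonal matrix of the representation.\<close>

section \<open>Zariski closures of sets of matrices\<close>

text \<open>The eigenvalues of \<open>D s\<close> cannot all be independent: \<open>D\<close> has
  finite order and \<open>det s = -1\<close>, so \<open>det (D s)\<close> is a root of unity and the
  powers of \<open>D s\<close> alone are never dense in a maximal torus. This is what the scalars
  are for: \<open>n - 1\<close> independent elements become eigenvalues and the last one becomes the
  scalar factor. The freedom to prescribe eigenvalues lies in the choice of the basis: seen from the
  eigenbasis of \<open>D\<close>, the fixed matrix of a transposition becomes a reflection that can
  be chosen. The independent elements enter only through this choice and the scalar. In the
  eigenbasis of \<open>D\<close> the representation stays over \<open>K_0\<close>, so independence
  over \<open>K_0\<close> remains usable in the exceptional case, where a vanishing entry would be a
  quadratic equation over \<open>K_0\<close> for the first independent element. Closures are formed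
  in the affine space of all complex matrices. Polynomials over the algebraic closure of
  \<open>K\<close> are complex polynomials, so this density is the stronger one, and limits may pass
  through singular matrices.\<close>

lemma mpoly_eval_single:
  "mpoly_eval x (Poly_Mapping.single a c) =
     c * (\<Prod>i\<in>Poly_Mapping.keys a. x i ^ Poly_Mapping.lookup a i)"
  by (auto simp: mpoly_eval_def)

text \<open>Generating the functions from constants and entries, rather than evaluating an
  \<open>mpoly\<close>, turns substitution of polynomial maps into an induction.\<close>

inductive_set polynomial_functions :: "nat \<Rightarrow> (complex mat \<Rightarrow> complex) set" for n where
  const: "(\<lambda>A. c) \<in> polynomial_functions n"
| entry: "i < n \<Longrightarrow> j < n \<Longrightarrow> (\<lambda>A. A $$ (i, j)) \<in> polynomial_functions n"
| add: "f \<in> polynomial_functions n \<Longrightarrow> g \<in> polynomial_functions n \<Longrightarrow>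
    (\<lambda>A. f A + g A) \<in> polynomial_functions n"
| mult: "f \<in> polynomial_functions n \<Longrightarrow> g \<in> polynomial_functions n \<Longrightarrow>
    (\<lambda>A. f A * g A) \<in> polynomial_functions n"

lemma polynomial_functions_sum:
  "(\<And>s. s \<in> S \<Longrightarrow> f s \<in> polynomial_functions n) \<Longrightarrow>
   (\<lambda>A. \<Sum>s\<in>S. f s A) \<in> polynomial_functions n"
  by (induction S rule: infinite_finite_induct) (auto intro: polynomial_functions.intros)

lemma polynomial_functions_prod:
  "(\<And>s. s \<in> S \<Longrightarrow> f s \<in> polynomial_functions n) \<Longrightarrow>
   (\<lambda>A. \<Prod>s\<in>S. f s A) \<in> polynomial_functions n"
  by (induction S rule: infinite_finite_induct) (auto intro: polynomial_functions.intros)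

lemma polynomial_functions_power:
  "f \<in> polynomial_functions n \<Longrightarrow> (\<lambda>A. f A ^ k) \<in> polynomial_functions n"
  by (induction k) (auto intro: polynomial_functions.intros)

lemma mpoly_eval_polynomial_function:
  assumes "p \<in> mpolys L ({..<n} \<times> {..<n})"
  shows "(\<lambda>A. mpoly_eval (\<lambda>ij. A $$ ij) p) \<in> polynomial_functions n"
  unfolding mpoly_eval_def
proof (intro polynomial_functions_sum polynomial_functions.mult polynomial_functions.const
    polynomial_functions_prod polynomial_functions_power)
  fix a i assume "a \<in> Poly_Mapping.keys p" "i \<in> Poly_Mapping.keys a"
  then have "i \<in> {..<n} \<times> {..<n}"
    using assms by (auto simp: mpolys_def)
  then show "(\<lambda>A. A $$ i) \<in> polynomial_functions n"
    by (cases i) (auto intro: polynomial_functions.entry)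
qed

lemma polynomial_functions_compose:
  assumes "f \<in> polynomial_functions n"
    and "\<And>i j. i < n \<Longrightarrow> j < n \<Longrightarrow> (\<lambda>A. \<phi> A $$ (i, j)) \<in> polynomial_functions k"
  shows "(\<lambda>A. f (\<phi> A)) \<in> polynomial_functions k"
  using assms(1) by induction (auto intro: polynomial_functions.intros assms(2))

lemma mat_mult_entries:
  assumes "A \<in> carrier_mat n k" "B \<in> carrier_mat k l"
  shows "A * B = mat n l (\<lambda>(i, j). \<Sum>r<k. A $$ (i, r) * B $$ (r, j))"
  using assms by (intro eq_matI) (auto simp: scalar_prod_def atLeast0LessThan)

text \<open>A separate \<open>g\<close> is needed because the entries of \<open>B * A * C\<close>
  follow the polynomial formula only for \<open>A\<close> in \<open>carrier_mat n n\<close>; for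
  other \<open>A\<close> nothing is guaranteed.\<close>

lemma polynomial_functions_two_sided_mult:
  assumes f: "f \<in> polynomial_functions n" and B: "B \<in> carrier_mat n n" and C: "C \<in> carrier_mat n n"
  obtains g where "g \<in> polynomial_functions n"
    and "\<And>A. A \<in> carrier_mat n n \<Longrightarrow> g A = f (B * A * C)"
proof
  let ?\<phi> = "\<lambda>A :: complex mat. mat n n (\<lambda>(i, j). \<Sum>r<n. (\<Sum>l<n. B $$ (i, l) * A $$ (l, r)) * C $$ (r, j))"
  show "(\<lambda>A. f (?\<phi> A)) \<in> polynomial_functions n"
    by (rule polynomial_functions_compose[OF f])
      (auto intro!: polynomial_functions_sum polynomial_functions.mult polynomial_functions.const
        polynomial_functions.entry)
  fix A :: "complex mat" assume "A \<in> carrier_mat n n"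
  then have "?\<phi> A = B * A * C"
    using B C by (subst mat_mult_entries[of "B * A" n n C n])
      (auto simp: mat_mult_entries[of B n n A n] intro!: eq_matI)
  then show "f (?\<phi> A) = f (B * A * C)" by simp
qed

lemma polynomial_function_on_curve:
  assumes "f \<in> polynomial_functions n"
    and "\<And>i j. i < n \<Longrightarrow> j < n \<Longrightarrow> \<exists>q. \<forall>z. \<gamma> z $$ (i, j) = poly q z"
  shows "\<exists>q. \<forall>z. f (\<gamma> z) = poly q z"
  using assms(1)
proof induction
  case (const c)
  show ?case by (intro exI[of _ "[:c:]"]) simp
next
  case (add f g)
  then show ?case by (metis poly_add)
next
  case (mult f g)
  then show ?case by (metis poly_mult)
qed (use assms(2) in auto)

text \<open>The ambient space is all of \<open>carrier_mat n n\<close> and not the invertible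
  matrices, since singular matrices occur as intermediate limits.\<close>

definition zariski_closure :: "nat \<Rightarrow> complex mat set \<Rightarrow> complex mat set" where
  "zariski_closure n S = {A \<in> carrier_mat n n.
     \<forall>f\<in>polynomial_functions n. (\<forall>B\<in>S. f B = 0) \<longrightarrow> f A = 0}"

lemma zariski_closure_subset: "S \<subseteq> carrier_mat n n \<Longrightarrow> S \<subseteq> zariski_closure n S"
  by (auto simp: zariski_closure_def)

lemma zariski_closure_carrier: "A \<in> zariski_closure n S \<Longrightarrow> A \<in> carrier_mat n n"
  by (auto simp: zariski_closure_def)

lemma zariski_closure_vanish:
  "A \<in> zariski_closure n S \<Longrightarrow> f \<in> polynomial_functions n \<Longrightarrow> (\<And>B. B \<in> S \<Longrightarrow> f B = 0) \<Longrightarrow> f A = 0"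
  by (auto simp: zariski_closure_def)

lemma zariski_closure_two_sided_mult:
  assumes B: "B \<in> carrier_mat n n" and C: "C \<in> carrier_mat n n" and T: "S \<subseteq> carrier_mat n n"
    and S: "\<And>A. A \<in> S \<Longrightarrow> B * A * C \<in> zariski_closure n T" and A: "A \<in> zariski_closure n S"
  shows "B * A * C \<in> zariski_closure n T"
  unfolding zariski_closure_def mem_Collect_eq
proof (intro conjI ballI impI)
  show "B * A * C \<in> carrier_mat n n"
    using B C zariski_closure_carrier[OF A] by auto
  fix f assume f: "f \<in> polynomial_functions n" "\<forall>B\<in>T. f B = 0"
  obtain g where g: "g \<in> polynomial_functions n"
    "\<And>A. A \<in> carrier_mat n n \<Longrightarrow> g A = f (B * A * C)"
    using polynomial_functions_two_sided_mult[OF f(1) B C] by blast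
  have "g A = 0"
  proof (rule zariski_closure_vanish[OF A g(1)])
    fix D assume D: "D \<in> S"
    then have "f (B * D * C) = 0"
      using zariski_closure_vanish[OF S[OF D] f(1)] f(2) by blast
    then show "g D = 0" using g(2) D T by auto
  qed
  then show "f (B * A * C) = 0"
    using g(2) zariski_closure_carrier[OF A] by simp
qed

text \<open>The closure of a semigroup is a semigroup, by treating one factor at a time: left
  multiplication by an element of \<open>S\<close> preserves the closure, hence right multiplication
  by a point of the closure maps \<open>S\<close>, and then its closure, into the closure.\<close>

lemma zariski_closure_mult:
  assumes S: "S \<subseteq> carrier_mat n n" and SS: "\<And>A B. A \<in> S \<Longrightarrow> B \<in> S \<Longrightarrow> A * B \<in> S"
    and A: "A \<in> zariski_closure n S" and B: "B \<in> zariski_closure n S"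
  shows "A * B \<in> zariski_closure n S"
proof -
  note cl = zariski_closure_carrier zariski_closure_subset[OF S]
  have 1: "A * B \<in> zariski_closure n S" if "A \<in> S" for A
  proof -
    have "A \<in> carrier_mat n n" using that S by auto
    then have "A * B * 1\<^sub>m n \<in> zariski_closure n S"
    proof (rule zariski_closure_two_sided_mult[OF _ one_carrier_mat S _ B])
      fix C assume "C \<in> S"
      then have "A * C \<in> S" by (rule SS[OF that])
      then show "A * C * 1\<^sub>m n \<in> zariski_closure n S"
        using S cl(2) by (metis right_mult_one_mat subsetD)
    qed
    then show ?thesis using \<open>A \<in> carrier_mat n n\<close> cl(1)[OF B] by simp
  qed
  have "1\<^sub>m n * A * B \<in> zariski_closure n S"
  proof (rule zariski_closure_two_sided_mult[OF one_carrier_mat cl(1)[OF B] S _ A])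
    fix C assume "C \<in> S"
    then have "C \<in> carrier_mat n n" "C * B \<in> zariski_closure n S" using S 1 by auto
    then show "1\<^sub>m n * C * B \<in> zariski_closure n S" by simp
  qed
  then show ?thesis using cl(1)[OF A] by simp
qed

text \<open>A polynomial vanishing on \<open>S\<close> restricts to a one-variable polynomial with
  infinitely many roots. The point \<open>z\<close> may itself be one of the finitely many
  exceptions, which is how limits are taken below.\<close>

lemma zariski_closure_curve:
  assumes \<gamma>: "\<And>i j. i < n \<Longrightarrow> j < n \<Longrightarrow> \<exists>q. \<forall>z. \<gamma> z $$ (i, j) = poly q z"
    and carr: "\<gamma> z \<in> carrier_mat n n"
    and fin: "finite {z. \<gamma> z \<notin> zariski_closure n S}"
  shows "\<gamma> z \<in> zariski_closure n S"
  unfolding zariski_closure_def mem_Collect_eq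
proof (intro conjI ballI impI carr)
  fix f assume f: "f \<in> polynomial_functions n" "\<forall>B\<in>S. f B = 0"
  obtain q where q: "\<And>z. f (\<gamma> z) = poly q z"
    using polynomial_function_on_curve[OF f(1) \<gamma>] by blast
  have "- {z. \<gamma> z \<notin> zariski_closure n S} \<subseteq> {z. poly q z = 0}"
    using f zariski_closure_vanish[OF _ f(1)] q by (auto simp flip: q)
  moreover have "infinite (- {z. \<gamma> z \<notin> zariski_closure n S})"
    using fin by (simp add: Compl_eq_Diff_UNIV infinite_UNIV_char_0)
  ultimately have "q = 0"
    using poly_roots_finite finite_subset by blast
  then show "f (\<gamma> z) = 0" using q by simp
qed

section \<open>Powers of a diagonal matrix with multiplicatively independent entries\<close>

definition monomial_value :: "('i \<Rightarrow> complex) \<Rightarrow> ('i \<Rightarrow>\<^sub>0 nat) \<Rightarrow> complex" where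
  "monomial_value x a = (\<Prod>i\<in>Poly_Mapping.keys a. x i ^ Poly_Mapping.lookup a i)"

lemma polynomial_function_on_diagonal:
  assumes "f \<in> polynomial_functions n"
  shows "\<exists>p\<in>mpolys UNIV {..<n}. \<forall>y. f (mat_diag n y) = mpoly_eval y p"
  using assms
proof induction
  case (const c)
  show ?case
    by (intro bexI[of _ "Poly_Mapping.single 0 c"])
      (auto simp: mpoly_eval_single mpolys_def split: if_splits)
next
  case (entry i j)
  have z: "0 \<in> mpolys UNIV {..<n}" by (auto simp: mpolys_def)
  show ?case
  proof (cases "i = j")
    case True
    with entry show ?thesis
      by (intro bexI[of _ "Poly_Mapping.single (Poly_Mapping.single i 1) 1"])
        (auto simp: mpoly_eval_single mpolys_def mat_diag_def split: if_splits)
  next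
    case False
    with entry z show ?thesis
      by (intro bexI[of _ 0]) (auto simp: mpoly_eval_def mat_diag_def)
  qed
next
  case (add f g)
  then obtain p q where "p \<in> mpolys UNIV {..<n}" "q \<in> mpolys UNIV {..<n}"
    and pq: "\<And>y. f (mat_diag n y) = mpoly_eval y p" "\<And>y. g (mat_diag n y) = mpoly_eval y q"
    by blast
  then have "p + q \<in> mpolys UNIV {..<n}"
    using Poly_Mapping.keys_add[of p q] by (fastforce simp: mpolys_def)
  then show ?case
    by (rule bexI[rotated]) (simp add: pq mpoly_eval_add)
next
  case (mult f g)
  then obtain p q where p: "p \<in> mpolys UNIV {..<n}" "q \<in> mpolys UNIV {..<n}"
    and pq: "\<And>y. f (mat_diag n y) = mpoly_eval y p" "\<And>y. g (mat_diag n y) = mpoly_eval y q"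
    by blast
  have "subring (UNIV :: complex set) complex_field"
    by (rule ring.subringI[OF ring_from_type_algebra]) (auto simp: ring_of_type_algebra_def)
  from mpolys_mult[OF this p] show ?case
    by (rule bexI[rotated]) (simp add: pq mpoly_eval_mult)
qed

text \<open>Vandermonde without determinants: the relation extends linearly from powers to all
  polynomials in \<open>v a\<close>, and the polynomial \<open>?q\<close> vanishes at every node
  except \<open>v b\<close>.\<close>

lemma power_sums_vanish:
  fixes c :: "'a \<Rightarrow> complex"
  assumes "finite S" "inj_on v S" and sum: "\<And>k. (\<Sum>a\<in>S. c a * v a ^ k) = 0" and b: "b \<in> S"
  shows "c b = 0"
proof -
  have poly_sum: "(\<Sum>a\<in>S. c a * poly q (v a)) = 0" for q
  proof -
    have "(\<Sum>a\<in>S. c a * poly q (v a)) = (\<Sum>i\<le>Polynomial.degree q. Polynomial.coeff q i * (\<Sum>a\<in>S. c a * v a ^ i))"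
      unfolding poly_altdef sum_distrib_left by (subst sum.swap) (simp add: mult_ac)
    then show ?thesis by (simp add: sum)
  qed
  let ?q = "\<Prod>a\<in>S - {b}. [:- v a, 1:]"
  have "(\<Sum>a\<in>S. c a * poly ?q (v a)) = c b * poly ?q (v b)"
    using assms(1) b by (subst sum.remove[of _ b]) (auto simp: poly_prod intro!: sum.neutral)
  moreover have "poly ?q (v b) \<noteq> 0"
    using assms(1,2) b by (auto simp: poly_prod inj_on_def)
  ultimately show ?thesis
    using poly_sum[of ?q] by simp
qed

text \<open>The assumption on \<open>d\<close> is multiplicative independence. On the
  \<open>k\<close>-th power of \<open>diag(d)\<close>, a polynomial takes the value "sum of
  coefficients times \<open>k\<close>-th powers of monomial values"; these values are distinct, so
  all coefficients vanish.\<close>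

lemma diagonal_in_zariski_closure:
  assumes d: "inj_on (monomial_value d) {a. Poly_Mapping.keys a \<subseteq> {..<n}}"
    and S: "\<And>k. mat_diag n (\<lambda>i. d i ^ k) \<in> S"
  shows "mat_diag n y \<in> zariski_closure n S"
  unfolding zariski_closure_def mem_Collect_eq
proof (intro conjI ballI impI mat_diag_dim)
  fix f assume f: "f \<in> polynomial_functions n" "\<forall>B\<in>S. f B = 0"
  obtain p where p: "p \<in> mpolys UNIV {..<n}" "\<And>y. f (mat_diag n y) = mpoly_eval y p"
    using polynomial_function_on_diagonal[OF f(1)] by blast
  have "Poly_Mapping.lookup p b = 0" if "b \<in> Poly_Mapping.keys p" for b
  proof (rule power_sums_vanish[OF finite_keys _ _ that])
    show "inj_on (monomial_value d) (Poly_Mapping.keys p)"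
      by (rule inj_on_subset[OF d]) (use p(1) in \<open>auto simp: mpolys_def\<close>)
    fix k
    have "mpoly_eval (\<lambda>i. d i ^ k) p = 0"
      using f(2) S p(2) by (metis)
    then show "(\<Sum>a\<in>Poly_Mapping.keys p. Poly_Mapping.lookup p a * monomial_value d a ^ k) = 0"
      by (simp add: mpoly_eval_def monomial_value_def prod_power_distrib mult.commute
          flip: power_mult)
  qed
  then have "p = 0" by (metis in_keys_iff poly_mapping_eqI lookup_zero)
  then show "f (mat_diag n y) = 0" by (simp add: p(2) mpoly_eval_def)
qed

section \<open>Column matrices and the generation of all matrices\<close>

definition column_matrix :: "nat \<Rightarrow> nat \<Rightarrow> (nat \<Rightarrow> complex) \<Rightarrow> complex mat" where
  "column_matrix n k a = mat n n (\<lambda>(i, j). if j = k then a i else if i = j then 1 else 0)"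

context
  fixes n :: nat and S :: "complex mat set"
  assumes S: "S \<subseteq> carrier_mat n n" and SS: "\<And>A B. A \<in> S \<Longrightarrow> B \<in> S \<Longrightarrow> A * B \<in> S"
    and diag: "\<And>y. mat_diag n y \<in> zariski_closure n S"
begin

text \<open>Conjugating the one-parameter group \<open>A (1 + \<epsilon> E\<^sub>l\<^sub>l) A\<^sup>-\<^sup>1\<close> by a diagonal matrix whose \<open>k\<close>-th entry
  is \<open>\<epsilon>\<close> leaves, in the limit \<open>\<epsilon> \<rightarrow> 0\<close>, only the off-diagonal part of the \<open>k\<close>-th column.\<close>

lemma column_matrix_unipotent_in_closure:
  assumes k: "k < n" and l: "l < n" and A: "A \<in> S" and A': "A' \<in> S" and inv: "A * A' = 1\<^sub>m n"
    and nz: "\<And>i. i < n \<Longrightarrow> i \<noteq> k \<Longrightarrow> A $$ (i, l) \<noteq> 0" "A' $$ (l, k) \<noteq> 0"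
    and b: "\<And>i. i < n \<Longrightarrow> i \<noteq> k \<Longrightarrow> b i \<noteq> 0"
  shows "column_matrix n k (b(k := 1)) \<in> zariski_closure n S"
proof -
  note mult = zariski_closure_mult[OF S SS]
  have Ac: "A \<in> carrier_mat n n" and Ac': "A' \<in> carrier_mat n n" using S A A' by auto
  \<comment> \<open>This choice makes the entry of the conjugate in row \<open>i\<close> and column
    \<open>k\<close> equal to \<open>y i * M i k = b i\<close>. Since \<open>b i\<close> is nonzero,
    the conjugating diagonal matrix is invertible.\<close>
  define y where "y i = b i / (A $$ (i, l) * A' $$ (l, k))" for i
  define M where "M i j = A $$ (i, l) * A' $$ (l, j)" for i j
  define s where "s \<epsilon> i = (if i = k then \<epsilon> else y i)" for \<epsilon> i
  \<comment> \<open>The conjugate with all negative powers of \<epsilon> cancelled, so that it is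
    polynomial in \<epsilon> and has a value at 0.\<close>
  define \<gamma> where "\<gamma> \<epsilon> = mat n n (\<lambda>(i, j). (if i = j then 1 else 0) +
    (if i = j then \<epsilon> * M i i else if i = k then \<epsilon>\<^sup>2 * (M k j / y j)
     else if j = k then b i else \<epsilon> * (M i j * y i / y j)))" for \<epsilon>
  have y: "y i \<noteq> 0" if "i < n" "i \<noteq> k" for i
    using nz b that by (simp add: y_def)
  have \<gamma>: "\<gamma> \<epsilon> \<in> zariski_closure n S" if \<epsilon>: "\<epsilon> \<noteq> 0" for \<epsilon>
  proof -
    let ?E = "mat_diag n (\<lambda>i. if i = l then 1 + \<epsilon> else 1)"
    have mid: "(A * ?E * A') $$ (i, j) = (if i = j then 1 else 0) + \<epsilon> * M i j" if "i < n" "j < n" for i j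
    proof -
      have "(A * ?E * A') $$ (i, j) = (\<Sum>r<n. A $$ (i, r) * (if r = l then 1 + \<epsilon> else 1) * A' $$ (r, j))"
        unfolding mat_diag_mult_right[OF Ac] using that by (subst mat_mult_entries[OF _ Ac']) auto
      also have "\<dots> = (\<Sum>r<n. A $$ (i, r) * A' $$ (r, j)) +
          (\<Sum>r<n. if r = l then \<epsilon> * (A $$ (i, l) * A' $$ (l, j)) else 0)"
        unfolding sum.distrib[symmetric] by (intro sum.cong) (auto simp: algebra_simps)
      also have "(\<Sum>r<n. A $$ (i, r) * A' $$ (r, j)) = (A * A') $$ (i, j)"
        using that by (simp add: mat_mult_entries[OF Ac Ac'])
      finally show ?thesis using that l inv by (simp add: M_def)
    qed
    have mc: "A * ?E * A' \<in> carrier_mat n n"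
      by (intro mult_carrier_mat[of _ n n] Ac Ac' mat_diag_dim)
    have "\<gamma> \<epsilon> = mat_diag n (s \<epsilon>) * (A * ?E * A') * mat_diag n (\<lambda>i. 1 / s \<epsilon> i)"
      using mc unfolding mat_diag_mult_left[OF mc]
      by (subst mat_diag_mult_right[of _ n n])
        (auto simp: \<gamma>_def mid s_def y M_def \<epsilon> y_def nz b power2_eq_square field_simps intro!: eq_matI)
    also have "\<dots> \<in> zariski_closure n S"
      using A A' zariski_closure_subset[OF S] by (intro mult diag) auto
    finally show ?thesis .
  qed
  have poly: "\<exists>q. \<forall>z. c + (if i = j then z * d1 else if i = k then z\<^sup>2 * d2
      else if j = k then d3 else z * d4) = poly q z" for i j :: nat and c d1 d2 d3 d4 :: complex
    by (intro exI[of _ "if i = j then [:c, d1:] else if i = k then [:c, 0, d2:]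
      else if j = k then [:c + d3:] else [:c, d4:]"]) (simp add: power2_eq_square)
  have "\<gamma> 0 \<in> zariski_closure n S"
  proof (rule zariski_closure_curve)
    fix i j assume ij: "i < n" "j < n"
    show "\<exists>q. \<forall>z. \<gamma> z $$ (i, j) = poly q z"
      unfolding \<gamma>_def using ij poly by simp
  next
    show "\<gamma> 0 \<in> carrier_mat n n" by (simp add: \<gamma>_def)
    have "{z. \<gamma> z \<notin> zariski_closure n S} \<subseteq> {0}" using \<gamma> by auto
    then show "finite {z. \<gamma> z \<notin> zariski_closure n S}" by (rule finite_subset) simp
  qed
  also have "\<gamma> 0 = column_matrix n k (b(k := 1))"
    by (auto simp: \<gamma>_def column_matrix_def intro!: eq_matI)
  finally show ?thesis .
qed

lemma column_matrix_in_closure: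
  assumes k: "k < n" and "\<exists>A\<in>S. \<exists>A'\<in>S. \<exists>l<n. A * A' = 1\<^sub>m n \<and>
      (\<forall>i<n. i \<noteq> k \<longrightarrow> A $$ (i, l) \<noteq> 0) \<and> A' $$ (l, k) \<noteq> 0"
  shows "column_matrix n k a \<in> zariski_closure n S"
proof -
  have 1: "column_matrix n k a \<in> zariski_closure n S" if a: "\<And>i. i < n \<Longrightarrow> a i \<noteq> 0" for a
  proof -
    \<comment> \<open>The division by \<open>a k\<close> is undone by multiplying column
      \<open>k\<close> with \<open>a k\<close> from the right, which also turns the diagonal entry 1
      into \<open>a k\<close>.\<close>
    let ?b = "\<lambda>i. a i / a k"
    have "column_matrix n k (?b(k := 1)) \<in> zariski_closure n S"
      using column_matrix_unipotent_in_closure[OF k, of _ _ _ ?b] assms(2) a k by auto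
    then have "column_matrix n k (?b(k := 1)) * mat_diag n (\<lambda>i. if i = k then a k else 1)
        \<in> zariski_closure n S"
      by (intro zariski_closure_mult[OF S SS] diag)
    also have "column_matrix n k (?b(k := 1)) * mat_diag n (\<lambda>i. if i = k then a k else 1) =
        column_matrix n k a"
      by (subst mat_diag_mult_right[of _ n n])
        (use a k in \<open>auto simp: column_matrix_def intro!: eq_matI\<close>)
    finally show ?thesis .
  qed
  \<comment> \<open>Zero entries are reached by shifting: \<open>a i + z\<close> is nonzero for
    every \<open>i\<close> except for finitely many \<open>z\<close>.\<close>
  have "column_matrix n k (\<lambda>i. a i + 0) \<in> zariski_closure n S"
  proof (rule zariski_closure_curve[where \<gamma> = "\<lambda>z. column_matrix n k (\<lambda>i. a i + z)"])
    fix i j assume ij: "i < n" "j < n"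
    show "\<exists>q. \<forall>z. column_matrix n k (\<lambda>i. a i + z) $$ (i, j) = poly q z"
      by (rule exI[of _ "if j = k then [:a i, 1:] else if i = j then 1 else 0"])
        (use ij in \<open>auto simp: column_matrix_def\<close>)
  next
    show "column_matrix n k (\<lambda>i. a i + 0) \<in> carrier_mat n n"
      by (simp add: column_matrix_def)
    have "{z. column_matrix n k (\<lambda>i. a i + z) \<notin> zariski_closure n S} \<subseteq> (\<lambda>i. - a i) ` {..<n}"
    proof
      fix z assume "z \<in> {z. column_matrix n k (\<lambda>i. a i + z) \<notin> zariski_closure n S}"
      then obtain i where "i < n" "a i + z = 0" using 1[of "\<lambda>i. a i + z"] by blast
      then show "z \<in> (\<lambda>i. - a i) ` {..<n}"
        by (intro image_eqI[of _ _ i]) (auto simp: eq_neg_iff_add_eq_0 add.commute)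
    qed
    then show "finite {z. column_matrix n k (\<lambda>i. a i + z) \<notin> zariski_closure n S}"
      by (rule finite_subset) simp
  qed
  then show ?thesis by simp
qed

text \<open>Elimination column by column. The induction is on the number \<open>k\<close> of leading
  columns in which \<open>A\<close> may differ from the identity; a column matrix is split off on
  the left as long as the pivot is nonzero.\<close>

lemma zariski_closure_eq_carrier_if_columns:
  assumes col: "\<And>k a. k < n \<Longrightarrow> column_matrix n k a \<in> zariski_closure n S"
  shows "zariski_closure n S = carrier_mat n n"
proof -
  have "A \<in> zariski_closure n S"
    if "k \<le> n" "A \<in> carrier_mat n n"
      "\<And>i j. i < n \<Longrightarrow> j < n \<Longrightarrow> k \<le> j \<Longrightarrow> A $$ (i, j) = (if i = j then 1 else 0)" for k A
    using that
  proof (induction k arbitrary: A)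
    case 0
    then have "A = mat_diag n (\<lambda>_. 1)" by (auto simp: mat_diag_def intro!: eq_matI)
    then show ?case using diag by metis
  next
    case (Suc k)
    then have k: "k < n" and Ac: "A \<in> carrier_mat n n" by auto
    have 1: "B \<in> zariski_closure n S" if B: "B \<in> carrier_mat n n" "B $$ (k, k) \<noteq> 0"
      "\<And>i j. i < n \<Longrightarrow> j < n \<Longrightarrow> k < j \<Longrightarrow> B $$ (i, j) = (if i = j then 1 else 0)" for B
    proof -
      \<comment> \<open>The solution of \<open>?B * ?C = B\<close> whose column \<open>k\<close> is
        a unit vector. Columns right of \<open>k\<close> stay those of the identity because
        \<open>B $$ (k, j) = 0\<close> there.\<close>
      let ?C = "mat n n (\<lambda>(i, j). if j = k then (if i = k then 1 else 0)
        else if i = k then B $$ (k, j) / B $$ (k, k)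
        else B $$ (i, j) - B $$ (i, k) * B $$ (k, j) / B $$ (k, k))"
      have C: "?C \<in> zariski_closure n S"
        by (rule Suc.IH) (use k B in auto)
      let ?B = "column_matrix n k (\<lambda>i. B $$ (i, k))"
      have "?B * ?C = B"
      proof (rule eq_matI)
        fix i j assume "i < dim_row B" "j < dim_col B"
        then have ij: "i < n" "j < n" using B by auto
        have "(?B * ?C) $$ (i, j) = (\<Sum>r<n. ?B $$ (i, r) * ?C $$ (r, j))"
          using ij by (subst mat_mult_entries[of _ n n _ n]) (auto simp: column_matrix_def)
        also have "\<dots> = (\<Sum>r\<in>{k} \<union> {i}. ?B $$ (i, r) * ?C $$ (r, j))"
          using ij k by (intro sum.mono_neutral_right) (auto simp: column_matrix_def)
        also have "\<dots> = B $$ (i, j)"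
          using ij k B by (cases "i = k") (auto simp: column_matrix_def)
        finally show "(?B * ?C) $$ (i, j) = B $$ (i, j)" .
      qed (use B in \<open>auto simp: column_matrix_def\<close>)
      then show ?thesis
        using zariski_closure_mult[OF S SS col[OF k, of "\<lambda>i. B $$ (i, k)"] C] by simp
    qed
    \<comment> \<open>A zero pivot is handled by adding \<open>z\<close> to it: only one value of
      \<open>z\<close> is bad.\<close>
    let ?\<gamma> = "\<lambda>z. mat n n (\<lambda>(i, j). A $$ (i, j) + (if i = k \<and> j = k then z else 0))"
    have "?\<gamma> 0 \<in> zariski_closure n S"
    proof (rule zariski_closure_curve[where \<gamma> = ?\<gamma> and z = 0])
      fix i j assume ij: "i < n" "j < n"
      show "\<exists>q. \<forall>z. ?\<gamma> z $$ (i, j) = poly q z"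
        by (rule exI[of _ "[:A $$ (i, j), if i = k \<and> j = k then 1 else 0:]"]) (use ij in auto)
    next
      have "{z. ?\<gamma> z \<notin> zariski_closure n S} \<subseteq> {- A $$ (k, k)}"
      proof
        fix z assume "z \<in> {z. ?\<gamma> z \<notin> zariski_closure n S}"
        then have "?\<gamma> z $$ (k, k) = 0"
          using 1[of "?\<gamma> z"] Suc.prems k by fastforce
        then show "z \<in> {- A $$ (k, k)}"
          using k by (simp add: eq_neg_iff_add_eq_0 add.commute)
      qed
      then show "finite {z. ?\<gamma> z \<notin> zariski_closure n S}"
        by (rule finite_subset) simp
    qed simp
    also have "?\<gamma> 0 = A" using Ac by (auto intro!: eq_matI)
    finally show ?case .
  qed
  from this[of n] show ?thesis
    using zariski_closure_carrier by (intro subset_antisym subsetI) auto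
qed

end

text \<open>The last condition says that for every \<open>k\<close> some conjugate of a matrix unit
  \<open>E_ll\<close> by an element of \<open>S\<close> has no zero in column \<open>k\<close> off
  the diagonal: its entries there are \<open>A $$ (i, l) * A' $$ (l, k)\<close>.\<close>

theorem zariski_closure_eq_carrier:
  assumes "S \<subseteq> carrier_mat n n" "\<And>A B. A \<in> S \<Longrightarrow> B \<in> S \<Longrightarrow> A * B \<in> S"
    and "inj_on (monomial_value d) {a. Poly_Mapping.keys a \<subseteq> {..<n}}"
    and "\<And>k. mat_diag n (\<lambda>i. d i ^ k) \<in> S"
    and "\<And>k. k < n \<Longrightarrow> \<exists>A\<in>S. \<exists>A'\<in>S. \<exists>l<n. A * A' = 1\<^sub>m n \<and>
      (\<forall>i<n. i \<noteq> k \<longrightarrow> A $$ (i, l) \<noteq> 0) \<and> A' $$ (l, k) \<noteq> 0"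
  shows "zariski_closure n S = carrier_mat n n"
  using assms diagonal_in_zariski_closure[OF assms(3,4)]
  by (intro zariski_closure_eq_carrier_if_columns column_matrix_in_closure) auto

section \<open>Subfields of the complex numbers\<close>

locale complex_subfield =
  fixes K :: "complex set"
  assumes subfield: "subfield K complex_field"
begin

lemma subring: "subring K complex_field"
  by (rule subfieldE(1)[OF subfield])

lemma zero_closed: "0 \<in> K" and one_closed: "1 \<in> K"
  and add_closed: "a \<in> K \<Longrightarrow> b \<in> K \<Longrightarrow> a + b \<in> K"
  and mult_closed: "a \<in> K \<Longrightarrow> b \<in> K \<Longrightarrow> a * b \<in> K"
  using subringE[OF subring] by (auto simp: ring_of_type_algebra_def)

lemma uminus_closed: assumes "a \<in> K" shows "- a \<in> K"
proof -
  interpret field complex_field by (rule field_from_type_algebra)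
  have "\<ominus>\<^bsub>complex_field\<^esub> a = - a"
    by (rule minus_equality) (auto simp: ring_of_type_algebra_def)
  then show ?thesis using subringE(5)[OF subring assms] by simp
qed

lemma inverse_closed: assumes "a \<in> K" shows "inverse a \<in> K"
proof (cases "a = 0")
  case False
  interpret field complex_field by (rule field_from_type_algebra)
  have "inv\<^bsub>complex_field\<^esub> a = inverse a"
    by (rule comm_inv_char) (use False in \<open>auto simp: ring_of_type_algebra_def\<close>)
  then show ?thesis
    using subfield_m_inv(1)[OF subfield, of a] assms False by (simp add: ring_of_type_algebra_def)
qed (simp add: zero_closed)

lemma diff_closed: "a \<in> K \<Longrightarrow> b \<in> K \<Longrightarrow> a - b \<in> K"
  using add_closed[OF _ uminus_closed, of a b] by simp

lemma divide_closed: "a \<in> K \<Longrightarrow> b \<in> K \<Longrightarrow> a / b \<in> K"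
  using mult_closed[OF _ inverse_closed, of a b] by (simp add: divide_inverse)

lemma sum_closed: "(\<And>i. i \<in> I \<Longrightarrow> f i \<in> K) \<Longrightarrow> sum f I \<in> K"
  by (induction I rule: infinite_finite_induct) (auto intro: zero_closed add_closed)

lemma prod_closed: "(\<And>i. i \<in> I \<Longrightarrow> f i \<in> K) \<Longrightarrow> prod f I \<in> K"
  by (induction I rule: infinite_finite_induct) (auto intro: one_closed mult_closed)

lemma power_closed: "a \<in> K \<Longrightarrow> a ^ k \<in> K"
  by (induction k) (auto intro: one_closed mult_closed)

lemma of_nat_closed: "of_nat k \<in> K"
  by (induction k) (auto intro: zero_closed one_closed add_closed)

lemma numeral_closed: "numeral k \<in> K"
  using of_nat_closed[of "numeral k"] by simp

lemmas closed = zero_closed one_closed add_closed mult_closed uminus_closed diff_closed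
  inverse_closed divide_closed sum_closed prod_closed power_closed of_nat_closed numeral_closed

lemma mult_mat_space:
  assumes "A \<in> mat_space n K" "B \<in> mat_space n K"
  shows "A * B \<in> mat_space n K"
  using assms by (auto simp: mat_space_def scalar_prod_def intro!: closed)

text \<open>Makes the fact that algebraic elements form a subfield applicable to the closure defined
  by complex polynomials.\<close>

lemma algebraic_closure_eq:
  "algebraic_closure_in_complex K =
     {z \<in> carrier complex_field. ring.algebraic complex_field K z}"
proof -
  interpret CF: field complex_field by (rule field_from_type_algebra)
  have pow: "x [^]\<^bsub>complex_field\<^esub> (k :: nat) = x ^ k" for x k
    by (induction k) (auto simp: ring_of_type_algebra_def nat_pow_def)
  \<comment> \<open>Polynomials of \<open>HOL-Algebra\<close> are lists with the leading coefficient
    first, those of \<open>Poly\<close> have the constant term first.\<close>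
  have eval: "CF.eval p x = poly (Poly (rev p)) x" for p x
  proof (induction p)
    case (Cons a p)
    then show ?case
      by (simp add: pow Poly_append poly_monom)
        (simp add: ring_of_type_algebra_def)
  next
    case Nil
    have "CF.eval [] x = \<zero>\<^bsub>complex_field\<^esub>" by simp
    then show ?case by (simp add: ring_of_type_algebra_def)
  qed
  show ?thesis
  proof (intro Set.set_eqI iffI)
    fix z assume "z \<in> algebraic_closure_in_complex K"
    then obtain p where p: "p \<noteq> 0" "\<And>i. Polynomial.coeff p i \<in> K" "poly p z = 0"
      by (auto simp: algebraic_closure_in_complex_def)
    have "CF.algebraic K z"
    proof (rule CF.algebraicI[unfolded over_def])
      show "rev (coeffs p) \<in> carrier (univ_poly complex_field K)"
        using p(1,2) by (auto simp: univ_poly_def polynomial_def coeffs_def hd_rev last_map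
            ring_of_type_algebra_def)
      show "rev (coeffs p) \<noteq> []" using p by simp
      show "CF.eval (rev (coeffs p)) z = \<zero>\<^bsub>complex_field\<^esub>"
        using p(3) by (simp add: eval) (simp add: ring_of_type_algebra_def)
    qed
    then show "z \<in> {z \<in> carrier complex_field. CF.algebraic K z}"
      by (simp add: ring_of_type_algebra_def)
  next
    fix z assume z: "z \<in> {z \<in> carrier complex_field. CF.algebraic K z}"
    obtain p where p: "p \<in> carrier (univ_poly complex_field K)" "p \<noteq> []" "CF.eval p z = \<zero>\<^bsub>complex_field\<^esub>"
      by (rule CF.algebraicE[unfolded over_def, OF subring, of z]) (use z in auto)
    from p(1,2) have "set p \<subseteq> K" "hd p \<noteq> 0"
      by (auto simp: univ_poly_def polynomial_def ring_of_type_algebra_def)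
    show "z \<in> algebraic_closure_in_complex K"
      unfolding algebraic_closure_in_complex_def mem_Collect_eq
    proof (intro exI[of _ "Poly (rev p)"] conjI allI)
      have "Polynomial.coeff (Poly (rev p)) (length p - 1) = hd p"
        using p(2) by (simp add: nth_default_def rev_nth hd_conv_nth)
      then show "Poly (rev p) \<noteq> 0" using \<open>hd p \<noteq> 0\<close> by (metis coeff_0)
      show "Polynomial.coeff (Poly (rev p)) i \<in> K" for i
        using \<open>set p \<subseteq> K\<close> zero_closed nth_mem[of i "rev p"]
        by (auto simp: nth_default_def)
      show "poly (Poly (rev p)) z = 0"
        using p(3) by (simp add: eval) (simp add: ring_of_type_algebra_def)
    qed
  qed
qed

lemma subset_algebraic_closure: "K \<subseteq> algebraic_closure_in_complex K"
proof
  fix z assume "z \<in> K"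
  then show "z \<in> algebraic_closure_in_complex K"
    by (auto simp: algebraic_closure_in_complex_def coeff_pCons intro!: exI[of _ "[:- z, 1:]"] closed
        split: nat.split)
qed

lemma complex_subfield_algebraic_closure: "complex_subfield (algebraic_closure_in_complex K)"
proof (rule complex_subfield.intro)
  interpret field complex_field by (rule field_from_type_algebra)
  show "subfield (algebraic_closure_in_complex K) complex_field"
    using subfield_of_algebraics[OF subfield] by (simp add: algebraic_closure_eq over_def)
qed

lemma algebraically_independent_sum:
  assumes t: "algebraically_independent K I t" and "finite E"
    and "\<And>a. a \<in> E \<Longrightarrow> Poly_Mapping.keys a \<subseteq> I" "\<And>a. a \<in> E \<Longrightarrow> c a \<in> K"
    and sum: "(\<Sum>a\<in>E. c a * (\<Prod>i\<in>Poly_Mapping.keys a. t i ^ Poly_Mapping.lookup a i)) = 0"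
    and b: "b \<in> E"
  shows "c b = 0"
proof -
  let ?p = "\<Sum>a\<in>E. Poly_Mapping.single a (c a)"
  have lookup: "Poly_Mapping.lookup ?p a = (if a \<in> E then c a else 0)" for a
    using \<open>finite E\<close> by (simp add: lookup_sum lookup_single when_def)
  have "Poly_Mapping.keys ?p \<subseteq> E"
    using lookup by (auto simp: in_keys_iff split: if_splits)
  then have "?p \<in> mpolys K I"
    using assms(3,4) by (auto simp: mpolys_def lookup zero_closed)
  moreover have "mpoly_eval t ?p = 0"
    using sum \<open>finite E\<close> by (simp add: mpoly_eval_sum mpoly_eval_single)
  ultimately have "?p = 0" using t by (auto simp: algebraically_independent_def)
  then show ?thesis using lookup[of b] b by simp
qed

text \<open>Different exponents would make the equation a relation between two distinct monomials,
  with the nonzero coefficient \<open>c\<close> at the first.\<close>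

lemma algebraically_independent_monomials:
  assumes t: "algebraically_independent K I t" and "finite I" and c: "c \<in> K" "c' \<in> K" "c \<noteq> 0"
    and eq: "c * (\<Prod>i\<in>I. t i ^ e i) = c' * (\<Prod>i\<in>I. t i ^ e' i)" and i: "i \<in> I"
  shows "e i = e' i"
proof (rule ccontr)
  define a where "a f = Abs_poly_mapping (\<lambda>i. if i \<in> I then f i else 0 :: nat)" for f
  have lookup: "Poly_Mapping.lookup (a f) = (\<lambda>i. if i \<in> I then f i else 0)" for f
  proof -
    have "{i. (if i \<in> I then f i else 0) \<noteq> 0} \<subseteq> I" by (auto split: if_split_asm)
    then show ?thesis
      unfolding a_def using \<open>finite I\<close> by (intro lookup_Abs_poly_mapping) (rule finite_subset)
  qed
  have keys: "Poly_Mapping.keys (a f) \<subseteq> I" for f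
    by (auto simp: in_keys_iff lookup split: if_splits)
  have val: "(\<Prod>i\<in>Poly_Mapping.keys (a f). t i ^ Poly_Mapping.lookup (a f) i) = (\<Prod>i\<in>I. t i ^ f i)" for f
    by (rule prod.mono_neutral_cong_left) (use \<open>finite I\<close> keys in \<open>auto simp: lookup in_keys_iff\<close>)
  assume "e i \<noteq> e' i"
  then have "a e \<noteq> a e'" using lookup i by metis
  with eq have rel: "(\<Sum>b\<in>{a e, a e'}. (if b = a e then c else - c') *
      (\<Prod>i\<in>Poly_Mapping.keys b. t i ^ Poly_Mapping.lookup b i)) = 0"
    by (simp add: val)
  have "(if a e = a e then c else - c') = 0"
    by (rule algebraically_independent_sum[OF t _ _ _ rel])
      (use c keys uminus_closed in \<open>auto split: if_splits\<close>)
  then show False using c by simp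
qed

end

lemma complex_subfield_cyclotomic: "complex_subfield (cyclotomic_field k)"
proof (rule complex_subfield.intro)
  interpret field complex_field by (rule field_from_type_algebra)
  show "subfield (cyclotomic_field k) complex_field"
    unfolding cyclotomic_field_def
    by (rule generate_field_is_subfield) (simp add: ring_of_type_algebra_def)
qed

lemma roots_of_unity_cyclotomic: "z ^ k = 1 \<Longrightarrow> z \<in> cyclotomic_field k"
  by (auto simp: cyclotomic_field_def roots_of_unity_def intro: generate_field.incl)

section \<open>Diagonalization and rationality\<close>

lemma conj_mult:
  assumes "R * R' = 1\<^sub>m n" "R \<in> carrier_mat n n" "R' \<in> carrier_mat n n"
    "A \<in> carrier_mat n n" "B \<in> carrier_mat n n"
  shows "(R' * A * R) * (R' * B * R) = R' * (A * B) * (R :: 'a :: comm_ring_1 mat)"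
proof -
  have "(R' * A * R) * (R' * B * R) = R' * (A * (R * R') * B) * R"
    using assms(2-5) by (simp add: assoc_mult_mat[of _ n n _ n _ n])
  also have "\<dots> = R' * (A * B) * R"
    using assms by simp
  finally show ?thesis .
qed

definition mat_trace :: "'a :: comm_ring_1 mat \<Rightarrow> 'a" where
  "mat_trace A = (\<Sum>i<dim_row A. A $$ (i, i))"

lemma mat_trace_mult_comm:
  assumes "A \<in> carrier_mat n n" "B \<in> carrier_mat n n"
  shows "mat_trace (A * B) = mat_trace (B * A)"
  using assms unfolding mat_trace_def
  by (simp add: mat_mult_entries[of _ n n _ n]) (subst sum.swap, simp add: mult.commute)

lemma mat_trace_conj:
  assumes "R * R' = 1\<^sub>m n" "R \<in> carrier_mat n n" "R' \<in> carrier_mat n n" "A \<in> carrier_mat n n"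
  shows "mat_trace (R' * A * R) = mat_trace A"
proof -
  have "mat_trace (R' * A * R) = mat_trace (R * (R' * A))"
    by (rule mat_trace_mult_comm[of _ n]) (use assms in auto)
  also have "R * (R' * A) = A"
    using assms by (simp flip: assoc_mult_mat[of _ n n _ n _ n])
  finally show ?thesis .
qed

text \<open>After triangularization the trace is the sum of the eigenvalues, and each of them is an
  \<open>m\<close>-th root of unity.\<close>

lemma (in complex_subfield) finite_order_mat_trace_closed:
  assumes A: "A \<in> carrier_mat n n" "A ^\<^sub>m m = 1\<^sub>m n"
    and roots: "\<And>z. z ^ m = 1 \<Longrightarrow> z \<in> K"
  shows "mat_trace A \<in> K"
proof -
  obtain es where es: "char_poly A = (\<Prod>e\<leftarrow>es. [:- e, 1:])"
    using char_poly_factorized[OF A(1)] by blast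
  obtain B P Q where "schur_decomposition A es = (B, P, Q)" by (metis prod_cases3)
  from schur_decomposition[OF A(1) es this]
  have sim: "similar_mat_wit A B P Q" and diag: "diag_mat B = es" by auto
  note * = similar_mat_witD2[OF A(1) sim]
  have "mat_trace A = mat_trace B"
    unfolding *(3) by (rule mat_trace_conj[OF *(2)]) (use * in auto)
  also have "\<dots> = sum_list es"
    using *(5) by (simp add: mat_trace_def diag_mat_def interv_sum_list_conv_sum_set_nat
        atLeast0LessThan flip: diag)
  also have "\<dots> = (\<Sum>i<length es. es ! i)"
    by (simp add: sum_list_sum_nth atLeast0LessThan)
  also have "\<dots> \<in> K"
  proof (intro sum_closed roots)
    fix i assume "i \<in> {..<length es}"
    then have "poly (char_poly A) (es ! i) = 0"
      unfolding es by (intro linear_poly_root) auto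
    then obtain v where v: "eigenvector A v (es ! i)"
      using eigenvalue_root_char_poly[OF A(1)] by (auto simp: eigenvalue_def)
    then have vc: "v \<in> carrier_vec n" "v \<noteq> 0\<^sub>v n" using A(1) by (auto simp: eigenvector_def)
    have "v = es ! i ^ m \<cdot>\<^sub>v v"
      using eigenvector_pow[OF A(1) v, of m] vc A(2) by simp
    moreover obtain j where j: "j < n" "v $ j \<noteq> 0"
      using vc by (metis carrier_vecD eq_vecI index_zero_vec)
    ultimately have "v $ j = es ! i ^ m * v $ j"
      using vc by (metis carrier_vecD index_smult_vec(1))
    then show "es ! i ^ m = 1" using j by simp
  qed
  finally show ?thesis .
qed

text \<open>Applying powers of the matrix to a linear relation between its eigenvectors turns the relation
  into a system of power sums.\<close>

lemma det_eigenvector_matrix_nonzero: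
  assumes A: "A \<in> carrier_mat n n" and W: "W \<in> carrier_mat n n"
    and eq: "A * W = W * mat_diag n e" and inj: "inj_on e {..<n}"
    and nz: "\<And>j. j < n \<Longrightarrow> \<exists>i<n. W $$ (i, j) \<noteq> 0"
  shows "det (W :: complex mat) \<noteq> 0"
proof
  assume "det W = 0"
  then obtain v where v: "v \<in> carrier_vec n" "v \<noteq> 0\<^sub>v n" "W *\<^sub>v v = 0\<^sub>v n"
    using det_0_iff_vec_prod_zero_field[OF W] by blast
  have entry: "(\<Sum>r<n. A $$ (i, r) * W $$ (r, j)) = W $$ (i, j) * e j" if "i < n" "j < n" for i j
  proof -
    have "(A * W) $$ (i, j) = (W * mat_diag n e) $$ (i, j)" by (simp add: eq)
    then show ?thesis
      using that by (simp add: mat_mult_entries[OF A W] mat_diag_mult_right[OF W])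
  qed
  have sum: "(\<Sum>j<n. W $$ (i, j) * v $ j * e j ^ k) = 0" if "i < n" for i k
    using that
  proof (induction k arbitrary: i)
    case 0
    then have "(W *\<^sub>v v) $ i = 0" using v(3) by simp
    then show ?case
      using 0 W v(1) by (simp add: scalar_prod_def atLeast0LessThan)
  next
    case (Suc k)
    have "(\<Sum>j<n. W $$ (i, j) * v $ j * e j ^ Suc k) =
        (\<Sum>j<n. (\<Sum>r<n. A $$ (i, r) * W $$ (r, j)) * v $ j * e j ^ k)"
      using Suc.prems by (intro sum.cong) (auto simp: entry)
    also have "\<dots> = (\<Sum>r<n. A $$ (i, r) * (\<Sum>j<n. W $$ (r, j) * v $ j * e j ^ k))"
      unfolding sum_distrib_left sum_distrib_right by (subst sum.swap) (simp add: mult_ac)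
    also have "\<dots> = 0" using Suc.IH by simp
    finally show ?case .
  qed
  have "v $ j = 0" if j: "j < n" for j
  proof -
    obtain i where i: "i < n" "W $$ (i, j) \<noteq> 0" using nz[OF j] by blast
    have "W $$ (i, j) * v $ j = 0"
      by (rule power_sums_vanish[of "{..<n}" e "\<lambda>j. W $$ (i, j) * v $ j"])
        (use sum[OF i(1)] inj j in auto)
    then show ?thesis using i by simp
  qed
  then have "v = 0\<^sub>v n" using v(1) by auto
  with v(2) show False by simp
qed

lemma det_nonzero_inverse:
  assumes "A \<in> carrier_mat n n" "det (A :: complex mat) \<noteq> 0"
  obtains B where "B \<in> carrier_mat n n" "A * B = 1\<^sub>m n" "B * A = 1\<^sub>m n"
  using det_non_zero_imp_unit[OF assms, of "()"] by (auto simp: Units_def ring_mat_def)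

lemma distinct_eigenvalues_diagonalizable:
  fixes A :: "complex mat"
  assumes A: "A \<in> carrier_mat n n" and es: "char_poly A = (\<Prod>e\<leftarrow>es. [:- e, 1:])" "distinct es"
  obtains W W' e where "W \<in> carrier_mat n n" "W' \<in> carrier_mat n n" "W * W' = 1\<^sub>m n" "W' * W = 1\<^sub>m n"
    "W' * A * W = mat_diag n e" "inj_on e {..<n :: nat}"
proof -
  have len: "length es = n"
    using degree_monic_char_poly[OF A] unfolding es(1) by (simp add: degree_linear_factors)
  have "\<exists>v. eigenvector A v (es ! j)" if "j < n" for j
  proof -
    have "poly (char_poly A) (es ! j) = 0"
      unfolding es(1) using that len by (intro linear_poly_root) auto
    then show ?thesis
      using eigenvalue_root_char_poly[OF A] by (simp add: eigenvalue_def)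
  qed
  then obtain v where v: "\<And>j. j < n \<Longrightarrow> eigenvector A (v j) (es ! j)" by metis
  define W where "W = mat n n (\<lambda>(i, j). v j $ i)"
  have vc: "v j \<in> carrier_vec n" "v j \<noteq> 0\<^sub>v n" "A *\<^sub>v v j = es ! j \<cdot>\<^sub>v v j" if "j < n" for j
    using v[OF that] A by (auto simp: eigenvector_def)
  have W: "W \<in> carrier_mat n n" by (simp add: W_def)
  have eq: "A * W = W * mat_diag n (\<lambda>j. es ! j)"
  proof (rule eq_matI)
    fix i j assume "i < dim_row (W * mat_diag n (\<lambda>j. es ! j))"
      "j < dim_col (W * mat_diag n (\<lambda>j. es ! j))"
    then have ij: "i < n" "j < n" by (auto simp: W_def mat_diag_def)
    have "col W j = v j" using ij vc(1)[OF ij(2)] by (auto simp: W_def)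
    then have "(A * W) $$ (i, j) = (A *\<^sub>v v j) $ i" using ij A W by simp
    also have "\<dots> = (W * mat_diag n (\<lambda>j. es ! j)) $$ (i, j)"
      unfolding mat_diag_mult_right[OF W] using ij vc[OF ij(2)] by (simp add: W_def)
    finally show "(A * W) $$ (i, j) = (W * mat_diag n (\<lambda>j. es ! j)) $$ (i, j)" .
  qed (use A W in \<open>auto simp: mat_diag_def\<close>)
  have inj: "inj_on (\<lambda>j. es ! j) {..<n}"
    using es(2) len by (auto simp: inj_on_def nth_eq_iff_index_eq)
  have "det W \<noteq> 0"
  proof (rule det_eigenvector_matrix_nonzero[OF A W eq inj])
    fix j assume j: "j < n"
    then obtain i where "i < n" "v j $ i \<noteq> 0"
      using vc[OF j] by (metis carrier_vecD eq_vecI index_zero_vec)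
    then show "\<exists>i<n. W $$ (i, j) \<noteq> 0" using j by (auto simp: W_def)
  qed
  then obtain W' where W': "W' \<in> carrier_mat n n" "W * W' = 1\<^sub>m n" "W' * W = 1\<^sub>m n"
    using det_nonzero_inverse[OF W] by blast
  have "W' * A * W = W' * (W * mat_diag n (\<lambda>j. es ! j))"
    using A W W' by (simp add: eq[symmetric])
  also have "\<dots> = mat_diag n (\<lambda>j. es ! j)"
    using W W' by (simp add: left_mult_one_mat[OF mat_diag_dim] flip: assoc_mult_mat[of _ n n _ n _ n])
  finally show thesis using that W W' inj by blast
qed

text \<open>The rational counterpart of \<open>power_sums_vanish\<close>. The Lagrange factors
  \<open>z i - z r\<close> are multiplied in one at a time, each step being a combination over
  \<open>K\<close> of two earlier sums; with all \<open>r\<close> except \<open>j\<close> present,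
  only the summand of \<open>a j\<close> survives.\<close>

lemma (in complex_subfield) power_sums_closed_imp_closed:
  assumes z: "inj_on z {..<n}" "\<And>i. i < n \<Longrightarrow> z i \<in> K"
    and sums: "\<And>k. (\<Sum>i<n. z i ^ k * a i) \<in> K" and j: "j < (n :: nat)"
  shows "a j \<in> K"
proof -
  have 1: "(\<Sum>i<n. z i ^ k * (\<Prod>r\<in>T. z i - z r) * a i) \<in> K" if "finite T" "T \<subseteq> {..<n}" for T k
    using that
  proof (induction T arbitrary: k rule: finite_induct)
    case empty
    then show ?case using sums by simp
  next
    case (insert r T)
    have "(\<Sum>i<n. z i ^ k * (\<Prod>r\<in>insert r T. z i - z r) * a i) =
        (\<Sum>i<n. z i ^ Suc k * (\<Prod>r\<in>T. z i - z r) * a i) -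
        z r * (\<Sum>i<n. z i ^ k * (\<Prod>r\<in>T. z i - z r) * a i)"
      unfolding sum_distrib_left sum_subtractf[symmetric] using insert.hyps
      by (intro sum.cong) (auto simp: algebra_simps)
    also have "\<dots> \<in> K" using insert.prems
      by (intro diff_closed mult_closed insert.IH z(2)) auto
    finally show ?case .
  qed
  let ?T = "{..<n} - {j}"
  let ?P = "\<Prod>r\<in>?T. z j - z r"
  have "(\<Sum>i<n. z i ^ 0 * (\<Prod>r\<in>?T. z i - z r) * a i) = ?P * a j"
    using j by (subst sum.remove[of _ j]) (auto intro!: sum.neutral)
  moreover have "?P \<noteq> 0"
    using z(1) j by (auto simp: inj_on_def)
  ultimately have "a j = (\<Sum>i<n. z i ^ 0 * (\<Prod>r\<in>?T. z i - z r) * a i) / ?P"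
    by simp
  also have "\<dots> \<in> K"
    using 1[of ?T 0] j z(2) by (intro divide_closed prod_closed diff_closed) auto
  finally show ?thesis .
qed

text \<open>Brauer's realization theorem is elementary for a group that contains a diagonal matrix with
  distinct entries: the traces lie in \<open>K\<close>, Lagrange interpolation at that matrix isolates the
  products of entries along closed paths, and a diagonal rescaling does the rest.\<close>

lemma (in complex_subfield) realizable_after_rescaling:
  assumes n: "0 < n" and M: "M \<subseteq> carrier_mat n n" and MM: "\<And>A B. A \<in> M \<Longrightarrow> B \<in> M \<Longrightarrow> A * B \<in> M"
    and trace: "\<And>A. A \<in> M \<Longrightarrow> mat_trace A \<in> K"
    and D: "mat_diag n z \<in> M" and z: "inj_on z {..<n}" "\<And>i. i < n \<Longrightarrow> z i \<in> K"
    and irred: "\<And>i j. i < n \<Longrightarrow> j < n \<Longrightarrow> \<exists>A\<in>M. A $$ (i, j) \<noteq> 0"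
  obtains c where "\<And>i. i < n \<Longrightarrow> c i \<noteq> 0"
    and "\<And>A i j. A \<in> M \<Longrightarrow> i < n \<Longrightarrow> j < n \<Longrightarrow> A $$ (i, j) * c j / c i \<in> K"
proof -
  have pow: "mat_diag n (\<lambda>i. z i ^ k) * A \<in> M" if "A \<in> M" for A k
  proof (induction k)
    case 0
    then show ?case using that M by auto
  next
    case (Suc k)
    have "mat_diag n (\<lambda>i. z i ^ Suc k) * A = mat_diag n z * (mat_diag n (\<lambda>i. z i ^ k) * A)"
      using that M by (simp add: subset_iff flip: assoc_mult_mat[of _ n n _ n _ n])
    then show ?case using MM[OF D Suc.IH] by simp
  qed
  have entry: "(A * (mat_diag n y * B)) $$ (i, j) = (\<Sum>r<n. y r * (A $$ (i, r) * B $$ (r, j)))"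
    if "A \<in> M" "B \<in> M" "i < n" "j < n" for A B y i j
  proof -
    have AB: "A \<in> carrier_mat n n" "B \<in> carrier_mat n n" using that M by auto
    show ?thesis
      using that(3,4) unfolding mat_diag_mult_left[OF AB(2)]
      by (subst mat_mult_entries[OF AB(1)]) (auto intro!: sum.cong)
  qed
  \<comment> \<open>Facts 1, 2 and 3 treat closed paths of length one, two and three. Powers of
    \<open>mat_diag n z\<close> inserted between two factors separate the terms of the sum over an
    intermediate index.\<close>
  have 1: "A $$ (i, i) \<in> K" if A: "A \<in> M" and i: "i < n" for A i
  proof (rule power_sums_closed_imp_closed[OF z _ i])
    fix k
    have "mat_trace (mat_diag n (\<lambda>i. z i ^ k) * A) \<in> K" by (intro trace pow A)
    then show "(\<Sum>i<n. z i ^ k * A $$ (i, i)) \<in> K"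
      using A M carrier_matD(1)[OF mat_diag_dim, of n "\<lambda>i. z i ^ k"]
      by (simp add: mat_trace_def subset_iff mat_diag_mult_left[of A n n])
  qed auto
  have 2: "A $$ (i, j) * B $$ (j, i) \<in> K" if "A \<in> M" "B \<in> M" "i < n" "j < n" for A B i j
  proof (rule power_sums_closed_imp_closed[OF z, where a = "\<lambda>j. A $$ (i, j) * B $$ (j, i)"])
    fix k
    have "(A * (mat_diag n (\<lambda>i. z i ^ k) * B)) $$ (i, i) \<in> K"
      by (intro 1 MM pow that)
    then show "(\<Sum>j<n. z j ^ k * (A $$ (i, j) * B $$ (j, i))) \<in> K"
      by (simp add: entry that)
  qed (use that in auto)
  have 3: "A $$ (i, j) * B $$ (j, r) * C $$ (r, i) \<in> K"
    if "A \<in> M" "B \<in> M" "C \<in> M" "i < n" "j < n" "r < n" for A B C i j r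
  proof (rule power_sums_closed_imp_closed[OF z, where a = "\<lambda>r. A $$ (i, j) * B $$ (j, r) * C $$ (r, i)"])
    fix k
    have "A $$ (i, j) * (B * (mat_diag n (\<lambda>i. z i ^ k) * C)) $$ (j, i) \<in> K"
      by (intro 2 MM pow that)
    then show "(\<Sum>r<n. z r ^ k * (A $$ (i, j) * B $$ (j, r) * C $$ (r, i))) \<in> K"
      by (simp add: entry that sum_distrib_left mult_ac)
  qed (use that in auto)
  obtain g where g: "\<And>j. j < n \<Longrightarrow> g j \<in> M" "\<And>j. j < n \<Longrightarrow> g j $$ (j, 0) \<noteq> 0"
  proof -
    have "\<forall>j. \<exists>A. j < n \<longrightarrow> A \<in> M \<and> A $$ (j, 0) \<noteq> 0" using irred n by blast
    then show ?thesis using that by metis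
  qed
  show thesis
  proof (rule that[of "\<lambda>j. g j $$ (j, 0)"])
    fix A i j assume A: "A \<in> M" and ij: "i < n" "j < n"
    obtain H where H: "H \<in> M" "H $$ (0, i) \<noteq> 0" using irred n ij by blast
    \<comment> \<open>An entry from 0 to \<open>i\<close> closes both paths: the quotient becomes a
      closed path of length three over one of length two.\<close>
    have "A $$ (i, j) * g j $$ (j, 0) / g i $$ (i, 0) =
        H $$ (0, i) * A $$ (i, j) * g j $$ (j, 0) / (H $$ (0, i) * g i $$ (i, 0))"
      using H g ij by (simp add: field_simps)
    also have "\<dots> \<in> K" by (intro divide_closed 2 3 H A g ij n)
    finally show "A $$ (i, j) * g j $$ (j, 0) / g i $$ (i, 0) \<in> K" .
  qed (use g in auto)
qed

section \<open>A reflection with prescribed product spectrum\<close>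

lemma sum_lessThan_indicator:
  fixes f :: "nat \<Rightarrow> 'a :: comm_semiring_1"
  assumes "i < n"
  shows "(\<Sum>k<n. (if k = i then 1 else 0) * f k) = f i" "(\<Sum>k<n. (if i = k then 1 else 0) * f k) = f i"
    "(\<Sum>k<n. f k * (if k = i then 1 else 0)) = f i" "(\<Sum>k<n. f k * (if i = k then 1 else 0)) = f i"
  using assms by (simp_all add: if_distrib[where f = "\<lambda>c. c * _"] if_distrib[where f = "\<lambda>c. _ * c"] cong: if_cong)

lemma conj_inverse_conj:
  assumes "Q * Q' = 1\<^sub>m n" "Q \<in> carrier_mat n n" "Q' \<in> carrier_mat n n" "A \<in> carrier_mat n n"
  shows "Q * (Q' * A * Q) * Q' = (A :: 'a :: comm_ring_1 mat)"
proof -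
  have "Q * (Q' * A * Q) * Q' = Q * (Q' * A)"
    using assms by (simp add: assoc_mult_mat[of _ n n _ n _ n] mult_carrier_mat[of _ n n])
  also have "\<dots> = Q * Q' * A"
    by (rule assoc_mult_mat[symmetric, of _ n n _ n _ n]) (use assms in auto)
  finally show ?thesis using assms by simp
qed

lemma zariski_closure_conj:
  assumes R: "R * R' = 1\<^sub>m n" "R \<in> carrier_mat n n" "R' \<in> carrier_mat n n"
    and S: "S \<subseteq> carrier_mat n n"
    and dense: "zariski_closure n ((\<lambda>A. R' * A * R) ` S) = carrier_mat n n"
  shows "zariski_closure n S = carrier_mat n n"
proof -
  define S' where "S' = (\<lambda>A. R' * A * R) ` S"
  have conj_carrier: "R' * A * R \<in> carrier_mat n n" if "A \<in> carrier_mat n n" for A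
    using that by (intro mult_carrier_mat[of _ n n] R)
  have S': "S' \<subseteq> carrier_mat n n"
    using S conj_carrier by (auto simp: S'_def)
  have "A \<in> zariski_closure n S" if A: "A \<in> carrier_mat n n" for A
  proof -
    have "R * (R' * A * R) * R' \<in> zariski_closure n S"
    proof (rule zariski_closure_two_sided_mult[OF R(2) R(3) S'])
      fix B assume "B \<in> S'"
      then show "R * B * R' \<in> zariski_closure n S"
        unfolding S'_def using conj_inverse_conj[OF R] S zariski_closure_subset[OF S] by force
    next
      show "R' * A * R \<in> zariski_closure n S'"
        using conj_carrier[OF A] dense[folded S'_def] by simp
    qed
    then show ?thesis by (simp add: conj_inverse_conj[OF R A])
  qed
  then show ?thesis using zariski_closure_carrier by blast
qed

text \<open>\<open>prods\<close> is forced, because a reflection has determinant -1.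
  \<open>zl\<close> keeps the denominators of the Cauchy matrix nonzero.\<close>

locale cauchy_data =
  fixes n :: nat and z l :: "nat \<Rightarrow> complex"
  assumes n: "2 \<le> n" and inj_z: "inj_on z {..<n}" and inj_l: "inj_on l {..<n}"
    and z_nz: "\<And>i. i < n \<Longrightarrow> z i \<noteq> 0" and l_nz: "\<And>i. i < n \<Longrightarrow> l i \<noteq> 0"
    and zl: "\<And>i j. i < n \<Longrightarrow> j < n \<Longrightarrow> z i \<noteq> l j"
    and prods: "(\<Prod>j<n. l j) = - (\<Prod>j<n. z j)"
begin

text \<open>The weights for which \<open>s = 1 - 2 (1,\<dots>,1)\<^sup>T p\<close> is a reflection and \<open>diag(z) s\<close> has
  the eigenvalues \<open>l\<^sub>j\<close>; they come from partial fractions.\<close>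

definition p :: "nat \<Rightarrow> complex" where
  "p i = (\<Prod>j<n. z i - l j) / (2 * z i * (\<Prod>k\<in>{..<n} - {i}. z i - z k))"

definition R :: "complex mat" where
  "R = mat n n (\<lambda>(i, j). (if i = j then 1 else 0) - 2 * p j)"

text \<open>A Cauchy matrix with scaled rows. Solving \<open>diag(z) s v = l v\<close> gives
  \<open>(z i - l) * v i = 2 * z i * (p . v)\<close>; column \<open>j\<close> is the solution for
  \<open>l j\<close>, normalized by \<open>p . v = 1 / 2\<close>, which \<open>sum_p_W\<close>
  confirms.\<close>

definition W :: "complex mat" where
  "W = mat n n (\<lambda>(i, j). z i / (z i - l j))"

lemma R_carrier: "R \<in> carrier_mat n n" and W_carrier: "W \<in> carrier_mat n n"
  by (simp_all add: R_def W_def)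

text \<open>Lagrange interpolation at the nodes \<open>z i\<close>: on the right the leading terms
  cancel, so the degree is below \<open>n\<close>, and \<open>p\<close> is defined to give the
  correct values at the nodes.\<close>

lemma interpolation:
  "(\<Sum>i<n. 2 * z i * p i * (\<Prod>k\<in>{..<n} - {i}. x - z k)) = (\<Prod>j<n. x - l j) - (\<Prod>i<n. x - z i)"
proof -
  let ?P = "\<lambda>a T. \<Prod>j\<in>T. [:- a j, 1:]"
  let ?S = "\<Sum>i<n. Polynomial.smult (2 * z i * p i) (?P z ({..<n} - {i}))"
  have deg: "Polynomial.degree (?P a T) = card T" for a :: "nat \<Rightarrow> complex" and T
    by (subst degree_prod_eq_sum_degree) auto
  have lead: "Polynomial.coeff (?P a {..<n}) n = 1" for a :: "nat \<Rightarrow> complex"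
  proof -
    have "monic (?P a {..<n})" by (rule monic_prod) auto
    then show ?thesis by (simp add: deg)
  qed
  have "Polynomial.degree (Polynomial.smult (2 * z i * p i) (?P z ({..<n} - {i}))) \<le> n - 1" if "i < n" for i
    using that degree_smult_le[of "2 * z i * p i" "?P z ({..<n} - {i})"] by (simp add: deg)
  then have degS: "Polynomial.degree ?S \<le> n - 1"
    by (intro degree_sum_le) auto
  have "?P l {..<n} = ?P z {..<n} + ?S"
  proof (rule poly_eqI_degree_lead_coeff[where A = "z ` {..<n}" and n = n])
    have "Polynomial.coeff ?S n = 0" using degS n by (intro coeff_eq_0) auto
    then show "Polynomial.coeff (?P l {..<n}) n = Polynomial.coeff (?P z {..<n} + ?S) n" by (simp add: lead)
    show "Polynomial.degree (?P z {..<n} + ?S) \<le> n"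
      using degS by (intro degree_add_le) (auto simp: deg)
    show "card (z ` {..<n}) \<ge> n" using inj_z by (simp add: card_image)
    fix x assume "x \<in> z ` {..<n}"
    then obtain i where i: "i < n" "x = z i" by auto
    have "(\<Prod>k\<in>{..<n} - {i}. z i - z k) \<noteq> 0"
      using inj_z i by (auto simp: inj_on_def)
    then have "2 * z i * p i * (\<Prod>k\<in>{..<n} - {i}. z i - z k) = (\<Prod>j<n. z i - l j)"
      using z_nz[OF i(1)] by (simp add: p_def)
    moreover have "poly ?S (z i) = 2 * z i * p i * (\<Prod>k\<in>{..<n} - {i}. z i - z k)"
      using i unfolding poly_sum
      by (subst sum.remove[of _ i]) (auto simp: poly_prod intro!: sum.neutral)
    moreover have "(\<Prod>k<n. z i - z k) = 0" using i by auto
    ultimately show "poly (?P l {..<n}) x = poly (?P z {..<n} + ?S) x"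
      by (simp add: i poly_prod)
  qed (simp add: deg)
  from arg_cong[OF this, of "\<lambda>q. poly q x"] show ?thesis
    by (simp add: poly_prod poly_sum algebra_simps)
qed

text \<open>The quotient on the right is that of the characteristic polynomials of
  \<open>diag(z) s\<close> and \<open>diag(z)\<close>. Evaluation at 0 yields \<open>sum_p\<close>,
  evaluation at \<open>l j\<close> yields \<open>sum_p_W\<close>.\<close>

lemma p_partial_fractions:
  assumes "\<And>i. i < n \<Longrightarrow> x \<noteq> z i"
  shows "(\<Sum>i<n. 2 * z i * p i / (x - z i)) = (\<Prod>j<n. x - l j) / (\<Prod>i<n. x - z i) - 1"
proof -
  let ?Q = "\<Prod>i<n. x - z i"
  have Q: "?Q \<noteq> 0" using assms by auto
  have "(\<Prod>k\<in>{..<n} - {i}. x - z k) = ?Q / (x - z i)" if "i < n" for i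
    using that assms[OF that] by (subst prod.remove[of "{..<n}" i]) auto
  then have "(\<Sum>i<n. 2 * z i * p i / (x - z i) * ?Q) = (\<Prod>j<n. x - l j) - ?Q"
    unfolding interpolation[symmetric] by (intro sum.cong) auto
  then have "(\<Sum>i<n. 2 * z i * p i / (x - z i)) * ?Q = (\<Prod>j<n. x - l j) - ?Q"
    by (simp only: sum_distrib_right)
  then show ?thesis using Q by (simp add: field_simps)
qed

text \<open>This is the place where the determinant condition \<open>prods\<close> enters; the sum
  being 1 is what makes \<open>R\<close> an involution.\<close>

lemma sum_p: "(\<Sum>i<n. p i) = 1"
proof -
  have "(\<Sum>i<n. 2 * z i * p i / (0 - z i)) = (\<Prod>j<n. 0 - l j) / (\<Prod>i<n. 0 - z i) - 1"
    by (rule p_partial_fractions) (use z_nz in metis)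
  also have "(\<Prod>j<n. 0 - l j) = - (\<Prod>i<n. 0 - z i)"
    using prods by (simp add: prod_uminus)
  also have "- (\<Prod>i<n. 0 - z i) / (\<Prod>i<n. 0 - z i) = - 1"
    using z_nz by simp
  also have "(\<Sum>i<n. 2 * z i * p i / (0 - z i)) = (\<Sum>i<n. (- 2) * p i)"
    using z_nz by (intro sum.cong) auto
  also have "\<dots> = (- 2) * (\<Sum>i<n. p i)"
    by (simp only: sum_distrib_left)
  finally show ?thesis by simp
qed

lemma sum_p_W: assumes j: "j < n" shows "(\<Sum>i<n. p i * W $$ (i, j)) = 1 / 2"
proof -
  have "(\<Sum>i<n. 2 * z i * p i / (l j - z i)) = (\<Prod>k<n. l j - l k) / (\<Prod>i<n. l j - z i) - 1"
    by (rule p_partial_fractions) (use zl j in metis)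
  also have "(\<Prod>k<n. l j - l k) = 0" using j by auto
  also have "(\<Sum>i<n. 2 * z i * p i / (l j - z i)) = (\<Sum>i<n. (- 2) * (p i * W $$ (i, j)))"
  proof (rule sum.cong)
    fix i assume "i \<in> {..<n}"
    then have "z i \<noteq> l j" using zl j by blast
    then have "z i - l j \<noteq> 0" "l j - z i \<noteq> 0" by auto
    then show "2 * z i * p i / (l j - z i) = - 2 * (p i * W $$ (i, j))"
      using \<open>i \<in> {..<n}\<close> j by (simp add: W_def field_simps)
  qed simp
  also have "\<dots> = (- 2) * (\<Sum>i<n. p i * W $$ (i, j))"
    by (simp only: sum_distrib_left)
  finally show ?thesis by (simp add: field_simps)
qed

lemma R_mult:
  assumes A: "A \<in> carrier_mat n n"
  shows "R * A = mat n n (\<lambda>(i, j). A $$ (i, j) - 2 * (\<Sum>k<n. p k * A $$ (k, j)))"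
  unfolding mat_mult_entries[OF R_carrier A]
  by (intro eq_matI) (auto simp: R_def left_diff_distrib sum_subtractf sum_lessThan_indicator
      sum_distrib_left mult.assoc)

lemma R_R: "R * R = 1\<^sub>m n"
proof -
  have "(\<Sum>k<n. p k * R $$ (k, j)) = - p j" if "j < n" for j
  proof -
    have "(\<Sum>k<n. p k * R $$ (k, j)) = (\<Sum>k<n. p k * (if k = j then 1 else 0)) - 2 * p j * (\<Sum>k<n. p k)"
      unfolding sum_distrib_left sum_subtractf[symmetric]
      using that by (intro sum.cong) (auto simp: R_def algebra_simps)
    then show ?thesis using that by (simp add: sum_lessThan_indicator sum_p)
  qed
  then show ?thesis
    unfolding R_mult[OF R_carrier] by (intro eq_matI) (auto simp: R_def)
qed

lemma R_W: "R * W = mat n n (\<lambda>(i, j). W $$ (i, j) - 1)"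
  unfolding R_mult[OF W_carrier] by (intro eq_matI) (auto simp: sum_p_W)

lemma diag_R_W: "mat_diag n z * R * W = W * mat_diag n l"
proof -
  have "mat_diag n z * R * W = mat_diag n z * (R * W)"
    by (rule assoc_mult_mat[of _ n n _ n _ n]) (auto simp: R_carrier W_carrier)
  also have "\<dots> = W * mat_diag n l"
    unfolding R_W
  proof (subst mat_diag_mult_left[of _ _ n], simp, subst mat_diag_mult_right[OF W_carrier], rule eq_matI)
    fix i j assume "i < dim_row (mat n n (\<lambda>(i, j). W $$ (i, j) * l j))"
      "j < dim_col (mat n n (\<lambda>(i, j). W $$ (i, j) * l j))"
    then have ij: "i < n" "j < n" by auto
    then have "z i - l j \<noteq> 0" using zl by auto
    then show "mat n n (\<lambda>(i, j). z i * mat n n (\<lambda>(i, j). W $$ (i, j) - 1) $$ (i, j)) $$ (i, j) =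
        mat n n (\<lambda>(i, j). W $$ (i, j) * l j) $$ (i, j)"
      using ij by (simp add: W_def field_simps)
  qed auto
  finally show ?thesis .
qed

lemma det_W: "det W \<noteq> 0"
proof (rule det_eigenvector_matrix_nonzero[OF _ W_carrier diag_R_W inj_l])
  show "mat_diag n z * R \<in> carrier_mat n n" by (rule mult_carrier_mat[OF mat_diag_dim R_carrier])
  fix j assume j: "j < n"
  with n z_nz zl[of 0 j] show "\<exists>i<n. W $$ (i, j) \<noteq> 0"
    by (intro exI[of _ 0]) (auto simp: W_def)
qed

section \<open>The reflection in the eigenbasis of the product\<close>

definition W' :: "complex mat" where
  "W' = (SOME B. B \<in> carrier_mat n n \<and> W * B = 1\<^sub>m n \<and> B * W = 1\<^sub>m n)"

lemma W': "W' \<in> carrier_mat n n" "W * W' = 1\<^sub>m n" "W' * W = 1\<^sub>m n"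
proof -
  have "\<exists>B. B \<in> carrier_mat n n \<and> W * B = 1\<^sub>m n \<and> B * W = 1\<^sub>m n"
    using det_nonzero_inverse[OF W_carrier det_W] by blast
  from someI_ex[OF this] show "W' \<in> carrier_mat n n" "W * W' = 1\<^sub>m n" "W' * W = 1\<^sub>m n"
    unfolding W'_def by auto
qed

text \<open>The coordinates in the eigenbasis \<open>W\<close> of the vector
  \<open>(1,...,1)\<close>, which \<open>R\<close> negates. As \<open>p\<close> takes the value 1/2
  on every column of \<open>W\<close>, the reflection becomes the identity minus the matrix with all
  columns equal to \<open>b\<close>.\<close>

definition b :: "nat \<Rightarrow> complex" where
  "b i = (\<Sum>k<n. W' $$ (i, k))"

lemma R_conj: "W' * R * W = mat n n (\<lambda>(i, j). (if i = j then 1 else 0) - b i)"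
proof -
  have "W' * R * W = W' * (R * W)"
    by (rule assoc_mult_mat[of _ n n _ n _ n]) (auto simp: R_carrier W_carrier W')
  also have "\<dots> = mat n n (\<lambda>(i, j). (\<Sum>k<n. W' $$ (i, k) * W $$ (k, j)) - b i)"
    unfolding R_W by (subst mat_mult_entries[OF W'(1)])
      (auto simp: right_diff_distrib sum_subtractf b_def intro!: eq_matI)
  also have "\<dots> = mat n n (\<lambda>(i, j). (W' * W) $$ (i, j) - b i)"
    by (intro eq_matI) (auto simp: mat_mult_entries[OF W'(1) W_carrier])
  also have "\<dots> = mat n n (\<lambda>(i, j). (if i = j then 1 else 0) - b i)"
    unfolding W'(3) by (intro eq_matI) auto
  finally show ?thesis .
qed

lemma diag_R_conj: "W' * (mat_diag n z * R) * W = mat_diag n l"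
proof -
  have "W' * (mat_diag n z * R) * W = W' * (mat_diag n z * R * W)"
    by (rule assoc_mult_mat[of _ n n _ n _ n])
      (auto simp: R_carrier W_carrier W' intro: mult_carrier_mat[of _ n n])
  also have "\<dots> = W' * W * mat_diag n l"
    unfolding diag_R_W by (rule assoc_mult_mat[symmetric, of _ n n _ n _ n]) (auto simp: W_carrier W')
  finally show ?thesis by (simp add: W'(3) left_mult_one_mat[OF mat_diag_dim])
qed

lemma diag_conj: "W' * mat_diag n z * W = mat n n (\<lambda>(i, j). l i * ((if i = j then 1 else 0) - b i))"
proof -
  have "mat_diag n z = mat_diag n z * (R * R)"
    by (simp add: R_R right_mult_one_mat[OF mat_diag_dim])
  also have "\<dots> = mat_diag n z * R * R"
    by (rule assoc_mult_mat[symmetric, of _ n n _ n _ n]) (auto simp: R_carrier)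
  finally have "W' * mat_diag n z * W = W' * (mat_diag n z * R * R) * W" by simp
  also have "\<dots> = mat_diag n l * (W' * R * W)"
    unfolding diag_R_conj[symmetric]
    by (rule conj_mult[symmetric, OF W'(2) W_carrier W'(1) _ R_carrier])
      (auto simp: R_carrier intro: mult_carrier_mat[of _ n n])
  also have "\<dots> = mat n n (\<lambda>(i, j). l i * ((if i = j then 1 else 0) - b i))"
    unfolding R_conj by (subst mat_diag_mult_left[of _ _ n]) (auto intro!: eq_matI)
  finally show ?thesis .
qed

text \<open>If \<open>b i = 0\<close>, then row \<open>i\<close> of \<open>W' * diag(z) * W\<close>
  is \<open>l i\<close> times a unit vector, so row \<open>i\<close> of \<open>W'\<close> is a left
  eigenvector of \<open>diag(z)\<close> for \<open>l i\<close>. But \<open>l i\<close> is none of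
  the \<open>z k\<close>, so this row of an invertible matrix would be zero.\<close>

lemma b_nonzero: assumes i: "i < n" shows "b i \<noteq> 0"
proof
  assume b: "b i = 0"
  have "W' * mat_diag n z * W * W' = W' * mat_diag n z * (W * W')"
    by (rule assoc_mult_mat[of _ n n _ n _ n])
      (auto simp: W_carrier W' intro: mult_carrier_mat[of _ n n])
  then have eq: "W' * mat_diag n z = W' * mat_diag n z * W * W'"
    by (simp add: W' right_mult_one_mat[of _ n n] mult_carrier_mat[of _ n n])
  have "W' $$ (i, k) = 0" if k: "k < n" for k
  proof -
    have "W' $$ (i, k) * z k = (W' * mat_diag n z) $$ (i, k)"
      using i k by (simp add: mat_diag_mult_right[OF W'(1)])
    also have "\<dots> = (\<Sum>r<n. (W' * mat_diag n z * W) $$ (i, r) * W' $$ (r, k))"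
      using i k by (subst eq, subst mat_mult_entries[OF mult_carrier_mat[OF
            mult_carrier_mat[OF W'(1) mat_diag_dim] W_carrier] W'(1)]) simp
    also have "\<dots> = (\<Sum>r<n. (if i = r then 1 else 0) * (l i * W' $$ (r, k)))"
      using i b by (intro sum.cong) (auto simp: diag_conj)
    also have "\<dots> = l i * W' $$ (i, k)" by (simp only: sum_lessThan_indicator[OF i])
    finally have "W' $$ (i, k) * (z k - l i) = 0" by (simp add: algebra_simps)
    then show ?thesis using zl[OF k i] by simp
  qed
  then have "(W' * W) $$ (i, i) = 0"
    using i by (simp add: mat_mult_entries[OF W'(1) W_carrier])
  then show False using i by (simp add: W'(3))
qed

text \<open>The trace of the reflection in both bases. If all \<open>b i\<close> are 1, this forces
  \<open>n = 2\<close>, and the trace of \<open>diag(z)\<close> in \<open>sum_z\<close> forces the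
  \<open>z i\<close> to have sum 0.\<close>

lemma sum_b: "(\<Sum>i<n. b i) = 2"
proof -
  have "mat_trace (W' * R * W) = mat_trace R"
    by (rule mat_trace_conj[OF W'(2) W_carrier W'(1) R_carrier])
  then have "(\<Sum>i<n. 1 - b i) = (\<Sum>i<n. 1 - 2 * p i)"
    unfolding R_conj by (simp add: mat_trace_def R_def)
  then show ?thesis
    by (simp add: sum_subtractf sum_p flip: sum_distrib_left)
qed

lemma sum_z: "(\<Sum>i<n. z i) = (\<Sum>i<n. l i * (1 - b i))"
proof -
  have "mat_trace (W' * mat_diag n z * W) = mat_trace (mat_diag n z)"
    by (rule mat_trace_conj[OF W'(2) W_carrier W'(1) mat_diag_dim])
  then show ?thesis
    unfolding diag_conj by (simp add: mat_trace_def mat_diag_def)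
qed

text \<open>If the reflection has only zeros on the diagonal in the eigenbasis \<open>W\<close>, then \<open>n = 2\<close> and
  \<open>z\<^sub>0 + z\<^sub>1 = 0\<close>: the group generated by \<open>diag(z)\<close> and the reflection is then dihedral modulo scalars,
  and a further matrix is needed.\<close>

theorem dense_in_matrices:
  assumes S: "S \<subseteq> carrier_mat n n" and SS: "\<And>A B. A \<in> S \<Longrightarrow> B \<in> S \<Longrightarrow> A * B \<in> S"
    and D: "mat_diag n z \<in> S" and r: "R \<in> S"
    and c: "\<And>A. A \<in> S \<Longrightarrow> c \<cdot>\<^sub>m A \<in> S"
    and inj: "inj_on (monomial_value (\<lambda>i. c * l i)) {a. Poly_Mapping.keys a \<subseteq> {..<n}}"
    and extra: "n = 2 \<Longrightarrow> z 0 + z 1 = 0 \<Longrightarrow> \<exists>A\<in>S. \<exists>A'\<in>S. A * A' = 1\<^sub>m n \<and>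
      (\<forall>i<n. \<forall>j<n. (W' * A * W) $$ (i, j) \<noteq> 0 \<and> (W' * A' * W) $$ (i, j) \<noteq> 0)"
  shows "zariski_closure n S = carrier_mat n n"
proof -
  define S' where "S' = (\<lambda>A. W' * A * W) ` S"
  have conj_carrier: "W' * A * W \<in> carrier_mat n n" if "A \<in> carrier_mat n n" for A
    using that by (intro mult_carrier_mat[of _ n n] W' W_carrier)
  have S': "S' \<subseteq> carrier_mat n n"
    using S conj_carrier by (auto simp: S'_def)
  have SS': "A * B \<in> S'" if "A \<in> S'" "B \<in> S'" for A B
    using that conj_mult[OF W'(2) W_carrier W'(1)] SS S unfolding S'_def by (auto simp: subset_iff)
  have conj_one: "W' * 1\<^sub>m n * W = 1\<^sub>m n"
    using W' W_carrier by simp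
  have one: "1\<^sub>m n \<in> S'"
    using SS[OF r r] conj_one by (auto simp: S'_def R_R intro!: image_eqI[of _ _ "1\<^sub>m n"])
  have diag: "mat_diag n (\<lambda>i. c * l i) \<in> S'"
  proof -
    have "W' * (c \<cdot>\<^sub>m (mat_diag n z * R)) * W = c \<cdot>\<^sub>m mat_diag n l"
      unfolding diag_R_conj[symmetric]
      using W' W_carrier R_carrier
      by (simp add: mult_smult_distrib[of _ n n _ n] mult_smult_assoc_mat[of _ n n _ n]
          mult_carrier_mat[of _ n n])
    moreover have "c \<cdot>\<^sub>m mat_diag n l = mat_diag n (\<lambda>i. c * l i)"
      by (auto simp: mat_diag_def intro!: eq_matI)
    ultimately show ?thesis
      unfolding S'_def using c[OF SS[OF D r]] by (intro image_eqI) auto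
  qed
  have "zariski_closure n S' = carrier_mat n n"
  proof (rule zariski_closure_eq_carrier[OF S' SS' inj])
    fix k show "mat_diag n (\<lambda>i. (c * l i) ^ k) \<in> S'"
    proof (induction k)
      case (Suc k)
      from SS'[OF diag Suc.IH] show ?case by simp
    qed (use one in simp)
  next
    fix k assume k: "k < n"
    show "\<exists>A\<in>S'. \<exists>A'\<in>S'. \<exists>l<n. A * A' = 1\<^sub>m n \<and>
        (\<forall>i<n. i \<noteq> k \<longrightarrow> A $$ (i, l) \<noteq> 0) \<and> A' $$ (l, k) \<noteq> 0"
    proof (cases "\<exists>j<n. b j \<noteq> 1")
      case True
      then obtain j where j: "j < n" "b j \<noteq> 1" by blast
      \<comment> \<open>Row \<open>j\<close> and column \<open>j\<close> of this involution have no
        zeros: off the diagonal the entries are \<open>- b i\<close>, on it \<open>1 - b j\<close>.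
        So \<open>?R\<close> serves as both \<open>A\<close> and \<open>A'\<close>, with
        \<open>l = j\<close>.\<close>
      let ?R = "W' * R * W"
      have "?R \<in> S'" using r by (simp add: S'_def)
      moreover have "?R * ?R = 1\<^sub>m n"
        using conj_mult[OF W'(2) W_carrier W'(1) R_carrier R_carrier] by (simp add: R_R conj_one)
      ultimately show ?thesis
        using j k b_nonzero by (intro bexI[of _ ?R] exI[of _ j]) (auto simp: R_conj)
    next
      case False
      then have "of_nat n = (2 :: complex)" using sum_b by simp
      then have n2: "n = 2" by (metis of_nat_eq_iff of_nat_numeral)
      have "(\<Sum>i<n. z i) = 0" unfolding sum_z using False by simp
      then have "z 0 + z 1 = 0" by (simp add: n2 numeral_2_eq_2 lessThan_Suc add.commute)
      from extra[OF n2 this] obtain A A' where A: "A \<in> S" "A' \<in> S" "A * A' = 1\<^sub>m n"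
        and nz: "\<And>i j. i < n \<Longrightarrow> j < n \<Longrightarrow> (W' * A * W) $$ (i, j) \<noteq> 0 \<and> (W' * A' * W) $$ (i, j) \<noteq> 0"
        by blast
      have "(W' * A * W) * (W' * A' * W) = 1\<^sub>m n"
        using A S conj_mult[OF W'(2) W_carrier W'(1), of A A'] conj_one by auto
      then show ?thesis
        using A nz k unfolding S'_def by blast
    qed
  qed
  then show ?thesis
    using zariski_closure_conj[OF W'(2) W_carrier W'(1) S] by (simp add: S'_def)
qed

text \<open>With \<open>z 1 = - z 0\<close> and \<open>l 0 * l 1 = z 0 ^ 2\<close>, the columns of
  \<open>W\<close> are proportional to \<open>(r, 1)\<close> and \<open>(- r, 1)\<close>. A zero
  entry of the conjugate is then a quadratic equation for \<open>r\<close> over \<open>K\<close>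
  whose outer coefficients are, up to sign, the off-diagonal entries of \<open>A\<close>; such an
  equation is excluded by \<open>l0\<close>.\<close>

lemma conj_entries_nonzero_if_two:
  assumes n2: "n = 2" and z: "z 0 + z 1 = 0" and A: "A \<in> carrier_mat 2 2"
    and nz: "A $$ (0, 1) \<noteq> 0 \<or> A $$ (1, 0) \<noteq> 0" and K: "complex_subfield K"
    and AK: "A \<in> mat_space 2 K" and zK: "z 0 \<in> K"
    and l0: "\<And>x y w. x \<in> K \<Longrightarrow> y \<in> K \<Longrightarrow> w \<in> K \<Longrightarrow> x * l 0 ^ 2 + y * l 0 + w = 0 \<Longrightarrow> x = 0 \<and> y = 0 \<and> w = 0"
    and ij: "i < n" "j < n"
  shows "(W' * A * W) $$ (i, j) \<noteq> 0"
proof -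
  interpret complex_subfield K by (rule K)
  define r where "r = (z 0 + l 0) / (z 0 - l 0)"
  have z1: "z 1 = - z 0" using z by (simp add: eq_neg_iff_add_eq_0 add.commute)
  have z0: "z 0 \<noteq> 0" and l00: "l 0 \<noteq> 0" using z_nz[of 0] l_nz[of 0] n2 by auto
  have d: "z 0 - l 0 \<noteq> 0" "z 0 + l 0 \<noteq> 0" "z 0 - l 1 \<noteq> 0" "z 0 + l 1 \<noteq> 0"
    using zl[of 0 0] zl[of 1 0] zl[of 0 1] zl[of 1 1] n2 z1 by (auto simp: add_eq_0_iff)
  have l1: "l 1 = z 0 ^ 2 / l 0"
  proof -
    have "l 0 * l 1 = z 0 ^ 2"
      using prods z1 by (simp add: n2 numeral_2_eq_2 lessThan_Suc mult.commute power2_eq_square)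
    then show ?thesis using l00 by (simp add: field_simps)
  qed
  have d': "- z 0 \<noteq> l 0" "- z 0 \<noteq> l 1"
    using d by (metis add.right_inverse)+
  have W_entry: "W $$ (i, j) = z i / (z i - l j)" if "i < 2" "j < 2" for i j
    using that unfolding n2[symmetric] by (simp add: W_def)
  have W0: "W $$ (0, 0) = r * W $$ (1, 0)" "W $$ (1, 0) \<noteq> 0"
    using d d' z0 by (simp_all add: W_entry z1 r_def divide_simps del: One_nat_def) (auto simp: algebra_simps)
  have W1: "W $$ (0, 1) = - r * W $$ (1, 1)" "W $$ (1, 1) \<noteq> 0"
  proof -
    have "z 0 - l 1 = - z 0 * (z 0 - l 0) / l 0" "- z 0 - l 1 = - z 0 * (z 0 + l 0) / l 0"
      using l00 by (simp_all add: l1 field_simps power2_eq_square del: One_nat_def)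
    then have "W $$ (0, 1) = - l 0 / (z 0 - l 0)" "W $$ (1, 1) = l 0 / (z 0 + l 0)"
      using d z0 l00 by (simp_all add: W_entry z1 del: One_nat_def)
    then show "W $$ (0, 1) = - r * W $$ (1, 1)" "W $$ (1, 1) \<noteq> 0"
      using d l00 by (simp_all add: r_def)
  qed
  \<comment> \<open>\<open>r\<close> is a fractional linear expression in \<open>l 0\<close> over
    \<open>K\<close>, so multiplying by \<open>(z 0 - l 0) ^ 2\<close> gives a quadratic relation
    for \<open>l 0\<close>.\<close>
  have r: "x = 0 \<and> w = 0" if K: "x \<in> K" "y \<in> K" "w \<in> K" and eq: "x * r ^ 2 + y * r + w = 0" for x y w
  proof -
    have rq: "r * (z 0 - l 0) = z 0 + l 0" using d(1) by (simp add: r_def)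
    have "(x * r ^ 2 + y * r + w) * (z 0 - l 0) ^ 2 =
        x * (r * (z 0 - l 0)) ^ 2 + y * (r * (z 0 - l 0)) * (z 0 - l 0) + w * (z 0 - l 0) ^ 2"
      by (simp add: algebra_simps power2_eq_square)
    then have "(x - y + w) * l 0 ^ 2 + (2 * z 0 * (x - w)) * l 0 + z 0 ^ 2 * (x + y + w) =
        (x * r ^ 2 + y * r + w) * (z 0 - l 0) ^ 2"
      unfolding rq by (simp add: algebra_simps power2_eq_square)
    then have "x - y + w = 0 \<and> 2 * z 0 * (x - w) = 0 \<and> z 0 ^ 2 * (x + y + w) = 0"
      unfolding eq using K zK by (intro l0 closed) auto
    then show ?thesis using z0 by (auto simp: algebra_simps)
  qed
  have AK': "A $$ (i, j) \<in> K" if "i < 2" "j < 2" for i j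
    using AK that by (auto simp: mat_space_def)
  define N where "N = W' * A * W"
  have N: "N \<in> carrier_mat 2 2"
    using A W' W_carrier n2 by (auto simp: N_def intro!: mult_carrier_mat)
  have AW: "A * W \<in> carrier_mat n n" using A W_carrier n2 by auto
  have "W * N = W * (W' * (A * W))"
    unfolding N_def using A W'(1) W_carrier by (simp add: n2 assoc_mult_mat[of _ 2 2 _ 2 _ 2])
  also have "\<dots> = W * W' * (A * W)"
    by (rule assoc_mult_mat[symmetric, OF W_carrier W'(1) AW])
  finally have WN: "W * N = A * W" by (simp add: W' left_mult_one_mat[OF AW])
  have rows: "W $$ (i, 0) * N $$ (0, j) + W $$ (i, 1) * N $$ (1, j) =
      A $$ (i, 0) * W $$ (0, j) + A $$ (i, 1) * W $$ (1, j)" if "i < 2" "j < 2" for i j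
  proof -
    have "(W * N) $$ (i, j) = (A * W) $$ (i, j)" by (simp add: WN)
    then show ?thesis
      using that W_carrier N A unfolding n2
      by (simp add: mat_mult_entries[of _ 2 2 _ 2] numeral_2_eq_2 lessThan_Suc add.commute)
  qed
  have "N $$ (i, j) \<noteq> 0" if "i < 2" "j < 2" for i j
  proof
    assume N0: "N $$ (i, j) = 0"
    define w where "w = W $$ (1, j)"
    define e where "e = (if j = 0 then r else - r)"
    have w: "w \<noteq> 0" "W $$ (0, j) = e * w"
      using W0 W1 that by (auto simp: w_def e_def less_2_cases_iff)
    define a0 a1 where "a0 = A $$ (0, 0) * e + A $$ (0, 1)" and "a1 = A $$ (1, 0) * e + A $$ (1, 1)"
    have 1: "r * (W $$ (1, 0) * N $$ (0, j)) - r * (W $$ (1, 1) * N $$ (1, j)) = a0 * w"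
      using rows[of 0 j] that W0 W1 w by (simp add: a0_def w_def[symmetric, simplified] algebra_simps)
    have 2: "W $$ (1, 0) * N $$ (0, j) + W $$ (1, 1) * N $$ (1, j) = a1 * w"
      using rows[of 1 j] that w by (simp add: a1_def w_def[symmetric, simplified] algebra_simps)
    have "a0 + r * a1 = 0 \<or> a0 - r * a1 = 0"
    proof (cases "i = 0")
      case True
      then have "(a0 + r * a1) * w = 0" using 1 2 N0 by (simp add: algebra_simps)
      then show ?thesis using w by simp
    next
      case False
      then have "i = 1" using that by simp
      then have "(a0 - r * a1) * w = 0" using 1 2 N0 by (auto simp: algebra_simps)
      then show ?thesis using w by simp
    qed
    \<comment> \<open>The signs \<epsilon> and \<delta> stand for the row and the column of the
      vanishing entry, so that all four cases give one quadratic equation.\<close>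
    then have "a0 + 1 * r * a1 = 0 \<or> a0 + (- 1) * r * a1 = 0" by simp
    then obtain \<epsilon> :: complex where eps: "\<epsilon> = 1 \<or> \<epsilon> = - 1" "a0 + \<epsilon> * r * a1 = 0" by blast
    have "e = 1 * r \<or> e = (- 1) * r" by (simp add: e_def)
    then obtain \<delta> :: complex where del: "\<delta> = 1 \<or> \<delta> = - 1" "e = \<delta> * r" by blast
    have "(\<epsilon> * \<delta> * A $$ (1, 0)) * r ^ 2 + (\<delta> * A $$ (0, 0) + \<epsilon> * A $$ (1, 1)) * r + A $$ (0, 1) = 0"
      using eps(2) unfolding a0_def a1_def del(2) by (simp add: algebra_simps power2_eq_square)
    then have "\<epsilon> * \<delta> * A $$ (1, 0) = 0 \<and> A $$ (0, 1) = 0"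
      by (rule r[rotated -1]) (use eps(1) del(1) AK' in \<open>auto intro!: closed\<close>)
    then show False using nz eps(1) del(1) by auto
  qed
  then show ?thesis using ij by (simp add: N_def n2)
qed

text \<open>A basis in which the reflection interchanges the first two vectors and fixes the others:
  half the sum and half the difference of the first two vectors are \<open>e\<^sub>1 - p\<^sub>1 (1,\<dots>,1)\<close>, fixed by the
  reflection, and \<open>(1,\<dots>,1)\<close>, which it negates.\<close>

definition P :: "complex mat" where
  "P = mat n n (\<lambda>(i, j). (if i = max 1 j then 1 else 0) - p (max 1 j) +
     (if j = 0 then 1 else if j = 1 then - 1 else 0))"

text \<open>Reads off coordinates: in \<open>v = sum a_j (e_j - p_j (1,...,1)) + c (1,...,1)\<close>
  with \<open>j\<close> from 1, applying \<open>p\<close> gives \<open>c\<close>, and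
  \<open>a_j\<close> is \<open>v_j - v_0\<close>. The first two rows are half the sum and half the
  difference of \<open>a_1\<close> and \<open>c\<close>.\<close>

definition P' :: "complex mat" where
  "P' = mat n n (\<lambda>(i, j). if i = 0 then ((if j = 1 then 1 else 0) - (if j = 0 then 1 else 0) + p j) / 2
     else if i = 1 then ((if j = 1 then 1 else 0) - (if j = 0 then 1 else 0) - p j) / 2
     else (if j = i then 1 else 0) - (if j = 0 then 1 else 0))"

lemma P_carrier: "P \<in> carrier_mat n n" "P' \<in> carrier_mat n n"
  by (simp_all add: P_def P'_def)

lemma sum_p_P:
  assumes "j < n"
  shows "(\<Sum>k<n. p k * P $$ (k, j)) = (if j = 0 then 1 else if j = 1 then - 1 else 0)" (is "_ = ?e")
proof -
  let ?m = "max 1 j"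
  have m: "?m < n" using assms n by auto
  have "(\<Sum>k<n. p k * P $$ (k, j)) = (\<Sum>k<n. p k * (if k = ?m then 1 else 0)) + (?e - p ?m) * (\<Sum>k<n. p k)"
    unfolding sum_distrib_left sum.distrib[symmetric]
    using assms by (intro sum.cong) (auto simp: P_def algebra_simps)
  then show ?thesis by (simp only: sum_lessThan_indicator[OF m] sum_p) simp
qed

lemma P'_P: "P' * P = 1\<^sub>m n"
proof (rule eq_matI)
  fix i j assume "i < dim_row (1\<^sub>m n :: complex mat)" "j < dim_col (1\<^sub>m n :: complex mat)"
  then have ij: "i < n" "j < n" by auto
  have d: "0 < n" "1 < n" using n by auto
  let ?e = "if j = 0 then 1 else if j = 1 then - 1 else 0 :: complex"
  have *: "(\<Sum>k<n. ((if k = a then 1 else 0) - (if k = 0 then 1 else 0) + c * p k) * P $$ (k, j)) =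
      P $$ (a, j) - P $$ (0, j) + c * ?e" if "a < n" for a c
    unfolding distrib_right left_diff_distrib sum.distrib sum_subtractf
    by (simp add: sum_lessThan_indicator that d mult.assoc sum_p_P[OF ij(2)] flip: sum_distrib_left)
  have "(P' * P) $$ (i, j) = (\<Sum>k<n. P' $$ (i, k) * P $$ (k, j))"
    using ij by (simp add: mat_mult_entries[OF P_carrier(2,1)])
  also have "\<dots> = (if i = 0 then (P $$ (1, j) - P $$ (0, j) + 1 * ?e) / 2
      else if i = 1 then (P $$ (1, j) - P $$ (0, j) + (- 1) * ?e) / 2
      else P $$ (i, j) - P $$ (0, j) + 0 * ?e)"
    unfolding *[OF d(2), symmetric] *[OF ij(1), symmetric] sum_divide_distrib
    using ij by (auto simp: P'_def intro!: sum.cong)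
  also have "\<dots> = 1\<^sub>m n $$ (i, j)"
    using ij d by (auto simp: P_def max_def)
  finally show "(P' * P) $$ (i, j) = 1\<^sub>m n $$ (i, j)" .
qed (auto simp: P_def P'_def)

lemma P_P': "P * P' = 1\<^sub>m n"
  by (rule mat_mult_left_right_inverse[OF P_carrier(2,1) P'_P])

lemma R_conj_P:
  "P' * R * P = mat n n (\<lambda>(i, j). if i = Transposition.transpose 0 1 j then 1 else 0)" (is "_ = ?T")
proof -
  have T: "?T \<in> carrier_mat n n" by simp
  have d: "0 < n" "1 < n" using n by auto
  have tr: "Transposition.transpose 0 1 j < n" if "j < n" for j
    using that d by (auto simp: Transposition.transpose_def)
  have "R * P = P * ?T"
  proof (rule eq_matI)
    fix i j assume "i < dim_row (P * ?T)" "j < dim_col (P * ?T)"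
    then have ij: "i < n" "j < n" using P_carrier by auto
    have "(P * ?T) $$ (i, j) = (\<Sum>k<n. P $$ (i, k) * (if k = Transposition.transpose 0 1 j then 1 else 0))"
      unfolding mat_mult_entries[OF P_carrier(1) T] using ij by simp
    also have "\<dots> = P $$ (i, Transposition.transpose 0 1 j)"
      by (rule sum_lessThan_indicator) (rule tr[OF ij(2)])
    also have "\<dots> = P $$ (i, j) - 2 * (if j = 0 then 1 else if j = 1 then - 1 else 0)"
      using ij d by (auto simp: P_def Transposition.transpose_def max_def)
    also have "\<dots> = (R * P) $$ (i, j)"
      unfolding R_mult[OF P_carrier(1)] using ij by (simp add: sum_p_P)
    finally show "(R * P) $$ (i, j) = (P * ?T) $$ (i, j)" ..
  qed (use P_carrier R_carrier in auto)
  then have "P' * R * P = P' * P * ?T"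
    using P_carrier R_carrier T by (simp add: assoc_mult_mat[of _ n n _ n _ n])
  then show ?thesis by (simp add: P'_P)
qed

lemma P_mat_space:
  assumes "complex_subfield K" "\<And>i. i < n \<Longrightarrow> z i \<in> K" "\<And>i. i < n \<Longrightarrow> l i \<in> K"
  shows "P \<in> mat_space n K" "P' \<in> mat_space n K"
proof -
  interpret complex_subfield K by fact
  have "p i \<in> K" if "i < n" for i
    unfolding p_def using that assms(2,3) by (intro closed) auto
  moreover have "max 1 j < n" if "j < n" for j using that n by auto
  ultimately show "P \<in> mat_space n K" "P' \<in> mat_space n K"
    by (auto simp: mat_space_def P_def P'_def intro!: closed)
qed

end

section \<open>Generic eigenvalues\<close>

text \<open>The eigenvalues are \<open>t\<^sub>1, \<dots>, t\<^sub>n\<^sub>-\<^sub>1\<close> and the last one is forced by the determinant; multiplied by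
  the scalar \<open>t\<^sub>n\<close> they become multiplicatively independent.\<close>

locale generic_data = complex_subfield K for K :: "complex set" +
  fixes n :: nat and z t :: "nat \<Rightarrow> complex"
  assumes n: "2 \<le> n" and inj_z: "inj_on z {..<n}"
    and z_nz: "\<And>i. i < n \<Longrightarrow> z i \<noteq> 0" and zK: "\<And>i. i < n \<Longrightarrow> z i \<in> K"
    and indep: "algebraically_independent K {1..n} t"
begin

definition l :: "nat \<Rightarrow> complex" where
  "l j = (if j < n - 1 then t (Suc j) else - (\<Prod>i<n. z i) / (\<Prod>i<n - 1. t (Suc i)))"

lemma monomials_eq:
  assumes "c \<in> K" "c' \<in> K" "c \<noteq> 0"
    and "c * (\<Prod>i<n. t (Suc i) ^ e i) = c' * (\<Prod>i<n. t (Suc i) ^ e' i)" and "i < n"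
  shows "e i = e' i"
proof -
  have "c * (\<Prod>i\<in>{1..n}. t i ^ e (i - 1)) = c' * (\<Prod>i\<in>{1..n}. t i ^ e' (i - 1))"
    using assms(4) by (simp add: prod.atLeast1_atMost_eq)
  from algebraically_independent_monomials[OF indep _ assms(1-3) this, of "Suc i"] show ?thesis
    using \<open>i < n\<close> by simp
qed

lemma single_exponent: "i < n \<Longrightarrow> (\<Prod>k<n. t (Suc k) ^ (if k = i then 1 else 0)) = t (Suc i)"
  by (simp add: if_distrib[where f = "\<lambda>e. _ ^ e"] cong: if_cong)

lemma t_neq: assumes "i < n" "c \<in> K" shows "t (Suc i) \<noteq> c"
proof
  assume "t (Suc i) = c"
  then have "1 * (\<Prod>k<n. t (Suc k) ^ (if k = i then 1 else 0)) = c * (\<Prod>k<n. t (Suc k) ^ 0)"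
    using assms single_exponent by simp
  from monomials_eq[OF _ _ _ this assms(1)] show False
    using assms(2) one_closed by simp
qed

lemma t_nonzero: "i < n \<Longrightarrow> t (Suc i) \<noteq> 0"
  using t_neq zero_closed by blast

lemma prod_z_nonzero: "(\<Prod>i<n. z i) \<noteq> 0" and prod_z_closed: "(\<Prod>i<n. z i) \<in> K"
  using z_nz zK by (auto intro: prod_closed)

lemma prod_t_nonzero: "(\<Prod>i<n - 1. t (Suc i)) \<noteq> 0"
  using t_nonzero by auto

text \<open>The product of all \<open>l i\<close> lies in \<open>K\<close>, so the
  \<open>l i\<close> need not be independent by themselves. The factor \<open>t n\<close> adds the
  total degree as its exponent, and this settles the matter.\<close>

lemma multiplicatively_independent:
  "inj_on (monomial_value (\<lambda>i. t n * l i)) {a. Poly_Mapping.keys a \<subseteq> {..<n}}"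
proof (rule inj_onI, unfold mem_Collect_eq)
  fix a b :: "nat \<Rightarrow>\<^sub>0 nat"
  assume keys: "Poly_Mapping.keys a \<subseteq> {..<n}" "Poly_Mapping.keys b \<subseteq> {..<n}"
    and eq: "monomial_value (\<lambda>i. t n * l i) a = monomial_value (\<lambda>i. t n * l i) b"
  define N where "N = n - 1"
  have nN: "n = Suc N" using n by (simp add: N_def)
  define \<delta> where "\<delta> = - (\<Prod>i<n. z i)"
  define \<tau> where "\<tau> = (\<Prod>i<N. t (Suc i))"
  let ?A = "Poly_Mapping.lookup a" and ?B = "Poly_Mapping.lookup b"
  have \<tau>: "\<tau> \<noteq> 0" using prod_t_nonzero by (simp add: \<tau>_def N_def)
  have \<delta>: "\<delta> \<noteq> 0" "\<delta> \<in> K"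
    using prod_z_nonzero prod_z_closed by (simp_all add: \<delta>_def uminus_closed)
  \<comment> \<open>Here \<open>m\<close> will be the last exponent of the other monomial: both
    sides are then multiplied by the same power of \<tau>, large enough to clear the denominator of
    \<open>l N\<close>.\<close>
  have val: "monomial_value (\<lambda>i. t n * l i) c * \<tau> ^ Poly_Mapping.lookup c N * \<tau> ^ m =
      \<delta> ^ Poly_Mapping.lookup c N * (\<Prod>i<n. t (Suc i) ^
        (if i < N then Poly_Mapping.lookup c i + m else (\<Sum>i<n. Poly_Mapping.lookup c i)))"
    if "Poly_Mapping.keys c \<subseteq> {..<n}" for c m
  proof -
    let ?C = "Poly_Mapping.lookup c"
    have "monomial_value (\<lambda>i. t n * l i) c = (\<Prod>i<n. (t n * l i) ^ ?C i)"
      unfolding monomial_value_def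
      by (rule prod.mono_neutral_left) (use that in \<open>auto simp: in_keys_iff\<close>)
    also have "\<dots> = t n ^ (\<Sum>i<n. ?C i) * (\<Prod>i<n. l i ^ ?C i)"
      by (simp add: power_mult_distrib prod.distrib power_sum)
    also have "(\<Prod>i<n. l i ^ ?C i) = (\<Prod>i<N. t (Suc i) ^ ?C i) * (\<delta> / \<tau>) ^ ?C N"
    proof -
      have "l i = t (Suc i)" if "i < N" for i using that by (simp add: l_def N_def)
      moreover have "l N = \<delta> / \<tau>" by (simp add: l_def N_def \<delta>_def \<tau>_def)
      moreover have "(\<Prod>i<n. l i ^ ?C i) = (\<Prod>i<N. l i ^ ?C i) * l N ^ ?C N"
        using prod.lessThan_Suc[of "\<lambda>i. l i ^ ?C i" N] by (simp add: nN[symmetric])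
      ultimately show ?thesis by simp
    qed
    finally have "monomial_value (\<lambda>i. t n * l i) c * \<tau> ^ ?C N * \<tau> ^ m =
        \<delta> ^ ?C N * (t n ^ (\<Sum>i<n. ?C i) * ((\<Prod>i<N. t (Suc i) ^ ?C i) * \<tau> ^ m))"
      using \<tau> by (simp add: power_divide)
    also have "(\<Prod>i<N. t (Suc i) ^ ?C i) * \<tau> ^ m = (\<Prod>i<N. t (Suc i) ^ (?C i + m))"
      by (simp add: \<tau>_def power_add prod.distrib prod_power_distrib)
    also have "t n ^ (\<Sum>i<n. ?C i) * (\<Prod>i<N. t (Suc i) ^ (?C i + m)) =
        (\<Prod>i<n. t (Suc i) ^ (if i < N then ?C i + m else (\<Sum>i<n. ?C i)))"
      by (simp add: nN mult.commute)
    finally show ?thesis .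
  qed
  have "\<delta> ^ ?A N * (\<Prod>i<n. t (Suc i) ^ (if i < N then ?A i + ?B N else (\<Sum>i<n. ?A i))) =
      \<delta> ^ ?B N * (\<Prod>i<n. t (Suc i) ^ (if i < N then ?B i + ?A N else (\<Sum>i<n. ?B i)))"
    unfolding val[OF keys(1), symmetric] val[OF keys(2), symmetric] eq by simp
  note exps = monomials_eq[OF power_closed[OF \<delta>(2)] power_closed[OF \<delta>(2)] _ this]
  have i: "?A i + ?B N = ?B i + ?A N" if "i < N" for i
    using exps[of i] that \<delta> nN by simp
  have "(\<Sum>i<n. ?A i) = (\<Sum>i<n. ?B i)"
    using exps[of N] \<delta> nN by simp
  then have s1: "(\<Sum>i<N. ?A i) + ?A N = (\<Sum>i<N. ?B i) + ?B N" by (simp add: nN)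
  have "(\<Sum>i<N. ?A i + ?B N) = (\<Sum>i<N. ?B i + ?A N)" using i by simp
  then have s2: "(\<Sum>i<N. ?A i) + N * ?B N = (\<Sum>i<N. ?B i) + N * ?A N" by (simp add: sum.distrib)
  \<comment> \<open>The differences of the first \<open>N\<close> exponents all equal the difference
    of the last ones, and the total degrees agree, so \<open>n\<close> times this difference is
    0.\<close>
  have "(int N + 1) * (int (?A N) - int (?B N)) = 0"
    using arg_cong[OF s1, of int] arg_cong[OF s2, of int] by (simp add: algebra_simps)
  then have "?A N = ?B N" by auto
  then have "?A i = ?B i" if "i < n" for i
    using i[of i] that nN by (cases "i = N") auto
  then show "a = b"
    using keys by (intro poly_mapping_eqI) (metis in_keys_iff lessThan_iff subsetD)
qed

lemma l_neq_z: assumes "i < n" "j < n" shows "z i \<noteq> l j"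
proof (cases "j < n - 1")
  case True
  then show ?thesis using t_neq[of j "z i"] assms zK by (auto simp: l_def)
next
  case False
  show ?thesis
  proof
    assume "z i = l j"
    then have "- (\<Prod>i<n. z i) = z i * (\<Prod>i<n - 1. t (Suc i))"
      using False prod_t_nonzero by (simp add: l_def field_simps)
    also have "(\<Prod>i<n - 1. t (Suc i)) = (\<Prod>k<n. t (Suc k) ^ (if k < n - 1 then 1 else 0))"
      by (rule prod.mono_neutral_cong_left) auto
    finally have "z i * (\<Prod>k<n. t (Suc k) ^ (if k < n - 1 then 1 else 0)) =
        - (\<Prod>i<n. z i) * (\<Prod>k<n. t (Suc k) ^ 0)" by simp
    \<comment> \<open>\<open>t 1\<close> has exponent 1 on the left, because
      \<open>2 \<le> n\<close>, and exponent 0 on the right.\<close>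
    from monomials_eq[OF _ _ _ this, of 0] show False
      using n zK z_nz assms prod_z_closed by (auto intro: uminus_closed)
  qed
qed

sublocale cauchy_data n z l
proof
  show "2 \<le> n" "inj_on z {..<n}" by (rule n, rule inj_z)
  show "z i \<noteq> 0" if "i < n" for i using z_nz that .
  show l_nz: "l i \<noteq> 0" if "i < n" for i
    using that t_nonzero[of i] prod_z_nonzero prod_t_nonzero by (auto simp: l_def)
  show "z i \<noteq> l j" if "i < n" "j < n" for i j using l_neq_z that .
  have "(\<Prod>j<n. l j) = (\<Prod>j<n - 1. l j) * l (n - 1)"
    using n prod.lessThan_Suc[of l "n - 1"] by simp
  also have "(\<Prod>j<n - 1. l j) = (\<Prod>j<n - 1. t (Suc j))" by (simp add: l_def)
  finally show "(\<Prod>j<n. l j) = - (\<Prod>j<n. z j)"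
    using prod_t_nonzero by (simp add: l_def)
  \<comment> \<open>Distinctness is multiplicative independence for the exponent vectors of single
    variables.\<close>
  show "inj_on l {..<n}"
  proof (rule inj_onI)
    fix i j assume ij: "i \<in> {..<n}" "j \<in> {..<n}" and "l i = l j"
    then have "monomial_value (\<lambda>i. t n * l i) (Poly_Mapping.single i 1) =
        monomial_value (\<lambda>i. t n * l i) (Poly_Mapping.single j 1)"
      by (simp add: monomial_value_def)
    from inj_onD[OF multiplicatively_independent this] ij
    have "Poly_Mapping.single i (1 :: nat) = Poly_Mapping.single j 1" by simp
    then have "Poly_Mapping.lookup (Poly_Mapping.single i (1 :: nat)) i =
        Poly_Mapping.lookup (Poly_Mapping.single j 1) i" by simp
    then show "i = j" by (simp add: lookup_single when_def split: if_splits)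
  qed
qed

lemma quadratic_relation:
  assumes "x \<in> K" "y \<in> K" "w \<in> K" and eq: "x * l 0 ^ 2 + y * l 0 + w = 0"
  shows "x = 0 \<and> y = 0 \<and> w = 0"
proof -
  define c where "c k = (if k = 0 then w else if k = 1 then y else x)" for k :: nat
  let ?a = "\<lambda>k. Poly_Mapping.single (1 :: nat) (k :: nat)"
  have inj: "inj_on ?a {..<3}"
    by (rule inj_onI) (metis lookup_single_eq)
  have lk: "Poly_Mapping.lookup (?a k) 1 = k" for k by simp
  have l0: "l 0 = t 1" using n by (simp add: l_def)
  have "(\<Sum>b\<in>?a ` {..<3}. c (Poly_Mapping.lookup b 1) *
      (\<Prod>i\<in>Poly_Mapping.keys b. t i ^ Poly_Mapping.lookup b i)) = (\<Sum>k<3. c k * t 1 ^ k)"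
    by (subst sum.reindex[OF inj]) (auto intro!: sum.cong)
  also have "\<dots> = 0"
    using eq l0 by (simp add: c_def eval_nat_numeral lessThan_Suc algebra_simps)
  finally have rel: "(\<Sum>b\<in>?a ` {..<3}. c (Poly_Mapping.lookup b 1) *
      (\<Prod>i\<in>Poly_Mapping.keys b. t i ^ Poly_Mapping.lookup b i)) = 0" .
  have "c (Poly_Mapping.lookup (?a k) 1) = 0" if "k < 3" for k
    by (rule algebraically_independent_sum[OF indep _ _ _ rel])
      (use assms that n in \<open>auto simp: c_def split: if_splits\<close>)
  then have "c k = 0" if "k < 3" for k using that by simp
  from this[of 0] this[of 1] this[of 2] show ?thesis by (simp add: c_def)
qed

end

section \<open>Matrices in bases\<close>

text \<open>Keeps the index set in the form \<open>{1..n}\<close> of the definitions under simplification.\<close>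

declare One_nat_def [simp del]

lemma sum_from_one: "(\<Sum>i\<in>{1..n}. f i) = (\<Sum>i<n. f (Suc i))"
  by (simp add: One_nat_def sum.atLeast1_atMost_eq)

text \<open>A dual family of functionals gives independence, spanning and the coordinates at once,
  without an argument on dimensions.\<close>

lemma (in vector_space) is_basis_if_dual_family:
  fixes n :: nat and x :: "nat \<Rightarrow> 'b" and \<phi> :: "nat \<Rightarrow> 'b \<Rightarrow> 'a"
  assumes dual: "\<And>i j. i \<in> {1..n} \<Longrightarrow> j \<in> {1..n} \<Longrightarrow> \<phi> i (x j) = (if i = j then 1 else 0)"
    and add: "\<And>i u v. \<phi> i (u + v) = \<phi> i u + \<phi> i v"
    and scale: "\<And>i c v. \<phi> i (scale c v) = c * \<phi> i v"
    and expand: "\<And>v. (\<Sum>i\<in>{1..n}. scale (\<phi> i v) (x i)) = v"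
  shows "inj_on x {1..n} \<and> independent (x ` {1..n}) \<and> span (x ` {1..n}) = UNIV"
    and "i \<in> {1..n} \<Longrightarrow> representation (x ` {1..n}) v (x i) = \<phi> i v"
proof -
  have zero: "\<phi> i 0 = 0" for i using scale[of i 0 0] by simp
  have sum: "\<phi> i (\<Sum>s\<in>S. f s) = (\<Sum>s\<in>S. \<phi> i (f s))" for i and S :: "'c set" and f
    by (induction S rule: infinite_finite_induct) (auto simp: add zero)
  have inj: "inj_on x {1..n}"
  proof (rule inj_onI)
    fix i j assume "i \<in> {1..n}" "j \<in> {1..n}" "x i = x j"
    then show "i = j" using dual[of i j] dual[of i i] by (auto split: if_splits)
  qed
  have indep: "independent (x ` {1..n})"
    unfolding dependent_finite[OF finite_imageI[OF finite_atLeastAtMost]]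
  proof
    assume "\<exists>u. (\<exists>v\<in>x ` {1..n}. u v \<noteq> 0) \<and> (\<Sum>v\<in>x ` {1..n}. scale (u v) v) = 0"
    then obtain u i where i: "i \<in> {1..n}" "u (x i) \<noteq> 0"
      and 0: "(\<Sum>v\<in>x ` {1..n}. scale (u v) v) = 0" by auto
    have "\<phi> i (\<Sum>v\<in>x ` {1..n}. scale (u v) v) = (\<Sum>j\<in>{1..n}. u (x j) * (if i = j then 1 else 0))"
      unfolding sum.reindex[OF inj] sum using i(1) by (intro sum.cong) (auto simp: scale dual)
    also have "\<dots> = u (x i)"
      using i(1) by (simp add: if_distrib[where f = "\<lambda>c. _ * c"] cong: if_cong)
    finally show False using 0 i(2) zero by simp
  qed
  have span: "span (x ` {1..n}) = UNIV"
  proof -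
    have "v \<in> span (x ` {1..n})" for v
    proof -
      have "(\<Sum>i\<in>{1..n}. scale (\<phi> i v) (x i)) \<in> span (x ` {1..n})"
        by (intro span_sum span_scale span_base) auto
      then show ?thesis by (simp add: expand)
    qed
    then show ?thesis by blast
  qed
  show "inj_on x {1..n} \<and> independent (x ` {1..n}) \<and> span (x ` {1..n}) = UNIV"
    using inj indep span by blast
  show "representation (x ` {1..n}) v (x i) = \<phi> i v" if i: "i \<in> {1..n}"
  proof -
    have "representation (x ` {1..n}) v (x i) =
        (\<Sum>j\<in>{1..n}. representation (x ` {1..n}) (scale (\<phi> j v) (x j)) (x i))"
    proof -
      have "representation (x ` {1..n}) (\<Sum>j\<in>{1..n}. scale (\<phi> j v) (x j)) =
          (\<lambda>b. \<Sum>j\<in>{1..n}. representation (x ` {1..n}) (scale (\<phi> j v) (x j)) b)"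
        by (rule representation_sum[OF indep]) (simp add: span)
      then show ?thesis by (simp add: expand)
    qed
    also have "\<dots> = (\<Sum>j\<in>{1..n}. \<phi> j v * (if i = j then 1 else 0))"
    proof (rule sum.cong)
      fix j assume j: "j \<in> {1..n}"
      have "x j \<in> span (x ` {1..n})" "x j \<in> x ` {1..n}" using j by (auto simp: span)
      then show "representation (x ` {1..n}) (scale (\<phi> j v) (x j)) (x i) =
          \<phi> j v * (if i = j then 1 else 0)"
        using inj_on_eq_iff[OF inj i j]
        by (simp add: representation_scale[OF indep] representation_basis[OF indep])
    qed simp
    also have "\<dots> = \<phi> i v"
      using i by (simp add: if_distrib[where f = "\<lambda>c. _ * c"] cong: if_cong)
    finally show ?thesis .
  qed
qed

locale based_space = vector_space scale
  for scale :: "complex \<Rightarrow> 'v :: ab_group_add \<Rightarrow> 'v" +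
  fixes n :: nat and x :: "nat \<Rightarrow> 'v"
  assumes basis: "is_basis scale n x"
begin

abbreviation crd :: "'v \<Rightarrow> nat \<Rightarrow> complex" where
  "crd v i \<equiv> coord scale n x v (Suc i)"

abbreviation M :: "('v \<Rightarrow> 'v) \<Rightarrow> complex mat" where
  "M \<equiv> matrix_in_basis scale n x"

lemma inj: "inj_on x {1..n}" and independent: "independent (x ` {1..n})"
  and span: "span (x ` {1..n}) = UNIV"
  using basis by (auto simp: is_basis_def)

lemma crd_basis: "i < n \<Longrightarrow> j < n \<Longrightarrow> crd (x (Suc j)) i = (if i = j then 1 else 0)"
proof -
  assume "i < n" "j < n"
  then have "x (Suc j) \<in> x ` {1..n}" "x (Suc i) = x (Suc j) \<longleftrightarrow> i = j"
    using inj_on_eq_iff[OF inj, of "Suc i" "Suc j"] by auto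
  then show ?thesis by (simp add: representation_basis[OF independent])
qed

lemma crd_sum_scale: "crd (\<Sum>s\<in>S. scale (c s) (f s)) i = (\<Sum>s\<in>S. c s * crd (f s) i)"
  by (subst representation_sum[OF independent]) (auto simp: span representation_scale[OF independent])

lemma crd_add: "crd (u + v) i = crd u i + crd v i"
  by (subst representation_add[OF independent]) (auto simp: span)

lemma crd_scale: "crd (scale c v) i = c * crd v i"
  by (subst representation_scale[OF independent]) (auto simp: span)

lemma expansion: "(\<Sum>i<n. scale (crd v i) (x (Suc i))) = v"
proof -
  have "(\<Sum>b\<in>x ` {1..n}. scale (representation (x ` {1..n}) v b) b) = v"
    by (rule sum_representation_eq[OF independent]) (auto simp: span)
  then show ?thesis
    unfolding sum.reindex[OF inj] by (simp add: sum_from_one)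
qed

lemma M_carrier: "M T \<in> carrier_mat n n"
  by (simp add: matrix_in_basis_def)

lemma M_entry: "i < n \<Longrightarrow> j < n \<Longrightarrow> M T $$ (i, j) = crd (T (x (Suc j))) i"
  by (simp add: matrix_in_basis_def)

lemma linear_sum_scale:
  assumes "Vector_Spaces.linear scale scale T"
  shows "T (\<Sum>s\<in>S. scale (c s) (f s)) = (\<Sum>s\<in>S. scale (c s) (T (f s)))"
proof -
  interpret T: Vector_Spaces.linear scale scale T by fact
  show ?thesis by (simp add: T.sum T.scale)
qed

lemma crd_linear:
  assumes "Vector_Spaces.linear scale scale T" "i < n"
  shows "crd (T v) i = (\<Sum>j<n. M T $$ (i, j) * crd v j)"
proof -
  have "crd (T v) i = crd (T (\<Sum>j<n. scale (crd v j) (x (Suc j)))) i" by (simp add: expansion)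
  also have "\<dots> = (\<Sum>j<n. crd v j * crd (T (x (Suc j))) i)"
    unfolding linear_sum_scale[OF assms(1)] by (rule crd_sum_scale)
  also have "\<dots> = (\<Sum>j<n. M T $$ (i, j) * crd v j)"
    using assms(2) by (intro sum.cong) (auto simp: M_entry mult.commute)
  finally show ?thesis .
qed

lemma M_comp:
  assumes "Vector_Spaces.linear scale scale T"
  shows "M (T \<circ> U) = M T * M U"
  unfolding mat_mult_entries[OF M_carrier M_carrier]
proof (rule eq_matI)
  fix i j
  assume "i < dim_row (mat n n (\<lambda>(i, j). \<Sum>r<n. M T $$ (i, r) * M U $$ (r, j)))"
    "j < dim_col (mat n n (\<lambda>(i, j). \<Sum>r<n. M T $$ (i, r) * M U $$ (r, j)))"
  then have ij: "i < n" "j < n" by auto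
  then have "M (T \<circ> U) $$ (i, j) = (\<Sum>r<n. M T $$ (i, r) * crd (U (x (Suc j))) r)"
    unfolding crd_linear[OF assms ij(1), symmetric] by (simp add: M_entry)
  also have "\<dots> = (\<Sum>r<n. M T $$ (i, r) * M U $$ (r, j))"
    using ij by (intro sum.cong) (simp_all add: M_entry)
  finally show "M (T \<circ> U) $$ (i, j) =
      mat n n (\<lambda>(i, j). \<Sum>r<n. M T $$ (i, r) * M U $$ (r, j)) $$ (i, j)" using ij by simp
qed (use M_carrier in auto)

lemma M_id: "M id = 1\<^sub>m n"
  using crd_basis by (auto simp: matrix_in_basis_def intro!: eq_matI)

context
  fixes Q Q' :: "complex mat"
  assumes Q: "Q \<in> carrier_mat n n" and Q': "Q' \<in> carrier_mat n n"
    and QQ': "Q * Q' = 1\<^sub>m n" and Q'Q: "Q' * Q = 1\<^sub>m n"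
begin

definition new_basis :: "nat \<Rightarrow> 'v" where
  "new_basis j = (\<Sum>i<n. scale (Q $$ (i, j - 1)) (x (Suc i)))"

lemma crd_new_basis: "i < n \<Longrightarrow> crd (new_basis (Suc j)) i = Q $$ (i, j)"
  unfolding new_basis_def crd_sum_scale
  by (simp add: crd_basis if_distrib[where f = "\<lambda>c. _ * c"] cong: if_cong)

lemma
  shows is_basis_new_basis: "is_basis scale n new_basis"
    and coord_new_basis: "i < n \<Longrightarrow> coord scale n new_basis v (Suc i) = (\<Sum>k<n. Q' $$ (i, k) * crd v k)"
proof -
  define \<phi> where "\<phi> i v = (\<Sum>k<n. Q' $$ (i - 1, k) * crd v k)" for i v
  have 1: "\<phi> i (new_basis j) = (if i = j then 1 else 0)" if ij: "i \<in> {1..n}" "j \<in> {1..n}" for i j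
  proof -
    obtain i' j' where [simp]: "i = Suc i'" "j = Suc j'" and "i' < n" "j' < n"
      using ij by (cases i; cases j) auto
    then have "\<phi> i (new_basis j) = (Q' * Q) $$ (i', j')"
      by (simp add: \<phi>_def crd_new_basis mat_mult_entries[OF Q' Q])
    then show ?thesis using \<open>i' < n\<close> \<open>j' < n\<close> by (simp add: Q'Q)
  qed
  have 2: "\<phi> i (u + v) = \<phi> i u + \<phi> i v" for i u v
    by (simp add: \<phi>_def crd_add distrib_left sum.distrib)
  have 3: "\<phi> i (scale c v) = c * \<phi> i v" for i c v
    by (simp add: \<phi>_def crd_scale sum_distrib_left mult_ac)
  have 4: "(\<Sum>i\<in>{1..n}. scale (\<phi> i v) (new_basis i)) = v" for v
  proof -
    have "crd (\<Sum>i\<in>{1..n}. scale (\<phi> i v) (new_basis i)) r = crd v r" if r: "r < n" for r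
    proof -
      have "crd (\<Sum>i\<in>{1..n}. scale (\<phi> i v) (new_basis i)) r =
          (\<Sum>i<n. (\<Sum>k<n. Q' $$ (i, k) * crd v k) * Q $$ (r, i))"
        unfolding crd_sum_scale sum_from_one using r
        by (simp add: \<phi>_def crd_new_basis)
      also have "\<dots> = (\<Sum>k<n. (\<Sum>i<n. Q $$ (r, i) * Q' $$ (i, k)) * crd v k)"
        unfolding sum_distrib_right by (subst sum.swap) (simp add: mult_ac)
      also have "\<dots> = (\<Sum>k<n. (Q * Q') $$ (r, k) * crd v k)"
        using r by (simp add: mat_mult_entries[OF Q Q'])
      also have "\<dots> = (\<Sum>k<n. (if r = k then 1 else 0) * crd v k)"
        using r by (intro sum.cong) (auto simp: QQ')
      also have "\<dots> = crd v r" by (rule sum_lessThan_indicator(2)[OF r])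
      finally show ?thesis .
    qed
    then show ?thesis
      by (subst (1 2) expansion[symmetric]) (intro sum.cong, auto)
  qed
  note dual = is_basis_if_dual_family[of n \<phi> new_basis, OF 1 2 3 4]
  show "is_basis scale n new_basis"
    using dual(1) by (simp add: is_basis_def)
  show "coord scale n new_basis v (Suc i) = (\<Sum>k<n. Q' $$ (i, k) * crd v k)" if "i < n"
    using dual(2)[of "Suc i" v] that by (simp add: \<phi>_def)
qed

lemma matrix_in_new_basis:
  assumes T: "Vector_Spaces.linear scale scale T"
  shows "matrix_in_basis scale n new_basis T = Q' * M T * Q"
proof (rule eq_matI)
  fix i j assume "i < dim_row (Q' * M T * Q)" "j < dim_col (Q' * M T * Q)"
  then have ij: "i < n" "j < n" using Q Q' by auto
  have "(Q' * M T * Q) $$ (i, j) = (Q' * (M T * Q)) $$ (i, j)"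
    by (simp add: assoc_mult_mat[OF Q' M_carrier Q])
  also have "\<dots> = (\<Sum>k<n. Q' $$ (i, k) * (\<Sum>r<n. M T $$ (k, r) * Q $$ (r, j)))"
    unfolding mat_mult_entries[OF Q' mult_carrier_mat[OF M_carrier Q]]
    using ij by (simp add: mat_mult_entries[OF M_carrier Q])
  also have "\<dots> = (\<Sum>k<n. Q' $$ (i, k) * crd (T (new_basis (Suc j))) k)"
    by (intro sum.cong) (auto simp: crd_linear[OF T] crd_new_basis)
  also have "\<dots> = matrix_in_basis scale n new_basis T $$ (i, j)"
    using ij by (simp add: matrix_in_basis_def coord_new_basis)
  finally show "matrix_in_basis scale n new_basis T $$ (i, j) = (Q' * M T * Q) $$ (i, j)" ..
qed (use Q Q' in \<open>auto simp: matrix_in_basis_def\<close>)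

lemma based_space_new_basis: "based_space scale n new_basis"
  by unfold_locales (rule is_basis_new_basis)

end

lemma permutation_matrix:
  assumes "q permutes {1..n}"
  shows "M (permutation_representation scale n x q) =
    mat n n (\<lambda>(i, j). if Suc i = q (Suc j) then 1 else 0)"
proof (rule eq_matI)
  fix i j assume "i < dim_row (mat n n (\<lambda>(i, j). if Suc i = q (Suc j) then 1 else 0 :: complex))"
    "j < dim_col (mat n n (\<lambda>(i, j). if Suc i = q (Suc j) then 1 else 0 :: complex))"
  then have ij: "i < n" "j < n" by auto
  have "permutation_representation scale n x q (x (Suc j)) =
      (\<Sum>k<n. scale (if k = j then 1 else 0) (x (q (Suc k))))"
    unfolding permutation_representation_def sum_from_one
    using ij by (intro sum.cong) (auto simp: crd_basis)
  also have "\<dots> = (\<Sum>k\<in>{j}. x (q (Suc k)))"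
    using ij by (intro sum.mono_neutral_cong_right) auto
  finally have eq: "permutation_representation scale n x q (x (Suc j)) = x (q (Suc j))" by simp
  have "q (Suc j) \<in> {1..n}" using ij by (simp only: permutes_in_image[OF assms]) simp
  then obtain k where k: "q (Suc j) = Suc k" "k < n" by (cases "q (Suc j)") auto
  show "M (permutation_representation scale n x q) $$ (i, j) =
      mat n n (\<lambda>(i, j). if Suc i = q (Suc j) then 1 else 0) $$ (i, j)"
    using ij k crd_basis[of i k] by (simp add: M_entry eq)
qed (auto simp: matrix_in_basis_def)

end

section \<open>Matrices of the two representations\<close>

lemma carrier_GL_if_inverse:
  assumes "A \<in> carrier_mat n n" "B \<in> carrier_mat n n" "A * B = 1\<^sub>m n"
  shows "A \<in> carrier (GL n UNIV)"
proof -
  have "det A * det B = 1" using det_mult[OF assms(1,2)] assms(3) by simp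
  then show ?thesis using assms(1) by (auto simp: GL_def mat_space_def)
qed

lemma (in based_space) permutation_matrix_hom:
  "(\<lambda>q. M (permutation_representation scale n x q)) \<in> hom (sym_group n) (GL n UNIV)"
proof -
  let ?h = "\<lambda>q. M (permutation_representation scale n x q)"
  have mult: "?h (p \<circ> q) = ?h p * ?h q" if p: "p permutes {1..n}" and q: "q permutes {1..n}" for p q
  proof (rule eq_matI)
    fix i j assume "i < dim_row (?h p * ?h q)" "j < dim_col (?h p * ?h q)"
    then have ij: "i < n" "j < n" by (auto simp: matrix_in_basis_def)
    have "q (Suc j) \<in> {1..n}" using ij by (simp only: permutes_in_image[OF q]) simp
    then obtain k where k: "q (Suc j) = Suc k" "k < n" by (cases "q (Suc j)") auto
    have "(?h p * ?h q) $$ (i, j) =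
        (\<Sum>r<n. (if Suc i = p (Suc r) then 1 else 0) * (if r = k then 1 else 0))"
      unfolding mat_mult_entries[OF M_carrier M_carrier] using ij k p q
      by (simp add: permutation_matrix)
    also have "\<dots> = ?h (p \<circ> q) $$ (i, j)"
      using ij k p q by (simp add: sum_lessThan_indicator permutation_matrix permutes_compose)
    finally show "?h (p \<circ> q) $$ (i, j) = (?h p * ?h q) $$ (i, j)" ..
  qed (auto simp: matrix_in_basis_def)
  have one: "?h id = 1\<^sub>m n"
    unfolding permutation_matrix[OF permutes_id] by (auto intro!: eq_matI)
  show ?thesis
  proof (rule homI)
    fix q assume "q \<in> carrier (sym_group n)"
    then have q: "q permutes {1..n}" by (simp add: sym_group_def)
    have "?h q * ?h (inv_into UNIV q) = 1\<^sub>m n"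
      using mult[OF q permutes_inv[OF q]] one permutes_inv_o(1)[OF q] by simp
    then show "?h q \<in> carrier (GL n UNIV)" by (rule carrier_GL_if_inverse[OF M_carrier M_carrier])
  next
    fix p q assume "p \<in> carrier (sym_group n)" "q \<in> carrier (sym_group n)"
    then show "?h (p \<otimes>\<^bsub>sym_group n\<^esub> q) = ?h p \<otimes>\<^bsub>GL n UNIV\<^esub> ?h q"
      using mult by (simp add: sym_group_def GL_def)
  qed
qed

lemma GL_space_hom_linear:
  assumes "\<pi> \<in> hom G (GL_space scale)" "g \<in> carrier G"
  shows "Vector_Spaces.linear scale scale (\<pi> g)" "bij (\<pi> g)"
  using assms by (auto simp: hom_def GL_space_def)

lemma GL_space_hom_mult:
  assumes "\<pi> \<in> hom G (GL_space scale)" "g \<in> carrier G" "h \<in> carrier G"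
  shows "\<pi> (g \<otimes>\<^bsub>G\<^esub> h) = \<pi> g \<circ> \<pi> h"
  using assms by (auto simp: hom_def GL_space_def)

lemma GL_space_hom_one:
  assumes "group G" "\<pi> \<in> hom G (GL_space scale)"
  shows "\<pi> \<one>\<^bsub>G\<^esub> = id"
proof
  fix v
  interpret group G by fact
  have "\<pi> \<one>\<^bsub>G\<^esub> (\<pi> \<one>\<^bsub>G\<^esub> v) = \<pi> \<one>\<^bsub>G\<^esub> v"
    using GL_space_hom_mult[OF assms(2), of "\<one>\<^bsub>G\<^esub>" "\<one>\<^bsub>G\<^esub>"] by (simp add: fun_eq_iff)
  then show "\<pi> \<one>\<^bsub>G\<^esub> v = id v"
    using GL_space_hom_linear(2)[OF assms(2), of "\<one>\<^bsub>G\<^esub>"] by (simp add: bij_def inj_eq)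
qed

lemma (in based_space) representation_matrix_mult:
  assumes "\<pi> \<in> hom G (GL_space scale)" "g \<in> carrier G" "h \<in> carrier G"
  shows "M (\<pi> (g \<otimes>\<^bsub>G\<^esub> h)) = M (\<pi> g) * M (\<pi> h)"
  unfolding GL_space_hom_mult[OF assms] by (rule M_comp) (rule GL_space_hom_linear(1)[OF assms(1,2)])

lemma (in based_space) representation_matrix_hom:
  assumes G: "group G" and \<pi>: "\<pi> \<in> hom G (GL_space scale)"
  shows "(\<lambda>g. M (\<pi> g)) \<in> hom G (GL n UNIV)"
proof (rule homI)
  interpret group G by fact
  fix g assume g: "g \<in> carrier G"
  have "M (\<pi> g) * M (\<pi> (inv\<^bsub>G\<^esub> g)) = 1\<^sub>m n"
    using representation_matrix_mult[OF \<pi> g inv_closed[OF g]] g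
    by (simp add: GL_space_hom_one[OF G \<pi>] M_id)
  then show "M (\<pi> g) \<in> carrier (GL n UNIV)" by (rule carrier_GL_if_inverse[OF M_carrier M_carrier])
next
  fix g h assume "g \<in> carrier G" "h \<in> carrier G"
  then show "M (\<pi> (g \<otimes>\<^bsub>G\<^esub> h)) = M (\<pi> g) \<otimes>\<^bsub>GL n UNIV\<^esub> M (\<pi> h)"
    using representation_matrix_mult[OF \<pi>] by (simp add: GL_def)
qed

lemma (in based_space) representation_matrix_pow:
  assumes G: "group G" and \<pi>: "\<pi> \<in> hom G (GL_space scale)" and g: "g \<in> carrier G"
  shows "M (\<pi> g) ^\<^sub>m k = M (\<pi> (g [^]\<^bsub>G\<^esub> (k :: nat)))"
proof -
  interpret group G by fact
  show ?thesis
  proof (induction k)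
    case 0
    have "M (\<pi> \<one>\<^bsub>G\<^esub>) = 1\<^sub>m n" by (simp only: GL_space_hom_one[OF G \<pi>] M_id)
    then show ?case using carrier_matD(1)[OF M_carrier] by simp
  next
    case (Suc k)
    then show ?case using g by (simp add: representation_matrix_mult[OF \<pi>])
  qed
qed

text \<open>Otherwise the orbit of the basis vector of column \<open>j\<close> lies in the kernel of
  the coordinate of row \<open>i\<close>. Its span is invariant and nonzero, hence everything, but
  that kernel is a proper subspace.\<close>

lemma (in based_space) irreducible_entry_nonzero:
  assumes G: "group G" and irr: "irreducible_representation G scale \<pi>" and ij: "i < n" "j < n"
  shows "\<exists>g\<in>carrier G. M (\<pi> g) $$ (i, j) \<noteq> 0"
proof (rule ccontr)
  interpret group G by fact
  have \<pi>: "\<pi> \<in> hom G (GL_space scale)" using irr by (simp add: irreducible_representation_def)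
  assume "\<not> ?thesis"
  then have zero: "crd (\<pi> g (x (Suc j))) i = 0" if "g \<in> carrier G" for g
    using that ij by (auto simp: M_entry)
  let ?O = "(\<lambda>g. \<pi> g (x (Suc j))) ` carrier G"
  have crd0: "crd 0 k = 0" for k using crd_scale[of 0 0 k] by simp
  have inv: "\<pi> h ` span ?O \<subseteq> span ?O" if h: "h \<in> carrier G" for h
  proof -
    interpret T: Vector_Spaces.linear scale scale "\<pi> h" by (rule GL_space_hom_linear(1)[OF \<pi> h])
    have "span ?O \<subseteq> {w. \<pi> h w \<in> span ?O}"
    proof (rule span_minimal)
      have "\<pi> h (\<pi> g (x (Suc j))) \<in> ?O" if "g \<in> carrier G" for g
        using GL_space_hom_mult[OF \<pi> h that] h that by (auto simp: fun_eq_iff intro!: image_eqI[of _ _ "h \<otimes>\<^bsub>G\<^esub> g"])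
      then show "?O \<subseteq> {w. \<pi> h w \<in> span ?O}" by (auto intro: span_base)
      show "subspace {w. \<pi> h w \<in> span ?O}"
        by (rule subspaceI) (auto simp: T.zero T.add T.scale span_zero span_add span_scale)
    qed
    then show ?thesis by auto
  qed
  have "span ?O = {0} \<or> span ?O = UNIV"
  proof -
    have "\<forall>W. subspace W \<and> (\<forall>g\<in>carrier G. \<pi> g ` W \<subseteq> W) \<longrightarrow> W = {0} \<or> W = UNIV"
      using irr unfolding irreducible_representation_def by simp
    from this[rule_format, of "span ?O"] show ?thesis
      using inv subspace_span by simp
  qed
  moreover have "x (Suc j) \<in> span ?O"
    by (rule span_base, rule image_eqI[of _ _ "\<one>\<^bsub>G\<^esub>"]) (simp_all add: GL_space_hom_one[OF G \<pi>])
  moreover have "x (Suc j) \<noteq> 0"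
    using crd_basis[OF ij(2) ij(2)] crd0[of j] by auto
  ultimately have "span ?O = UNIV" by auto
  moreover have "span ?O \<subseteq> {w. crd w i = 0}"
    by (rule span_minimal) (auto simp: zero crd0 crd_add crd_scale intro!: subspaceI)
  ultimately have "crd (x (Suc i)) i = 0" by auto
  then show False using crd_basis[OF ij(1) ij(1)] by simp
qed

lemma (in complex_subfield) free_product_lift_GL_closed:
  assumes G: "group G" and H: "group H" and f: "f \<in> hom G (GL n UNIV)" and h: "h \<in> hom H (GL n UNIV)"
    and fK: "\<And>a. a \<in> carrier G \<Longrightarrow> f a \<in> mat_space n K"
    and hK: "\<And>b. b \<in> carrier H \<Longrightarrow> h b \<in> mat_space n K"
    and U: "U \<in> carrier (free_product G H)"
  shows "free_product_lift (GL n UNIV) f h U \<in> mat_space n K"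
proof -
  obtain u where u: "u \<in> words G H" "U = free_product_rel G H `` {u}"
    using U by (auto simp: free_product_def elim!: quotientE)
  have "word_eval (GL n UNIV) f h u \<in> mat_space n K" if "u \<in> words G H" for u
    using that
  proof (induction u)
    case Nil
    then show ?case by (auto simp: word_eval_def GL_def mat_space_def zero_closed one_closed)
  next
    case (Cons s u)
    then have "case_sum f h s \<in> mat_space n K" using fK hK by auto
    then show ?case
      using mult_mat_space Cons by (simp add: word_eval_def GL_def)
  qed
  then show ?thesis
    using free_product_lift_class[OF G H group_GL_complex f h u(1)] u by simp
qed

text \<open>A neighbourhood of \<open>A\<close> contains the points of \<open>GL\<close> where some
  polynomial over \<open>L\<close>, nonzero at \<open>A\<close>, does not vanish; as a complex
  polynomial it cannot vanish on all of \<open>S\<close>.\<close>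

lemma zariski_dense_in_GL_if_closure:
  assumes L: "subring L complex_field" and S: "S \<subseteq> carrier (GL n L)"
    and dense: "zariski_closure n S = carrier_mat n n"
  shows "zariski_dense_in_GL n L S"
proof -
  have GL: "carrier (GL n L) \<subseteq> mat_space n L" by (auto simp: GL_def)
  have "A \<in> (zariski_GL n L) closure_of S" if A: "A \<in> carrier (GL n L)" for A
    unfolding in_closure_of
  proof (intro conjI allI impI)
    show "A \<in> topspace (zariski_GL n L)"
      using A GL by (auto simp: zariski_GL_def topspace_zariski_topology[OF L])
    fix T assume T: "A \<in> T \<and> openin (zariski_GL n L) T"
    then obtain p where p: "p \<subseteq> mpolys L ({..<n} \<times> {..<n})"
      and T': "T = (mat_space n L - zero_locus n L p) \<inter> carrier (GL n L)"
      by (auto simp: zariski_GL_def openin_subtopology openin_zariski_topology_iff[OF L])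
    with T obtain q where q: "q \<in> p" "mpoly_eval (\<lambda>ij. A $$ ij) q \<noteq> 0"
      by (auto simp: zero_locus_def)
    let ?f = "\<lambda>A. mpoly_eval (\<lambda>ij. A $$ ij) q"
    have f: "?f \<in> polynomial_functions n"
      by (rule mpoly_eval_polynomial_function) (use p q in auto)
    have "A \<in> zariski_closure n S"
      using A GL unfolding dense by (auto simp: mat_space_def)
    then obtain B where B: "B \<in> S" "?f B \<noteq> 0"
      using zariski_closure_vanish[OF _ f] q(2) by blast
    then have "B \<in> T"
      unfolding T' using S GL q(1) by (auto simp: zero_locus_def)
    then show "\<exists>y. y \<in> S \<and> y \<in> T" using B by blast
  qed
  moreover have "(zariski_GL n L) closure_of S \<subseteq> carrier (GL n L)"
    using closure_of_subset_topspace[of "zariski_GL n L" S] by (auto simp: zariski_GL_def)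
  ultimately show ?thesis
    using S by (auto simp: zariski_dense_in_GL_def)
qed

lemma mat_diag_pow: "mat_diag n e ^\<^sub>m k = mat_diag n (\<lambda>i. e i ^ k)"
proof (induction k)
  case 0
  then show ?case using carrier_matD(1)[OF mat_diag_dim, of n e] by simp
qed (simp add: power_Suc2 del: power_Suc)

lemma smult_smult_mat: "a \<cdot>\<^sub>m (b \<cdot>\<^sub>m A) = (a * b :: 'a :: comm_ring_1) \<cdot>\<^sub>m A"
  by (intro eq_matI) (auto simp: mult.assoc)

text \<open>Two changes of basis: to an eigenbasis of the regular element, which makes
  \<open>realizable_after_rescaling\<close> applicable, and then a diagonal one, which leaves
  \<open>mat_diag n z\<close> as it is. The \<open>z i\<close> are \<open>m\<close>-th roots of
  unity, hence nonzero and in \<open>K\<close>.\<close>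

lemma (in based_space) rational_eigenbasis:
  assumes G: "group G" and irr: "irreducible_representation G scale \<pi>" and n: "0 < n" and m: "0 < m"
    and ord: "\<And>g. g \<in> carrier G \<Longrightarrow> g [^]\<^bsub>G\<^esub> m = \<one>\<^bsub>G\<^esub>"
    and K: "complex_subfield K" and roots: "\<And>w. w ^ m = 1 \<Longrightarrow> w \<in> K"
    and g: "g \<in> carrier G" and reg: "regular_semisimple (M (\<pi> g))"
  obtains v z where "based_space scale n v"
    and "\<And>h. h \<in> carrier G \<Longrightarrow> matrix_in_basis scale n v (\<pi> h) \<in> mat_space n K"
    and "matrix_in_basis scale n v (\<pi> g) = mat_diag n z" "inj_on z {..<n}"
    and "\<And>i. i < n \<Longrightarrow> z i \<noteq> 0" "\<And>i. i < n \<Longrightarrow> z i \<in> K"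
proof -
  interpret G: group G by fact
  interpret complex_subfield K by fact
  have \<pi>: "\<pi> \<in> hom G (GL_space scale)" using irr by (simp add: irreducible_representation_def)
  obtain es where es: "char_poly (M (\<pi> g)) = (\<Prod>e\<leftarrow>es. [:- e, 1:])" "distinct es"
    using reg by (auto simp: regular_semisimple_def)
  obtain W W' z where W: "W \<in> carrier_mat n n" "W' \<in> carrier_mat n n" "W * W' = 1\<^sub>m n" "W' * W = 1\<^sub>m n"
    and Wz: "W' * M (\<pi> g) * W = mat_diag n z" and inj_z: "inj_on z {..<n}"
    using distinct_eigenvalues_diagonalizable[OF M_carrier es] by blast
  interpret E: based_space scale n "new_basis W" by (rule based_space_new_basis[OF W])
  have Ez: "E.M (\<pi> g) = mat_diag n z"
    using matrix_in_new_basis[OF W GL_space_hom_linear(1)[OF \<pi> g]] Wz by simp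
  have pow: "E.M (\<pi> h) ^\<^sub>m m = 1\<^sub>m n" if "h \<in> carrier G" for h
    unfolding E.representation_matrix_pow[OF G \<pi> that] ord[OF that] GL_space_hom_one[OF G \<pi>]
    by (rule E.M_id)
  have zm: "z i ^ m = 1" if i: "i < n" for i
  proof -
    have "mat_diag n (\<lambda>i. z i ^ m) $$ (i, i) = 1\<^sub>m n $$ (i, i)"
      using pow[OF g] unfolding Ez mat_diag_pow by simp
    then show ?thesis using i by (simp add: mat_diag_def)
  qed
  let ?M = "(\<lambda>h. E.M (\<pi> h)) ` carrier G"
  have zK: "z i \<in> K" if "i < n" for i using zm[OF that] by (rule roots)
  obtain c where c: "\<And>i. i < n \<Longrightarrow> c i \<noteq> 0"
    and cK: "\<And>A i j. A \<in> ?M \<Longrightarrow> i < n \<Longrightarrow> j < n \<Longrightarrow> A $$ (i, j) * c j / c i \<in> K"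
  proof (rule realizable_after_rescaling[OF n _ _ _ _ inj_z zK])
    show "?M \<subseteq> carrier_mat n n" using E.M_carrier by auto
    fix A B assume "A \<in> ?M" "B \<in> ?M"
    then show "A * B \<in> ?M"
      by (auto simp flip: E.representation_matrix_mult[OF \<pi>])
  next
    fix A assume "A \<in> ?M"
    then show "mat_trace A \<in> K"
      using finite_order_mat_trace_closed[OF E.M_carrier pow roots] by auto
  next
    show "mat_diag n z \<in> ?M" using g by (auto simp flip: Ez)
    show "\<exists>A\<in>?M. A $$ (i, j) \<noteq> 0" if "i < n" "j < n" for i j
      using E.irreducible_entry_nonzero[OF G irr that] by auto
  next
    fix c assume "\<And>i. i < n \<Longrightarrow> c i \<noteq> 0"
      "\<And>A i j. A \<in> ?M \<Longrightarrow> i < n \<Longrightarrow> j < n \<Longrightarrow> A $$ (i, j) * c j / c i \<in> K"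
    then show thesis by (rule that)
  qed
  let ?Q = "mat_diag n c" and ?Q' = "mat_diag n (\<lambda>i. 1 / c i)"
  have Q: "?Q \<in> carrier_mat n n" "?Q' \<in> carrier_mat n n" "?Q * ?Q' = 1\<^sub>m n" "?Q' * ?Q = 1\<^sub>m n"
    using c unfolding mat_diag_diag by (auto simp: mat_diag_def intro!: eq_matI)
  let ?v = "E.new_basis ?Q"
  have conj: "matrix_in_basis scale n ?v (\<pi> h) = mat n n (\<lambda>(i, j). E.M (\<pi> h) $$ (i, j) * c j / c i)"
    if "h \<in> carrier G" for h
    unfolding E.matrix_in_new_basis[OF Q GL_space_hom_linear(1)[OF \<pi> that]]
      mat_diag_mult_left[OF E.M_carrier]
    by (subst mat_diag_mult_right[of _ n]) (auto intro!: eq_matI)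
  show thesis
  proof (rule that[of ?v z])
    show "based_space scale n ?v" by (rule E.based_space_new_basis[OF Q])
    show "matrix_in_basis scale n ?v (\<pi> h) \<in> mat_space n K" if "h \<in> carrier G" for h
      unfolding conj[OF that] using cK that by (auto simp: mat_space_def)
    show "matrix_in_basis scale n ?v (\<pi> g) = mat_diag n z"
      unfolding conj[OF g] Ez using c by (auto simp: mat_diag_def intro!: eq_matI)
    show "z i \<noteq> 0" if "i < n" for i
      using zm[OF that] m by (auto simp: power_0_left)
  qed (use inj_z zK in auto)
qed

section \<open>The group generated by the two representations\<close>

locale matrix_group = based_space scale n x + G: group G + complex_subfield K
  for scale :: "complex \<Rightarrow> 'v :: ab_group_add \<Rightarrow> 'v" and n x
    and G :: "('g, 'b) monoid_scheme" (structure) and K +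
  fixes \<pi> :: "'g \<Rightarrow> 'v \<Rightarrow> 'v"
  assumes \<pi>: "\<pi> \<in> hom G (GL_space scale)"
    and \<pi>_K: "\<And>g. g \<in> carrier G \<Longrightarrow> M (\<pi> g) \<in> mat_space n K"
begin

definition scaled_image :: "complex mat set" where
  "scaled_image = {c \<cdot>\<^sub>m A | c A. c \<in> K - {0} \<and>
     A \<in> Pi_hom scale n x \<pi> ` carrier (free_product G (sym_group n))}"

lemmas homs = representation_matrix_hom[OF G.group_axioms \<pi>] permutation_matrix_hom
lemmas groups = G.group_axioms sym_group_is_group[of n] group_GL_complex[of n]

lemma Pi_hom: "Pi_hom scale n x \<pi> \<in> hom (free_product G (sym_group n)) (GL n UNIV)"
  unfolding Pi_hom_def by (rule free_product_lift_hom[OF groups homs])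

lemma Pi_hom_mat_space:
  assumes U: "U \<in> carrier (free_product G (sym_group n))"
  shows "Pi_hom scale n x \<pi> U \<in> mat_space n K"
  unfolding Pi_hom_def
proof (rule free_product_lift_GL_closed[OF groups(1,2) homs _ _ U])
  fix q assume "q \<in> carrier (sym_group n)"
  then have "q permutes {1..n}" by (simp add: sym_group_def)
  then show "M (permutation_representation scale n x q) \<in> mat_space n K"
    by (simp add: permutation_matrix mat_space_def zero_closed one_closed)
qed (rule \<pi>_K)

lemma scaled_image_GL:
  assumes "K \<subseteq> L"
  shows "scaled_image \<subseteq> carrier (GL n L)"
proof
  fix A assume "A \<in> scaled_image"
  then obtain c U where A: "A = c \<cdot>\<^sub>m Pi_hom scale n x \<pi> U" and c: "c \<in> K" "c \<noteq> 0"
    and U: "U \<in> carrier (free_product G (sym_group n))" by (auto simp: scaled_image_def)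
  have "Pi_hom scale n x \<pi> U \<in> carrier (GL n UNIV)" by (rule hom_in_carrier[OF Pi_hom U])
  then show "A \<in> carrier (GL n L)"
    using Pi_hom_mat_space[OF U] c mult_closed[OF c(1)] assms unfolding A
    by (auto simp: GL_def mat_space_def)
qed

lemma scaled_image_carrier: "scaled_image \<subseteq> carrier_mat n n"
  using scaled_image_GL[OF subset_UNIV] by (auto simp: GL_def mat_space_def)

lemma scaled_image_smult:
  assumes "A \<in> scaled_image" "c \<in> K" "c \<noteq> 0"
  shows "c \<cdot>\<^sub>m A \<in> scaled_image"
proof -
  obtain d B where A: "A = d \<cdot>\<^sub>m B" "d \<in> K" "d \<noteq> 0"
    and B: "B \<in> Pi_hom scale n x \<pi> ` carrier (free_product G (sym_group n))"
    using assms(1) by (auto simp: scaled_image_def)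
  have "c \<cdot>\<^sub>m A = (c * d) \<cdot>\<^sub>m B" by (simp add: A(1) smult_smult_mat)
  moreover have "c * d \<in> K - {0}" using A assms(2,3) by (auto intro: mult_closed)
  ultimately show ?thesis
    unfolding scaled_image_def mem_Collect_eq using B by (intro exI[of _ "c * d"] exI[of _ B]) simp
qed

lemma image_in_scaled_image:
  assumes "U \<in> carrier (free_product G (sym_group n))" "Pi_hom scale n x \<pi> U = A"
  shows "A \<in> scaled_image"
proof -
  have "A = 1 \<cdot>\<^sub>m A" by auto
  moreover have "A \<in> Pi_hom scale n x \<pi> ` carrier (free_product G (sym_group n))"
    using assms by blast
  moreover have "1 \<in> K - {0}" using one_closed by simp
  ultimately show ?thesis unfolding scaled_image_def mem_Collect_eq by (intro exI[of _ 1] exI[of _ A]) simp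
qed

lemma scaled_image_mult:
  assumes "A \<in> scaled_image" "B \<in> scaled_image"
  shows "A * B \<in> scaled_image"
proof -
  interpret F: group "free_product G (sym_group n)" by (rule group_free_product[OF groups(1,2)])
  obtain c U d V where A: "A = c \<cdot>\<^sub>m Pi_hom scale n x \<pi> U" "c \<in> K" "c \<noteq> 0"
    and U: "U \<in> carrier (free_product G (sym_group n))"
    and B: "B = d \<cdot>\<^sub>m Pi_hom scale n x \<pi> V" "d \<in> K" "d \<noteq> 0"
    and V: "V \<in> carrier (free_product G (sym_group n))"
    using assms by (auto simp: scaled_image_def)
  have carr: "Pi_hom scale n x \<pi> U \<in> carrier_mat n n" "Pi_hom scale n x \<pi> V \<in> carrier_mat n n"
    using Pi_hom_mat_space U V by (auto simp: mat_space_def)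
  have "A * B = (c * d) \<cdot>\<^sub>m (Pi_hom scale n x \<pi> U * Pi_hom scale n x \<pi> V)"
    unfolding A(1) B(1) using carr
    by (simp add: mult_smult_distrib[of _ n n _ n] mult_smult_assoc_mat[of _ n n _ n] smult_smult_mat mult.commute)
  also have "Pi_hom scale n x \<pi> U * Pi_hom scale n x \<pi> V =
      Pi_hom scale n x \<pi> (U \<otimes>\<^bsub>free_product G (sym_group n)\<^esub> V)"
    using hom_mult[OF Pi_hom U V] by (simp add: GL_def)
  finally show ?thesis
    using scaled_image_smult[OF image_in_scaled_image[OF F.m_closed[OF U V] refl], of "c * d"] A B
    by (simp add: mult_closed)
qed

lemma generators_in_scaled_image:
  shows "g \<in> carrier G \<Longrightarrow> M (\<pi> g) \<in> scaled_image"
    and "q permutes {1..n} \<Longrightarrow> M (permutation_representation scale n x q) \<in> scaled_image"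
proof -
  assume g: "g \<in> carrier G"
  show "M (\<pi> g) \<in> scaled_image"
    by (rule image_in_scaled_image[of "free_product_rel G (sym_group n) `` {[Inl g]}"])
      (use g in \<open>auto simp: Pi_hom_def free_product_lift_left[OF groups homs] free_product_def intro!: quotientI\<close>)
next
  assume q: "q permutes {1..n}"
  then have q: "q \<in> carrier (sym_group n)" by (simp add: sym_group_def)
  show "M (permutation_representation scale n x q) \<in> scaled_image"
    by (rule image_in_scaled_image[of "free_product_rel G (sym_group n) `` {[Inr q]}"])
      (use q in \<open>auto simp: Pi_hom_def free_product_lift_right[OF groups homs] free_product_def intro!: quotientI\<close>)
qed

text \<open>There is no transposition in dimension one, but the scalars \<open>2 ^ k\<close> already
  form an infinite subset of the line, and the identity meets the condition on columns.\<close>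

lemma scaled_image_dense_dim_one:
  assumes n: "n = 1"
  shows "zariski_closure n scaled_image = carrier_mat n n"
proof (rule zariski_closure_eq_carrier[OF scaled_image_carrier scaled_image_mult, where d = "\<lambda>_. 2"])
  have one: "1\<^sub>m n \<in> scaled_image"
    using generators_in_scaled_image(1)[OF G.one_closed] by (simp add: GL_space_hom_one[OF G.group_axioms \<pi>] M_id)
  show "mat_diag n (\<lambda>_. 2 ^ k) \<in> scaled_image" for k
  proof -
    have "mat_diag n (\<lambda>_. 2 ^ k :: complex) = 2 ^ k \<cdot>\<^sub>m 1\<^sub>m n" by (auto simp: mat_diag_def intro!: eq_matI)
    then show ?thesis using scaled_image_smult[OF one, of "2 ^ k"] by (simp add: closed)
  qed
  show "\<exists>A\<in>scaled_image. \<exists>A'\<in>scaled_image. \<exists>l<n. A * A' = 1\<^sub>m n \<and>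
      (\<forall>i<n. i \<noteq> k \<longrightarrow> A $$ (i, l) \<noteq> 0) \<and> A' $$ (l, k) \<noteq> 0" if "k < n" for k
    using one that by (intro bexI[of _ "1\<^sub>m n"] exI[of _ k]) (auto simp: n)
  show "inj_on (monomial_value (\<lambda>_. 2)) {a. Poly_Mapping.keys a \<subseteq> {..<n}}"
  proof (rule inj_onI, unfold mem_Collect_eq)
    fix a b :: "nat \<Rightarrow>\<^sub>0 nat"
    assume keys: "Poly_Mapping.keys a \<subseteq> {..<n}" "Poly_Mapping.keys b \<subseteq> {..<n}"
      and eq: "monomial_value (\<lambda>_. 2) a = monomial_value (\<lambda>_. 2) b"
    have val: "monomial_value (\<lambda>_. 2) c = 2 ^ Poly_Mapping.lookup c 0"
      if "Poly_Mapping.keys c \<subseteq> {..<n}" for c :: "nat \<Rightarrow>\<^sub>0 nat"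
    proof -
      have "monomial_value (\<lambda>_. 2) c = (\<Prod>i\<in>{0}. 2 ^ Poly_Mapping.lookup c i)"
        unfolding monomial_value_def
        by (rule prod.mono_neutral_left) (use that n in \<open>auto simp: in_keys_iff\<close>)
      then show ?thesis by simp
    qed
    have "complex_of_real (2 ^ Poly_Mapping.lookup a 0) = complex_of_real (2 ^ Poly_Mapping.lookup b 0)"
      using eq by (simp add: val keys)
    then have "(2 :: real) ^ Poly_Mapping.lookup a 0 = 2 ^ Poly_Mapping.lookup b 0"
      by (simp only: of_real_eq_iff)
    then have "Poly_Mapping.lookup a 0 = Poly_Mapping.lookup b 0" by simp
    moreover have "Poly_Mapping.lookup c i = 0" if "Poly_Mapping.keys c \<subseteq> {..<n}" "i \<noteq> 0"
      for c :: "nat \<Rightarrow>\<^sub>0 nat" and i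
    proof -
      have "i \<notin> Poly_Mapping.keys c" using that n by auto
      then show ?thesis by (simp add: in_keys_iff)
    qed
    ultimately show "a = b" using keys by (intro poly_mapping_eqI) metis
  qed
qed

end

theorem lemma6p20:
  fixes G :: "('g, 'b) monoid_scheme"
    and scale :: "complex \<Rightarrow> 'v :: ab_group_add \<Rightarrow> 'v"
    and \<pi> :: "'g \<Rightarrow> 'v \<Rightarrow> 'v"
    and n m :: nat
    and K :: "complex set"
  defines "K0 \<equiv> cyclotomic_field (n * m)"
    and "Kbar \<equiv> algebraic_closure_in_complex K"
  assumes "group G" and "finite (carrier G)"
    and "vector_space scale"
    and "\<exists>B. finite B \<and> module.span scale B = UNIV"
    and "vector_space.dim scale UNIV = n"
    and "irreducible_representation G scale \<pi>"
    and "0 < m" and "even m"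
    and "\<And>g. g \<in> carrier G \<Longrightarrow> g [^]\<^bsub>G\<^esub> m = \<one>\<^bsub>G\<^esub>"
    and "subfield K complex_field" and "K0 \<subseteq> K"
    and "\<exists>t :: nat \<Rightarrow> complex. t ` {1..n} \<subseteq> K \<and> algebraically_independent K0 {1..n} t"
    and "\<exists>g\<in>carrier G. \<exists>y. is_basis scale n y \<and>
           matrix_in_basis scale n y (\<pi> g) \<in> carrier (GL n Kbar) \<and>
           regular_semisimple (matrix_in_basis scale n y (\<pi> g))"
  shows "\<exists>x. is_basis scale n x \<and>
           (\<forall>g\<in>carrier G. matrix_in_basis scale n x (\<pi> g) \<in> carrier (GL n K)) \<and>
           zariski_dense_in_GL n Kbar
             {c \<cdot>\<^sub>m A | c A. c \<in> K - {0} \<and>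
                A \<in> Pi_hom scale n x \<pi> ` carrier (free_product G (sym_group n))}"
proof -
  note G = \<open>group G\<close> and irr = \<open>irreducible_representation G scale \<pi>\<close>
  interpret G: group G by (rule G)
  have K0: "complex_subfield K0" unfolding K0_def by (rule complex_subfield_cyclotomic)
  interpret K: complex_subfield K by (rule complex_subfield.intro) fact
  have \<pi>: "\<pi> \<in> hom G (GL_space scale)" using irr by (simp add: irreducible_representation_def)
  obtain t where t: "\<And>i. i \<in> {1..n} \<Longrightarrow> t i \<in> K" "algebraically_independent K0 {1..n} t"
    using assms(14) by blast
  obtain g y where g: "g \<in> carrier G" and y: "is_basis scale n y"
    and reg: "regular_semisimple (matrix_in_basis scale n y (\<pi> g))"
    using assms(15) by blast
  interpret Y: based_space scale n y
    by (intro based_space.intro based_space_axioms.intro y) fact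
  have n: "0 < n"
  proof (rule ccontr)
    assume "\<not> 0 < n"
    then have "(UNIV :: 'v set) = {0}" using Y.span by (simp add: One_nat_def)
    then show False using irr by (simp add: irreducible_representation_def)
  qed
  have roots: "w \<in> K0" if "w ^ m = 1" for w
    unfolding K0_def using that by (intro roots_of_unity_cyclotomic) (simp add: mult.commute power_mult)
  obtain v z where v: "based_space scale n v"
    and vK0: "\<And>h. h \<in> carrier G \<Longrightarrow> matrix_in_basis scale n v (\<pi> h) \<in> mat_space n K0"
    and vz: "matrix_in_basis scale n v (\<pi> g) = mat_diag n z" and inj_z: "inj_on z {..<n}"
    and z_nz: "\<And>i. i < n \<Longrightarrow> z i \<noteq> 0" and zK0: "\<And>i. i < n \<Longrightarrow> z i \<in> K0"
    using Y.rational_eigenbasis[OF G irr n \<open>0 < m\<close> assms(11) K0 roots g reg] by metis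
  interpret V: based_space scale n v by (rule v)
  have vK: "V.M (\<pi> h) \<in> mat_space n K" if "h \<in> carrier G" for h
    using vK0[OF that] \<open>K0 \<subseteq> K\<close> by (auto simp: mat_space_def)
  have goal: ?thesis
    if X: "matrix_group scale n x G K \<pi>"
      and dense: "zariski_closure n (matrix_group.scaled_image scale n x G K \<pi>) = carrier_mat n n" for x
  proof -
    interpret X: matrix_group scale n x G K \<pi> by (rule X)
    have KL: "K \<subseteq> Kbar" unfolding Kbar_def by (rule K.subset_algebraic_closure)
    have "subring Kbar complex_field"
      unfolding Kbar_def
      by (rule complex_subfield.subring[OF K.complex_subfield_algebraic_closure])
    from zariski_dense_in_GL_if_closure[OF this X.scaled_image_GL[OF KL] dense]
    have "zariski_dense_in_GL n Kbar X.scaled_image" .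
    moreover have "X.M (\<pi> h) \<in> carrier (GL n K)" if "h \<in> carrier G" for h
      using X.generators_in_scaled_image(1)[OF that] X.scaled_image_GL[OF subset_refl] by blast
    ultimately show ?thesis
      unfolding X.scaled_image_def using X.basis by blast
  qed
  show ?thesis
  proof (cases "n = 1")
    case True
    have X: "matrix_group scale n v G K \<pi>"
      by (intro matrix_group.intro matrix_group_axioms.intro v G K.complex_subfield_axioms \<pi> vK)
    show ?thesis
      by (rule goal[OF X matrix_group.scaled_image_dense_dim_one[OF X True]])
  next
    case False
    then have n2: "2 \<le> n" using n by simp
    \<comment> \<open>The base field here is \<open>K0\<close>: over it the \<open>t i\<close> are
      independent, and it contains the entries of the representation in the basis \<open>v\<close>.
      The eigenvalues \<open>C.l\<close> and the entries of \<open>C.P\<close> lie only in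
      \<open>K\<close>.\<close>
    interpret C: generic_data K0 n z t
      by (intro generic_data.intro generic_data_axioms.intro K0 n2 inj_z z_nz zK0 t(2))
    have lK: "C.l i \<in> K" if "i < n" for i
      unfolding C.l_def using that t(1) zK0 \<open>K0 \<subseteq> K\<close>
      by (auto intro!: K.divide_closed K.uminus_closed K.prod_closed)
    have PK: "C.P \<in> mat_space n K" "C.P' \<in> mat_space n K"
      using C.P_mat_space[OF K.complex_subfield_axioms _ lK] zK0 \<open>K0 \<subseteq> K\<close> by auto
    note P = C.P_carrier C.P_P' C.P'_P
    let ?x = "V.new_basis C.P"
    have conj: "matrix_in_basis scale n ?x (\<pi> h) = C.P' * V.M (\<pi> h) * C.P" if "h \<in> carrier G" for h
      by (rule V.matrix_in_new_basis[OF P GL_space_hom_linear(1)[OF \<pi> that]])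
    have X: "matrix_group scale n ?x G K \<pi>"
    proof (intro matrix_group.intro matrix_group_axioms.intro G K.complex_subfield_axioms \<pi>)
      show "based_space scale n ?x" by (rule V.based_space_new_basis[OF P])
      show "matrix_in_basis scale n ?x (\<pi> h) \<in> mat_space n K" if "h \<in> carrier G" for h
        unfolding conj[OF that] by (intro K.mult_mat_space PK vK that)
    qed
    interpret X: matrix_group scale n ?x G K \<pi> by (rule X)
    \<comment> \<open>The scaled image, transported from the basis \<open>?x\<close> back to the
      eigenbasis \<open>v\<close>, where the regular element is \<open>mat_diag n z\<close> and the
      transposition is \<open>C.R\<close>.\<close>
    define S where "S = (\<lambda>A. C.P * A * C.P') ` X.scaled_image"
    have unconj: "C.P * (C.P' * A * C.P) * C.P' = A" if "A \<in> carrier_mat n n" for A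
      by (rule conj_inverse_conj[OF P(3,1,2) that])
    have SG: "V.M (\<pi> h) \<in> S" if "h \<in> carrier G" for h
      unfolding S_def using X.generators_in_scaled_image(1)[OF that] unconj[OF V.M_carrier]
      by (metis conj[OF that] image_eqI)
    have "zariski_closure n S = carrier_mat n n"
    proof (rule C.dense_in_matrices[OF _ _ _ _ _ C.multiplicatively_independent])
      show "S \<subseteq> carrier_mat n n"
        unfolding S_def using X.scaled_image_carrier P(1,2) by (auto intro!: mult_carrier_mat[of _ n n])
      show "A * B \<in> S" if "A \<in> S" "B \<in> S" for A B
        using that conj_mult[OF P(4,2,1)] X.scaled_image_carrier X.scaled_image_mult
        unfolding S_def by (auto simp: subset_iff)
      show "mat_diag n z \<in> S" using SG[OF g] by (simp add: vz)
      show "C.R \<in> S"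
      proof -
        \<comment> \<open>Bases are numbered from 1, so this is the transposition of the matrix
          indices 0 and 1.\<close>
        let ?\<tau> = "Transposition.transpose (1 :: nat) 2"
        have \<tau>: "?\<tau> permutes {1..n}" using n2 by (intro permutes_swap_id) auto
        have "X.M (permutation_representation scale n ?x ?\<tau>) = C.P' * C.R * C.P"
          unfolding X.permutation_matrix[OF \<tau>] C.R_conj_P
          by (auto simp: Transposition.transpose_def intro!: eq_matI)
        then show ?thesis
          unfolding S_def using X.generators_in_scaled_image(2)[OF \<tau>] unconj[OF C.R_carrier]
          by (metis image_eqI)
      qed
      show "t n \<cdot>\<^sub>m A \<in> S" if A: "A \<in> S" for A
      proof -
        obtain B where B: "B \<in> X.scaled_image" "A = C.P * B * C.P'" using A by (auto simp: S_def)
        have "B \<in> carrier_mat n n" using B X.scaled_image_carrier by auto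
        then have "t n \<cdot>\<^sub>m A = C.P * (t n \<cdot>\<^sub>m B) * C.P'"
          using P(1,2) by (simp add: B(2) mult_smult_distrib[of _ n n _ n]
              mult_smult_assoc_mat[of _ n n _ n] mult_carrier_mat[of _ n n])
        moreover have "t n \<noteq> 0" using C.t_nonzero[of "n - 1"] n by simp
        ultimately show ?thesis
          unfolding S_def using X.scaled_image_smult[OF B(1), of "t n"] t(1)[of n] n by auto
      qed
      show "\<exists>A\<in>S. \<exists>A'\<in>S. A * A' = 1\<^sub>m n \<and> (\<forall>i<n. \<forall>j<n.
          (C.W' * A * C.W) $$ (i, j) \<noteq> 0 \<and> (C.W' * A' * C.W) $$ (i, j) \<noteq> 0)"
        if two: "n = 2" and z0: "z 0 + z 1 = 0"
      proof -
        obtain h where h: "h \<in> carrier G" "V.M (\<pi> h) $$ (0, 1) \<noteq> 0"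
          using V.irreducible_entry_nonzero[OF G irr, of 0 1] two by auto
        let ?A = "V.M (\<pi> h)" and ?A' = "V.M (\<pi> (inv\<^bsub>G\<^esub> h))"
        have h': "inv\<^bsub>G\<^esub> h \<in> carrier G" using h(1) by simp
        have AA': "?A * ?A' = 1\<^sub>m n"
          unfolding V.representation_matrix_mult[OF \<pi> h(1) h', symmetric] G.r_inv[OF h(1)]
            GL_space_hom_one[OF G \<pi>] by (rule V.M_id)
        \<comment> \<open>Were \<open>?A'\<close> diagonal, the entry (0, 1) of
          \<open>?A * ?A'\<close> would give \<open>?A' $$ (1, 1) = 0\<close>, contradicting the
          entry (1, 1).\<close>
        have "?A' $$ (0, 1) \<noteq> 0 \<or> ?A' $$ (1, 0) \<noteq> 0"
        proof (rule ccontr)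
          assume "\<not> ?thesis"
          then have *: "?A' $$ (0, 1) = 0" "?A' $$ (1, 0) = 0" by auto
          have "(?A * ?A') $$ (i, 1) = ?A $$ (i, 1) * ?A' $$ (1, 1)" if "i < 2" for i
          proof -
            have "{..<n} = {0, 1}" using two by auto
            then show ?thesis
              unfolding mat_mult_entries[OF V.M_carrier V.M_carrier] using that two * by simp
          qed
          from this[of 0, unfolded AA'] this[of 1, unfolded AA'] show False using h(2) two by simp
        qed
        moreover have "(C.W' * V.M (\<pi> k) * C.W) $$ (i, j) \<noteq> 0"
          if k: "k \<in> carrier G" "V.M (\<pi> k) $$ (0, 1) \<noteq> 0 \<or> V.M (\<pi> k) $$ (1, 0) \<noteq> 0"
            and ij: "i < n" "j < n" for k i j
          by (rule C.conj_entries_nonzero_if_two[OF two z0 _ k(2) K0 _ _ _ ij])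
            (use V.M_carrier vK0[OF k(1)] zK0 two C.quadratic_relation in auto)
        ultimately show ?thesis
          using AA' SG[OF h(1)] SG[OF h'] h h' by blast
      qed
    qed
    then have "zariski_closure n X.scaled_image = carrier_mat n n"
      unfolding S_def by (rule zariski_closure_conj[OF P(4,2,1) X.scaled_image_carrier])
    then show ?thesis by (rule goal[OF X])
  qed
qed

end
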